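(* Let $(G,q_1,\theta_1)$, $(\Gamma,q_2,\theta_2)$, $U=\{0,u_0\}$, $q_0$, $K_*=\{k_1,k_2\}$, $\Sigma_*=\{\sigma_1,\sigma_2\}$, $c$, $s$, $f$, $J$, $S$ be as in the context, and let $N_{x,y,z}=\sum_{w\in J}S_{w,x}S_{w,y}S_{w,z}/S_{(0,0),w}$ for $x,y,z\in J$. Then all the numbers $N_{x,y,z}$ (the fusion coefficients) are non-negative integers if and only if the following five conditions hold: (1) $|\Gamma|=|G|+4$; (2) $(1+\langle u_0,k\rangle)(1-s^2\langle k,k\rangle)=0$ for all $k\in K_*$; (3) $(1+\langle u_0,\sigma\rangle)(1+s^2\langle\sigma,\sigma\rangle)=0$ for all $\sigma\in\Sigma_*$; (4) if $G^{\theta_1}\cong\mathbb{Z}_4$, then $q_0(u_0)=-1$; (5) if $\Gamma^{\theta_2}\cong\mathbb{Z}_4$, then $q_0(u_0)=-1$. Under these conditions the (symmetric) coefficients are as follows, for $u,u',u''\in U$, $k,k',k''\in K_*$, $\sigma,\sigma',\sigma''\in\Sigma_*$, $g,g',g''\in G_*$, $\gamma,\gamma',\gamma''\in\Gamma_*$, $\varepsilon,\varepsilon',\varepsilon''\in\{1,-1\}$: $N_{(u,0),(u',0),(u'',0)}=N_{(u,0),(u',\pi),(u'',\pi)}=\delta_{u+u'+u'',0}$; $N_{(u,0),(u',0),z}=0$ for $z=(u'',\pi),(k,\varepsilon),g,(\sigma,\varepsilon),\gamma$; $N_{(u,0),(u',\pi),z}=0$ for $z=(k,\varepsilon),g,(\sigma,\varepsilon),\gamma$;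 $N_{(u,0),(k,\varepsilon),(k',\varepsilon')}=\delta_{u+k+k',0}\,\delta_{\varepsilon,\varepsilon'}$; $N_{(u,0),g,g'}=\delta_{u+g+g',0}+\delta_{u+g-g',0}$; $N_{(u,0),(\sigma,\varepsilon),(\sigma',\varepsilon')}=\delta_{u+\sigma+\sigma',0}\,\delta_{\varepsilon,\varepsilon'}$; $N_{(u,0),\gamma,\gamma'}=\delta_{u+\gamma+\gamma',0}+\delta_{u+\gamma-\gamma',0}$; $N_{(u,0),(k,\varepsilon),g}=N_{(u,0),(k,\varepsilon),(\sigma,\varepsilon')}=N_{(u,0),(k,\varepsilon),\gamma}=N_{(u,0),g,(\sigma,\varepsilon)}=N_{(u,0),g,\gamma}=N_{(u,0),(\sigma,\varepsilon),\gamma}=0$; $N_{(u,\pi),(u',\pi),(u'',\pi)}=2$; $N_{(u,\pi),(u',\pi),(k,\varepsilon)}=\frac{1+\langle k,u_0\rangle}{2}$; $N_{(u,\pi),(u',\pi),g}=1+\langle g,u_0\rangle$; $N_{(u,\pi),(u',\pi),(\sigma,\varepsilon)}=\frac{1+\langle\sigma,u_0\rangle}{2}$; $N_{(u,\pi),(u',\pi),\gamma}=1+\langle\gamma,u_0\rangle$; $N_{(u,\pi),(k,\varepsilon),(k',\varepsilon')}=\frac{1+\delta_{u+k+k',0}}{2}+\frac{\varepsilon\varepsilon's^2}{4}(\langle u+k+k',k_1\rangle-\langle u+k+k',\sigma_1\rangle)$; $N_{(u,\pi),(k,\varepsilon),g}=\frac{1+\langle k+g,u_0\rangle}{2}$;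 $N_{(u,\pi),(k,\varepsilon),(\sigma,\varepsilon')}=0$; $N_{(u,\pi),(k,\varepsilon),\gamma}=\frac{1+\langle k,u_0\rangle\langle\gamma,u_0\rangle}{2}$; $N_{(u,\pi),g,g'}=1+\langle g+g',u_0\rangle+\delta_{u+g+g',0}+\delta_{u+g+\theta(g'),0}$; $N_{(u,\pi),g,(\sigma,\varepsilon)}=\frac{1+\langle g,u_0\rangle\langle\sigma,u_0\rangle}{2}$; $N_{(u,\pi),g,\gamma}=1+\langle g,u_0\rangle\langle\gamma,u_0\rangle$; $N_{(u,\pi),(\sigma,\varepsilon),(\sigma',\varepsilon')}=\frac{1-\delta_{u+\sigma+\sigma',0}}{2}+\frac{\varepsilon\varepsilon's^2}{4}(\langle u+\sigma+\sigma',k_1\rangle-\langle u+\sigma+\sigma',\sigma\rangle)$; $N_{(u,\pi),(\sigma,\varepsilon),\gamma}=\frac{1+\langle\sigma+\gamma,u_0\rangle}{2}$; $N_{(u,\pi),\gamma,\gamma'}=1+\langle\gamma+\gamma',u_0\rangle-\delta_{u+\gamma+\gamma',0}-\delta_{u+\gamma+\theta(\gamma'),0}$; $N_{(k,\varepsilon),(k',\varepsilon'),(k'',\varepsilon'')}=\frac{(1+\langle u_0,k+k'+k''\rangle)(1+\varepsilon\varepsilon'+\varepsilon'\varepsilon''+\varepsilon''\varepsilon)}{8}$; $N_{(k,\varepsilon),(k',\varepsilon'),g}=\frac{(1+s^2\varepsilon\varepsilon'\overline{\langle k,k+k'+g\rangle})(1+\langle g,u_0\rangle)}{4}$; $N_{(k,\varepsilon),(k',\varepsilon'),(\sigma,\varepsilon'')}=\frac{(1+\langle\sigma,u_0\rangle)(1+\varepsilon\varepsilon'+\varepsilon''(\varepsilon+\varepsilon')\langle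 k+k',k\rangle sf(k,\sigma))}{8}$; $N_{(k,\varepsilon),(k',\varepsilon'),\gamma}=\frac{(1+\langle\gamma,u_0\rangle)(1-\varepsilon\varepsilon's^2\langle k-k',\sigma_1\rangle\overline{\langle\gamma,\sigma_1\rangle})}{4}$; $N_{(k,\varepsilon),g,g'}=\frac{1+\langle k+g+g',u_0\rangle}{2}+\delta_{k+g+g',0}+\delta_{k+g+\theta(g'),0}$; $N_{(k,\varepsilon),g,(\sigma,\varepsilon')}=\frac{(1+\varepsilon\varepsilon'sf(k,\sigma)\overline{\langle k+g,k\rangle})(1-\langle g,u_0\rangle)}{4}$; $N_{(k,\varepsilon),g,\gamma}=\frac{1+\langle k+g,u_0\rangle\langle\gamma,u_0\rangle}{2}$; $N_{(k,\varepsilon''),(\sigma,\varepsilon),(\sigma',\varepsilon')}=\frac{(1+\varepsilon\varepsilon'-\varepsilon''(\varepsilon+\varepsilon')sf(k,\sigma)\overline{\langle\sigma+\sigma',\sigma\rangle})(1+\langle k,u_0\rangle)}{8}$; $N_{(k,\varepsilon),(\sigma,\varepsilon'),\gamma}=\frac{(1-\varepsilon\varepsilon'sf(k,\sigma)\overline{\langle\sigma+\gamma,\sigma\rangle})(1-\langle\gamma,u_0\rangle)}{4}$; $N_{(k,\varepsilon),\gamma,\gamma'}=\frac{1+\langle k,u_0\rangle\langle\gamma+\gamma',u_0\rangle}{2}$; $N_{g,g',g''}=1+\langle g+g'+g'',u_0\rangle+\delta_{g+g'+g'',0}+\delta_{\theta(g)+g'+g'',0}+\delta_{g+\theta(g')+g'',0}+\delta_{g+g'+\theta(g''),0}$;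 $N_{g,g',(\sigma,\varepsilon)}=\frac{1+\langle g+g',u_0\rangle\langle\sigma,u_0\rangle}{2}$; $N_{g,g',\gamma}=1+\langle g+g',u_0\rangle\langle\gamma,u_0\rangle$; $N_{g,(\sigma,\varepsilon),(\sigma',\varepsilon')}=\frac{(1+\varepsilon\varepsilon's^2\overline{\langle g,k_1\rangle}\langle k_1,\sigma-\sigma'\rangle)(1+\langle g,u_0\rangle)}{4}$; $N_{g,(\sigma,\varepsilon),\gamma}=\frac{1+\langle g,u_0\rangle\langle\sigma+\gamma,u_0\rangle}{2}$; $N_{g,\gamma,\gamma'}=1+\langle g,u_0\rangle\langle\gamma+\gamma',u_0\rangle$; $N_{(\sigma,\varepsilon),(\sigma',\varepsilon'),(\sigma'',\varepsilon'')}=\frac{(1+\langle\sigma+\sigma'+\sigma'',u_0\rangle)(1+\varepsilon\varepsilon'+\varepsilon'\varepsilon''+\varepsilon''\varepsilon)}{8}$; $N_{(\sigma,\varepsilon),(\sigma',\varepsilon'),\gamma}=\frac{(1-\varepsilon\varepsilon's^2\overline{\langle\sigma+\sigma'+\gamma,\sigma\rangle})(1+\langle\sigma+\sigma'+\gamma,u_0\rangle)}{4}$; $N_{(\sigma,\varepsilon),\gamma,\gamma'}=\frac{1+\langle\sigma+\gamma+\gamma',u_0\rangle}{2}-\delta_{\sigma+\gamma+\gamma',0}-\delta_{\sigma+\gamma+\theta(\gamma'),0}$; $N_{\gamma,\gamma',\gamma''}=1+\langle\gamma+\gamma'+\gamma'',u_0\rangle-\delta_{\gamma+\gamma'+\g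amma'',0}-\delta_{\theta(\gamma)+\gamma'+\gamma'',0}-\delta_{\gamma+\theta(\gamma')+\gamma'',0}-\delta_{\gamma+\gamma'+\theta(\gamma''),0}$.
   Context: A metric group $(G,q)$ is a finite abelian group $G$ with a map $q:G\to\mathbb{T}=\{z\in\mathbb{C}:|z|=1\}$ such that $q(-g)=q(g)$ and $\langle g,h\rangle=q(g+h)q(g)^{-1}q(h)^{-1}$ is a non-degenerate bicharacter. $\mathcal{G}(q)=\frac{1}{\sqrt{|G|}}\sum_{g\in G}q(g)$. An involutive metric group $(G,q,\theta)$ is a metric group with $\theta\in\mathrm{Aut}(G)$, $\theta^2=\mathrm{id}$, $q\circ\theta=q$; $G^\theta$ is the fixed-point subgroup. Subscripts on $\langle\cdot,\cdot\rangle$ and $\theta$ are suppressed. Setting: $(G,q_1,\theta_1)$, $(\Gamma,q_2,\theta_2)$ are involutive metric groups with $c:=\mathcal{G}(q_1)=-\mathcal{G}(q_2)$ and $|G^{\theta_1}|=|\Gamma^{\theta_2}|=4$; $k_0\in G^{\theta_1}$ and $\sigma_0\in\Gamma^{\theta_2}$ are elements of order 2 with $q_1(k_0)=q_2(\sigma_0)$. Identify $\{0,k_0\}$ and $\{0,\sigma_0\}$ and denote both by $U=\{0,u_0\}$, a common subgroup of $G^{\theta_1}$ and $\Gamma^{\theta_2}$; $q_0$ is the restriction of $q_1$ (equivalently $q_2$) to $U$. (A pairing of an element of $U$ with an element of $G$, resp. $\Gamma$, is computed in $G$, resp. $\Gamma$; e.g. $k+k'$, $k-k'$, $\sigma+\sigma'$,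 $\sigma-\sigma'$ lie in $U$ for $k,k'\in K_*$, $\sigma,\sigma'\in\Sigma_*$ defined next.) Write $K_*=G^{\theta_1}\setminus\{0,k_0\}=\{k_1,k_2\}$, $\Sigma_*=\Gamma^{\theta_2}\setminus\{0,\sigma_0\}=\{\sigma_1,\sigma_2\}$. Assume one of: (A1) $q_1(k_1)=q_1(k_2)$, $q_2(\sigma_1)=-q_2(\sigma_2)$, and $s:=c/q_1(k_1)$ satisfies $s^4=1$; (A2) $q_1(k_1)=-q_1(k_2)$, $q_2(\sigma_1)=q_2(\sigma_2)$, and $s:=c/q_2(\sigma_1)$ satisfies $s^4=1$. (In either case $\langle u_0,u_0\rangle=1$, and $q_0(u_0)\in\{1,-1\}$.) Put $a=1/\sqrt{|G|}$, $b=1/\sqrt{|\Gamma|}$; fix $G_*\subset G$, $\Gamma_*\subset\Gamma$ with $G=G^{\theta_1}\sqcup G_*\sqcup\theta_1(G_* )$, $\Gamma=\Gamma^{\theta_2}\sqcup\Gamma_*\sqcup\theta_2(\Gamma_* )$. Let $J_1=K_*\times\{1,-1\}$, $J_2=\Sigma_*\times\{1,-1\}$, $J=(U\times\{0,\pi\})\sqcup J_1\sqcup G_*\sqcup J_2\sqcup\Gamma_*$. Fix a function $f:K_*\times\Sigma_*\to\{s,-s\}$ with $f(k+k_0,\sigma)=f(k,\sigma)\overline{\langle u_0,\sigma\rangle}$ and $f(k,\sigma+\sigma_0)=f(k,\sigma)\overline{\langle k,u_0\rangle}$. With blocks indexed in order by $U\times\{0\},U\times\{\pi\},J_1,G_*,J_2,\Gamma_*$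 (rows $u,u,(k,\varepsilon),g,(\sigma,\varepsilon),\gamma$; columns with primes): $$S=\begin{pmatrix} \frac{a-b}{2}\overline{\langle u,u'\rangle}&\frac{a+b}{2}\overline{\langle u,u'\rangle}&\frac{a}{2}\overline{\langle u,k'\rangle}&a\overline{\langle u,g'\rangle}&\frac{b}{2}\overline{\langle u,\sigma'\rangle}&b\overline{\langle u,\gamma'\rangle}\\ \frac{a+b}{2}\overline{\langle u,u'\rangle}&\frac{a-b}{2}\overline{\langle u,u'\rangle}&\frac{a}{2}\overline{\langle u,k'\rangle}&a\overline{\langle u,g'\rangle}&-\frac{b}{2}\overline{\langle u,\sigma'\rangle}&-b\overline{\langle u,\gamma'\rangle}\\ \frac{a}{2}\overline{\langle k,u'\rangle}&\frac{a}{2}\overline{\langle k,u'\rangle}&(\frac{a}{2}+\frac{\varepsilon\varepsilon's}{4})\overline{\langle k,k'\rangle}&a\overline{\langle k,g'\rangle}&\frac{\varepsilon\varepsilon'f(k,\sigma')}{4}&0\\ a\overline{\langle g,u'\rangle}&a\overline{\langle g,u'\rangle}&a\overline{\langle g,k'\rangle}&a(\overline{\langle g,g'\rangle}+\overline{\langle g,\theta(g')\rangle})&0&0\\ \frac{b}{2}\overline{\langle\sigma,u'\rangle}&-\frac{b}{2}\overline{\langle\sigma,u'\rangle}&\frac{\varepsilon\varepsilon'f(k',\sigma)}{4}&0&-(\frac{b}{2}-\frac{\varepsilon\varepsilon's}{4})\overline{\langle\sigma,\sigma'\rangle}&-b\overline{\langle\sigma,\gamma'\rangle}\\ b\overline{\langle\gamma,u'\rangle}&-b\overline{\langle\gamma,u'\rangle}&0&0&-b\overline{\langle\gamma,\sigma'\rangle}&-b(\overline{\langle\gamma,\gamma'\rangle}+\overline{\langle\gamma,\theta(\gamma')\rangle})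 \end{pmatrix}.$$
   Formalization: In N_{(u,0),g,g'} and N_{(u,0),γ,γ'}, δ_{u+g−g',0} is corrected to δ_{u+g+θ(g'),0} (same for γ); in N_{(u,0),(k,ε),(k',ε')} and its σ version, δ_{ε,ε'} is corrected to δ_{ε,s²ε'}. The printed forms fail for some θ≠−1 and for s²=−1. *)

theory Defs
  imports "HOL-Analysis.Analysis" "HOL-Library.Z2" "HOL-Algebra.Elementary_Groups"
begin

section \<open>Involutive metric groups\<close>

definition pairing :: "('a::ab_group_add \<Rightarrow> complex) \<Rightarrow> 'a \<Rightarrow> 'a \<Rightarrow> complex" where
  "pairing q g h = q (g + h) * inverse (q g) * inverse (q h)"

definition metric_group :: "('a::{ab_group_add,finite} \<Rightarrow> complex) \<Rightarrow> bool" where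
  "metric_group q \<longleftrightarrow>
     (\<forall>g. norm (q g) = 1) \<and>
     (\<forall>g. q (- g) = q g) \<and>
     (\<forall>g g' h. pairing q (g + g') h = pairing q g h * pairing q g' h) \<and>
     (\<forall>g h h'. pairing q g (h + h') = pairing q g h * pairing q g h') \<and>
     (\<forall>g. (\<forall>h. pairing q g h = 1) \<longrightarrow> g = 0)"

text \<open>The argument of \<open>inv_sqrt_order\<close> only serves to determine the group (its domain).\<close>

definition inv_sqrt_order :: "('a::finite \<Rightarrow> complex) \<Rightarrow> complex" where
  "inv_sqrt_order q = complex_of_real (1 / sqrt (real CARD('a)))"

definition gauss_sum :: "('a::{ab_group_add,finite} \<Rightarrow> complex) \<Rightarrow> complex" where
  "gauss_sum q = inv_sqrt_order q * (\<Sum>g\<in>UNIV. q g)"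

definition involutive_metric_group ::
    "('a::{ab_group_add,finite} \<Rightarrow> complex) \<Rightarrow> ('a \<Rightarrow> 'a) \<Rightarrow> bool" where
  "involutive_metric_group q \<theta> \<longleftrightarrow>
     metric_group q \<and>
     bij \<theta> \<and> (\<forall>g h. \<theta> (g + h) = \<theta> g + \<theta> h) \<and>
     \<theta> \<circ> \<theta> = id \<and> q \<circ> \<theta> = q"

definition fixed_points :: "('a \<Rightarrow> 'a) \<Rightarrow> 'a set" where
  "fixed_points \<theta> = {g. \<theta> g = g}"

text \<open>A subset of an additive group as a structure of HOL-Algebra.\<close>

definition additive_structure :: "'a::ab_group_add set \<Rightarrow> 'a monoid" where
  "additive_structure H = \<lparr>carrier = H, monoid.mult = (+), one = 0\<rparr>"

definition is_transversal :: "('a \<Rightarrow> 'a) \<Rightarrow> 'a set \<Rightarrow> bool" where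
  "is_transversal \<theta> R \<longleftrightarrow>
     UNIV = fixed_points \<theta> \<union> R \<union> \<theta> ` R \<and>
     fixed_points \<theta> \<inter> R = {} \<and> fixed_points \<theta> \<inter> \<theta> ` R = {} \<and> R \<inter> \<theta> ` R = {}"


section \<open>The common subgroup $U = \{0, u_0\}$\<close>

text \<open>
  The two-element group \<open>U\<close> obtained by identifying \<open>{0, k\<^sub>0}\<close> with \<open>{0, \<sigma>\<^sub>0}\<close> is the type
  \<^typ>\<open>bit\<close>, with \<open>u\<^sub>0 = 1\<close>.  The inclusion of \<open>U\<close> in a group, sending \<open>u\<^sub>0\<close> to \<open>t\<close>, is
  \<open>from_U t\<close>; \<open>to_U\<close> is its inverse and is only meaningful on \<open>{0, t}\<close>.
\<close>

definition from_U :: "'a::zero \<Rightarrow> bit \<Rightarrow> 'a" where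
  "from_U t u = (if u = 0 then 0 else t)"

definition to_U :: "'a::zero \<Rightarrow> bit" where
  "to_U x = (if x = 0 then 0 else 1)"


section \<open>The matrix $S$ and the fusion coefficients\<close>

text \<open>
  Labels of the rows and columns of \<open>S\<close>: \<open>LZero u\<close> and \<open>LPi u\<close> stand for \<open>(u, 0)\<close> and \<open>(u, \<pi>)\<close>,
  and the signs \<open>\<epsilon>\<close> in \<open>LK k \<epsilon>\<close> and \<open>LSig \<sigma> \<epsilon>\<close> are the complex numbers \<open>1\<close> and \<open>-1\<close>.
\<close>

datatype ('g, 'h) label =
    LZero bit
  | LPi bit
  | LK 'g complex
  | LG 'g
  | LSig 'h complex
  | LGam 'h

locale S_matrix =
  fixes q\<^sub>1 :: "'g::{ab_group_add,finite} \<Rightarrow> complex" and \<theta>\<^sub>1 :: "'g \<Rightarrow> 'g"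
    and k\<^sub>0 :: 'g and Gs :: "'g set"
    and q\<^sub>2 :: "'h::{ab_group_add,finite} \<Rightarrow> complex" and \<theta>\<^sub>2 :: "'h \<Rightarrow> 'h"
    and \<sigma>\<^sub>0 :: 'h and \<Gamma>s :: "'h set"
    and s :: complex and f :: "'g \<Rightarrow> 'h \<Rightarrow> complex"
begin

abbreviation a :: complex where "a \<equiv> inv_sqrt_order q\<^sub>1"
abbreviation b :: complex where "b \<equiv> inv_sqrt_order q\<^sub>2"

abbreviation cG :: "'g \<Rightarrow> 'g \<Rightarrow> complex" where "cG x y \<equiv> cnj (pairing q\<^sub>1 x y)"
abbreviation c\<Gamma> :: "'h \<Rightarrow> 'h \<Rightarrow> complex" where "c\<Gamma> x y \<equiv> cnj (pairing q\<^sub>2 x y)"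

abbreviation iG :: "bit \<Rightarrow> 'g" where "iG \<equiv> from_U k\<^sub>0"
abbreviation i\<Gamma> :: "bit \<Rightarrow> 'h" where "i\<Gamma> \<equiv> from_U \<sigma>\<^sub>0"

fun S :: "('g, 'h) label \<Rightarrow> ('g, 'h) label \<Rightarrow> complex" where
  "S (LZero u) (LZero u') = (a - b) / 2 * cG (iG u) (iG u')"
| "S (LZero u) (LPi u') = (a + b) / 2 * cG (iG u) (iG u')"
| "S (LZero u) (LK k' \<epsilon>') = a / 2 * cG (iG u) k'"
| "S (LZero u) (LG g') = a * cG (iG u) g'"
| "S (LZero u) (LSig \<sigma>' \<epsilon>') = b / 2 * c\<Gamma> (i\<Gamma> u) \<sigma>'"
| "S (LZero u) (LGam \<gamma>') = b * c\<Gamma> (i\<Gamma> u) \<gamma>'"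

| "S (LPi u) (LZero u') = (a + b) / 2 * cG (iG u) (iG u')"
| "S (LPi u) (LPi u') = (a - b) / 2 * cG (iG u) (iG u')"
| "S (LPi u) (LK k' \<epsilon>') = a / 2 * cG (iG u) k'"
| "S (LPi u) (LG g') = a * cG (iG u) g'"
| "S (LPi u) (LSig \<sigma>' \<epsilon>') = - b / 2 * c\<Gamma> (i\<Gamma> u) \<sigma>'"
| "S (LPi u) (LGam \<gamma>') = - b * c\<Gamma> (i\<Gamma> u) \<gamma>'"

| "S (LK k \<epsilon>) (LZero u') = a / 2 * cG k (iG u')"
| "S (LK k \<epsilon>) (LPi u') = a / 2 * cG k (iG u')"
| "S (LK k \<epsilon>) (LK k' \<epsilon>') = (a / 2 + \<epsilon> * \<epsilon>' * s / 4) * cG k k'"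
| "S (LK k \<epsilon>) (LG g') = a * cG k g'"
| "S (LK k \<epsilon>) (LSig \<sigma>' \<epsilon>') = \<epsilon> * \<epsilon>' * f k \<sigma>' / 4"
| "S (LK k \<epsilon>) (LGam \<gamma>') = 0"

| "S (LG g) (LZero u') = a * cG g (iG u')"
| "S (LG g) (LPi u') = a * cG g (iG u')"
| "S (LG g) (LK k' \<epsilon>') = a * cG g k'"
| "S (LG g) (LG g') = a * (cG g g' + cG g (\<theta>\<^sub>1 g'))"
| "S (LG g) (LSig \<sigma>' \<epsilon>') = 0"
| "S (LG g) (LGam \<gamma>') = 0"

| "S (LSig \<sigma> \<epsilon>) (LZero u') = b / 2 * c\<Gamma> \<sigma> (i\<Gamma> u')"
| "S (LSig \<sigma> \<epsilon>) (LPi u') = - b / 2 * c\<Gamma> \<sigma> (i\<Gamma> u')"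
| "S (LSig \<sigma> \<epsilon>) (LK k' \<epsilon>') = \<epsilon> * \<epsilon>' * f k' \<sigma> / 4"
| "S (LSig \<sigma> \<epsilon>) (LG g') = 0"
| "S (LSig \<sigma> \<epsilon>) (LSig \<sigma>' \<epsilon>') = - (b / 2 - \<epsilon> * \<epsilon>' * s / 4) * c\<Gamma> \<sigma> \<sigma>'"
| "S (LSig \<sigma> \<epsilon>) (LGam \<gamma>') = - b * c\<Gamma> \<sigma> \<gamma>'"

| "S (LGam \<gamma>) (LZero u') = b * c\<Gamma> \<gamma> (i\<Gamma> u')"
| "S (LGam \<gamma>) (LPi u') = - b * c\<Gamma> \<gamma> (i\<Gamma> u')"
| "S (LGam \<gamma>) (LK k' \<epsilon>') = 0"
| "S (LGam \<gamma>) (LG g') = 0"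
| "S (LGam \<gamma>) (LSig \<sigma>' \<epsilon>') = - b * c\<Gamma> \<gamma> \<sigma>'"
| "S (LGam \<gamma>) (LGam \<gamma>') = - b * (c\<Gamma> \<gamma> \<gamma>' + c\<Gamma> \<gamma> (\<theta>\<^sub>2 \<gamma>'))"

definition J :: "('g, 'h) label set" where
  "J = range LZero \<union> range LPi \<union>
       {LK k \<epsilon> | k \<epsilon>. k \<in> fixed_points \<theta>\<^sub>1 - {0, k\<^sub>0} \<and> \<epsilon> \<in> {1, -1}} \<union>
       LG ` Gs \<union>
       {LSig \<sigma> \<epsilon> | \<sigma> \<epsilon>. \<sigma> \<in> fixed_points \<theta>\<^sub>2 - {0, \<sigma>\<^sub>0} \<and> \<epsilon> \<in> {1, -1}} \<union>
       LGam ` \<Gamma>s"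

text \<open>
  \<open>S (LZero 0) w\<close> vanishes for some \<open>w \<in> J\<close> only if \<open>a = b\<close>, i.e. if the two groups have the same
  order; the quotient is then \<open>0\<close> by the convention \<open>x / 0 = 0\<close>.
\<close>

definition N :: "('g, 'h) label \<Rightarrow> ('g, 'h) label \<Rightarrow> ('g, 'h) label \<Rightarrow> complex" where
  "N x y z = (\<Sum>w\<in>J. S w x * S w y * S w z / S (LZero 0) w)"

end

end

(*
  Column x of S splits into a function \<xi> x on G, a function \<omega> x on \<Gamma> (each a sum of characters
  over a \<theta>-orbit) and functions \<psi> x on K, \<phi> x on \<Sigma> which carry the signs \<epsilon>.  Summing over all
  rows, completing the sums over G and \<Gamma>, gives for |G| \<noteq> |\<Gamma>|
    N x y z = (T x y z) / 2 + \<kappa> / 2 * (sum over U of the product of the \<xi> + \<omega>) + 2 * (W x y z)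
  with \<kappa> = 1 / (|\<Gamma>| - |G|).  Orthogonality of characters turns T into Kronecker deltas, and W is a sum
  over the two-element sets K and \<Sigma>, so every coefficient becomes a finite computation with signs.
  Since <u0,k> = - <u0,\<sigma>> = \<alpha> is a sign, either all k or all \<sigma> pair trivially with u0; the
  coefficients with three labels in K (resp. \<Sigma>) then read 1 / (|\<Gamma>| - |G|) + 3\<delta>/4 and
  1 / (|\<Gamma>| - |G|) - \<delta>/4 for a sign \<delta>, and integrality forces |\<Gamma>| = |G| + 4 and \<delta> = 1.
*)
theory Submission
  imports Defs
begin

section \<open>Signs and natural numbers\<close>

text \<open>The sign \<alpha> comes from q(x + u0) = q(u0) <u0,x> q(x): the ratio of the two values
  of q on K is q0(u0) <u0,k>, on \<Sigma> it is q0(u0) <u0,\<sigma>>. (A1) and (A2) both say that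
  one ratio is 1 and the other -1, so both are treated at once. If 2k = u0, then q0(u0) = <u0,k>;
  thus (4) and (5) become conditions on \<alpha>, and for either value of \<alpha> the conditions on
  only one of the two groups have content. They matter because <k,x> is a sign only if 2k = 0 or
  <u0,x> = 1; otherwise it is a primitive fourth root of unity. The rows (u,0) and (u,\<pi>) have
  the denominators (a - b)/2 and (a + b)/2; bringing them together produces \<kappa> = a^2 b^2 /
  (a^2 - b^2). For a = b a denominator is 0 and this formula is lost, so equal orders are excluded
  by a coefficient of their own, 1 - 2/|G|. In the final step integrality alone would also admit
  |\<Gamma>| = |G| - 4 with \<delta> = -1; non-negativity removes this mirror solution.\<close>

definition is_sign :: "complex \<Rightarrow> bool" where
  "is_sign x \<longleftrightarrow> x = 1 \<or> x = -1"

lemma is_sign_mult: "is_sign x \<Longrightarrow> is_sign y \<Longrightarrow> is_sign (x * y)"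
  by (auto simp: is_sign_def)

lemma is_sign_cnj: "is_sign x \<Longrightarrow> cnj x = x"
  by (auto simp: is_sign_def)

lemma is_sign_uminus: "is_sign (- x) \<longleftrightarrow> is_sign x"
  by (auto simp: is_sign_def minus_equation_iff)

lemma is_sign_cnj_iff: "is_sign (cnj x) \<longleftrightarrow> is_sign x"
  using complex_cnj_cancel_iff[of x 1] complex_cnj_cancel_iff[of x "-1"] by (simp add: is_sign_def)

lemma of_bool_in_Nats: "of_bool P \<in> \<nat>"
  by (cases P) simp_all

lemma sign_in_Nats:
  assumes "is_sign x"
  shows "1 + x \<in> \<nat>" "(1 + x) / 2 \<in> \<nat>"
  using assms by (auto simp: is_sign_def)

text \<open>For y = -1 the product is 0 whatever x is. The guard matters because x will contain a
  pairing <k,z> or <\<sigma>,z>, which is known to be a sign only when the factor 1 + y does not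
  vanish.\<close>

lemma quarter_in_Nats:
  assumes "is_sign y" "y = 1 \<Longrightarrow> is_sign x"
  shows "(1 + x) * (1 + y) / 4 \<in> \<nat>"
  using assms by (auto simp: is_sign_def)

text \<open>The second factor is 4 if the three signs agree and 0 otherwise; the first is 0 or
  2.\<close>

lemma eighth_in_Nats:
  assumes "is_sign y" "\<epsilon> \<in> {1, -1}" "\<epsilon>' \<in> {1, -1}" "\<epsilon>'' \<in> {1, -1}"
  shows "(1 + y) * (1 + \<epsilon> * \<epsilon>' + \<epsilon>' * \<epsilon>'' + \<epsilon>'' * \<epsilon>) / 8 \<in> \<nat>"
  using assms by (auto simp: is_sign_def)

text \<open>The same expression with x as third sign; in the applications x is a label's sign times
  a pairing times s f.\<close>

lemma eighth_in_Nats':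
  assumes "is_sign y" "\<epsilon> \<in> {1, -1}" "\<epsilon>' \<in> {1, -1}" "is_sign x"
  shows "(1 + y) * (1 + \<epsilon> * \<epsilon>' + (\<epsilon> + \<epsilon>') * x) / 8 \<in> \<nat>"
  using assms by (auto simp: is_sign_def)

text \<open>On \<Gamma> the deltas enter with a minus sign. A delta that fires makes the pairing x
  equal to 1, so the main term is 2 or 1; 2 absorbs two deltas, 1 absorbs only one, hence the
  exclusion in the second claim.\<close>

lemma deltas_in_Nats:
  assumes "is_sign x" "P \<or> Q \<Longrightarrow> x = 1"
  shows "1 + x - of_bool P - of_bool Q \<in> \<nat>" "\<not> (P \<and> Q) \<Longrightarrow> (1 + x) / 2 - of_bool P - of_bool Q \<in> \<nat>"
  using assms by (auto simp: is_sign_def of_bool_def)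

text \<open>Clearing denominators in the second number gives 4 = d (4 l + e), so d divides 4 and
  finitely many pairs remain. The pair d = -4, \<delta> = -1 also makes both numbers integers; it is
  discarded because the first one is then -1.\<close>

lemma reciprocal_plus_quarter_in_Nats:
  fixes d :: int and \<delta> :: complex
  assumes d: "d \<noteq> 0" and \<delta>: "is_sign \<delta>"
    and 1: "1 / of_int d + 3 * \<delta> / 4 \<in> \<nat>" and 2: "1 / of_int d - \<delta> / 4 \<in> \<nat>"
  shows "d = 4 \<and> \<delta> = 1"
proof -
  obtain e :: int where e: "\<delta> = of_int e" "e = 1 \<or> e = -1"
    using \<delta> unfolding is_sign_def by (metis of_int_1 of_int_minus)
  obtain m where m: "1 / of_int d + 3 * \<delta> / 4 = of_nat m"
    using 1 by (rule Nats_cases)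
  obtain l where l: "1 / of_int d - \<delta> / 4 = of_nat l"
    using 2 by (rule Nats_cases)
  have "of_int (4 + 3 * e * d) = (of_int (4 * int m * d) :: complex)"
    using m d unfolding e by (simp add: field_simps)
  then have m': "4 + 3 * e * d = 4 * int m * d"
    by (simp only: of_int_eq_iff)
  have "of_int (4 - e * d) = (of_int (4 * int l * d) :: complex)"
    using l d unfolding e by (simp add: field_simps)
  then have l': "4 - e * d = 4 * int l * d"
    by (simp only: of_int_eq_iff)
  have "4 = d * (4 * int l + e)"
    using l' by (simp add: algebra_simps)
  then have "d dvd 4"
    by (rule dvdI)
  then have "\<bar>d\<bar> \<le> 4"
    using dvd_imp_le_int[of 4 d] by simp
  then have "d \<in> {-4, -3, -2, -1, 1, 2, 3, 4}"
    using d by auto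
  then have "d = 4 \<and> e = 1"
    using e(2) m' l' by (elim insertE emptyE disjE; simp; presburger)
  then show ?thesis
    using e(1) by simp
qed

lemma half_not_in_Nats: "1 / 2 \<notin> (\<nat> :: complex set)"
proof
  assume "1 / 2 \<in> (\<nat> :: complex set)"
  then obtain m where "1 / 2 = (of_nat m :: complex)"
    by (rule Nats_cases)
  then have "of_nat (2 * m) = (of_nat 1 :: complex)"
    by (simp add: field_simps)
  then have "2 * m = 1"
    by (simp only: of_nat_eq_iff)
  then show False
    by presburger
qed

section \<open>One involutive metric group\<close>

text \<open>The element t plays the role of u0, and everything here serves G and \<Gamma> alike.
  \<open>q_fixed\<close> is what (A1) and (A2) have in common when seen from a single group: q is
  constant up to sign on the nontrivial coset of U.\<close>

locale metric_side =
  fixes q :: "'a::{ab_group_add,finite} \<Rightarrow> complex" and \<theta> :: "'a \<Rightarrow> 'a"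
    and t :: 'a and R :: "'a set"
  assumes inv: "involutive_metric_group q \<theta>"
    and card_fix: "card (fixed_points \<theta>) = 4"
    and t_fix: "t \<in> fixed_points \<theta>" and t_nonzero: "t \<noteq> 0" and t_double: "t + t = 0"
    and q_fixed: "k \<in> fixed_points \<theta> - {0, t} \<Longrightarrow> k' \<in> fixed_points \<theta> - {0, t} \<Longrightarrow> q k' = q k \<or> q k' = - q k"
    and transversal: "is_transversal \<theta> R"
begin

abbreviation p :: "'a \<Rightarrow> 'a \<Rightarrow> complex" where "p \<equiv> pairing q"
abbreviation F :: "'a set" where "F \<equiv> fixed_points \<theta>"
abbreviation Fs :: "'a set" where "Fs \<equiv> fixed_points \<theta> - {0, t}"

section \<open>Identities for the pairing and the involution\<close>

lemma metric: "metric_group q"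
  using inv by (simp add: involutive_metric_group_def)

lemma norm_q: "norm (q x) = 1"
  using metric by (simp add: metric_group_def)

lemma q_nonzero: "q x \<noteq> 0"
  using norm_q[of x] by auto

lemma q_uminus: "q (- x) = q x"
  using metric by (simp add: metric_group_def)

lemma p_add_left: "p (x + y) z = p x z * p y z"
  using metric by (simp add: metric_group_def)

lemma p_add_right: "p z (x + y) = p z x * p z y"
  using metric by (simp add: metric_group_def)

lemma p_sym: "p x y = p y x"
  by (simp add: pairing_def add.commute mult_ac)

lemma norm_p: "norm (p x y) = 1"
  by (simp add: pairing_def norm_mult norm_inverse norm_q)

lemma p_nonzero: "p x y \<noteq> 0"
  using norm_p[of x y] by auto

lemma p_0_left: "p 0 x = 1"
  using p_add_left[of 0 0 x] p_nonzero[of 0 x] by simp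

lemma p_0_right: "p x 0 = 1"
  using p_sym[of x 0] p_0_left[of x] by simp

lemma q_0: "q 0 = 1"
  using p_0_left[of 0] q_nonzero[of 0] by (simp add: pairing_def)

lemma q_add: "q (x + y) = q x * q y * p x y"
  using q_nonzero[of x] q_nonzero[of y] by (simp add: pairing_def field_simps)

lemma theta_add: "\<theta> (x + y) = \<theta> x + \<theta> y"
  using inv by (simp add: involutive_metric_group_def)

lemma theta_theta: "\<theta> (\<theta> x) = x"
  using inv by (simp add: involutive_metric_group_def pointfree_idE)

lemma q_theta: "q (\<theta> x) = q x"
proof -
  have "q \<circ> \<theta> = q" using inv by (simp add: involutive_metric_group_def)
  then show ?thesis by (simp add: fun_eq_iff)
qed

lemma p_theta_theta: "p (\<theta> x) (\<theta> y) = p x y"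
  by (simp add: pairing_def q_theta flip: theta_add)

lemma theta_0: "\<theta> 0 = 0"
  using theta_add[of 0 0] by simp

lemma theta_eq_0: "\<theta> x = 0 \<longleftrightarrow> x = 0"
  using theta_theta[of x] theta_0 by auto

lemma p_theta_left: "p (\<theta> x) y = p x (\<theta> y)"
  using p_theta_theta[of x "\<theta> y"] by (simp add: theta_theta)

lemma p_fixed_theta: "x \<in> F \<Longrightarrow> p x (\<theta> y) = p x y"
  using p_theta_theta[of x y] by (simp add: fixed_points_def)

lemma F_0: "0 \<in> F"
  by (simp add: fixed_points_def theta_0)

lemma F_add: "x \<in> F \<Longrightarrow> y \<in> F \<Longrightarrow> x + y \<in> F"
  by (simp add: fixed_points_def theta_add)

lemma F_uminus: "x \<in> F \<Longrightarrow> - x \<in> F"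
proof -
  have "\<theta> (- x) + \<theta> x = 0"
    using theta_add[of "- x" x] by (simp add: theta_0)
  then show "x \<in> F \<Longrightarrow> - x \<in> F"
    by (simp add: fixed_points_def add_eq_0_iff2)
qed

lemma is_sign_p_t: "is_sign (p t x)"
proof -
  have "p t x * p t x = 1"
    using p_add_left[of t t x] by (simp add: t_double p_0_left)
  then show ?thesis
    by (simp add: is_sign_def square_eq_1_iff)
qed

text \<open>Non-degeneracy gives y with <y,x> different from 1; translating the summation variable
  by y multiplies the sum by the conjugate of that value.\<close>

lemma sum_character: "(\<Sum>h\<in>UNIV. cnj (p h x)) = of_nat CARD('a) * of_bool (x = 0)"
proof (cases "x = 0")
  case False
  then have "\<exists>y. p x y \<noteq> 1"
    using metric unfolding metric_group_def by blast
  then obtain y where y: "p y x \<noteq> 1"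
    using p_sym[of x] by auto
  have "(\<Sum>h\<in>UNIV. cnj (p h x)) = (\<Sum>h\<in>UNIV. cnj (p (y + h) x))"
    by (rule sum.reindex_bij_betw[symmetric]) (simp add: bij_betw_def)
  also have "\<dots> = cnj (p y x) * (\<Sum>h\<in>UNIV. cnj (p h x))"
    by (simp add: p_add_left sum_distrib_left)
  finally have "(cnj (p y x) - 1) * (\<Sum>h\<in>UNIV. cnj (p h x)) = 0"
    by (simp add: algebra_simps)
  with y False show ?thesis
    by simp
qed (simp add: p_0_right)

section \<open>The group of fixed points, of order four\<close>

lemma Fs_eq:
  assumes "k \<in> Fs"
  shows "Fs = {k, k + t}" "k + t \<noteq> k"
proof -
  show 1: "k + t \<noteq> k"
    using t_nonzero by simp
  have "k + t \<noteq> 0"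
  proof
    assume "k + t = 0"
    then have "k + t = t + t" using t_double by simp
    then show False using assms by simp
  qed
  then have sub: "{0, t, k, k + t} \<subseteq> F"
    using assms F_0 t_fix F_add by auto
  have ne: "0 \<noteq> t" "0 \<noteq> k" "t \<noteq> k" "0 \<noteq> k + t" "t \<noteq> k + t" "k \<noteq> k + t"
    using assms 1 t_nonzero \<open>k + t \<noteq> 0\<close> by auto
  then have "card {0, t, k, k + t} = 4"
    by (simp add: card_insert_if)
  then have "{0, t, k, k + t} = F"
    using sub card_fix by (intro card_subset_eq) simp_all
  then have "Fs = {0, t, k, k + t} - {0, t}"
    by simp
  also have "\<dots> = {k, k + t}"
    using ne by auto
  finally show "Fs = {k, k + t}" .
qed

lemma Fs_add_t:
  assumes "k \<in> Fs"
  shows "k + t \<in> Fs"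
  unfolding Fs_eq(1)[OF assms] by simp

lemma Fs_cases:
  assumes "k \<in> Fs" "k' \<in> Fs"
  shows "k' = k \<or> k' = k + t"
  using assms(2) unfolding Fs_eq(1)[OF assms(1)] by simp

lemma Fs_nonempty: "\<exists>k. k \<in> Fs"
proof (rule ccontr)
  assume "\<not> ?thesis"
  then have "F \<subseteq> {0, t}"
    by blast
  then have "card F \<le> card {0, t}"
    by (intro card_mono) simp_all
  with card_fix t_nonzero show False
    by simp
qed

lemma card_Fs: "card Fs = 2"
proof -
  have "card Fs = card F - card {0, t}"
    using F_0 t_fix by (intro card_Diff_subset) simp_all
  then show ?thesis
    using card_fix t_nonzero by simp
qed

text \<open>F modulo {0, t} has order 2, so doubling lands in {0, t}. F is a Klein four-group if 2k
  = 0 and cyclic with t = 2k otherwise.\<close>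

lemma Fs_double:
  assumes "k \<in> Fs"
  shows "k + k = 0 \<or> k + k = t"
proof -
  have "k + k \<in> F" using assms F_add by simp
  moreover have "k + k \<notin> {k, k + t}" using assms by auto
  ultimately show ?thesis unfolding Fs_eq(1)[OF assms, symmetric] by simp
qed

lemma Fs_add_Fs: "k \<in> Fs \<Longrightarrow> k' \<in> Fs \<Longrightarrow> k + k' = 0 \<or> k + k' = t"
  using Fs_double[of k] Fs_cases[of k k'] t_double by (auto simp flip: add.assoc)

text \<open>Comparing q(k + t) = q(k) q(t) <k,t> with the two values q(k) and -q(k) allowed by
  \<open>q_fixed\<close> shows that q(t) <k,t> is a sign, hence q(t) is one; then 1 = q(2t) = q(t)^2
  <t,t>.\<close>

lemma pairing_t_t: "p t t = 1"
proof -
  obtain k where k: "k \<in> Fs"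
    using Fs_nonempty by blast
  have "q (k + t) = q k \<or> q (k + t) = - q k"
    using q_fixed[OF k Fs_add_t[OF k]] .
  then have "q t * p k t = 1 \<or> q t * p k t = -1"
    using q_nonzero[of k] mult_left_cancel[of "q k" "q t * p k t" "-1"] by (simp add: q_add mult.assoc)
  then have "(q t * p k t) * (q t * p k t) = 1"
    by (elim disjE) simp_all
  moreover have "p k t * p k t = 1"
    using is_sign_p_t[of k] by (auto simp: is_sign_def p_sym[of k t])
  ultimately have "q t * q t = 1"
    by (simp add: mult_ac)
  then show ?thesis
    using q_add[of t t] by (simp add: t_double q_0)
qed

lemma p_t_add_t: "p t (k + t) = p t k"
  by (simp add: p_add_right pairing_t_t)

lemma sum_Fs: "k \<in> Fs \<Longrightarrow> (\<Sum>h\<in>Fs. f h) = f k + (f (k + t) :: complex)"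
  using Fs_eq[of k] by simp

text \<open>From 1 = q(k - k) = q(k)^2 <k,-k> one gets <k,k> = q(k)^2, and so q(t) = q(k)^2 <k,k> =
  <k,k>^2 = <t,k>. This translates the cyclic conditions, which speak of q0(u0), into conditions on
  \<alpha>.\<close>

lemma q_t_of_double: 
  assumes "k \<in> Fs" "k + k = t"
  shows "q t = p t k"
proof -
  have "1 = q k * q k * p k (- k)"
    using q_add[of k "- k"] by (simp add: q_0 q_uminus)
  moreover have "p k k * p k (- k) = 1"
    using p_add_right[of k k "- k"] by (simp add: p_0_right)
  ultimately have "p k k = q k * q k"
    using p_nonzero[of k "-k"] by (metis mult_right_cancel)
  moreover have "q t = q k * q k * p k k"
    using assms q_add[of k k] by simp
  moreover have "p t k = p k k * p k k"
    using assms p_add_left[of k k k] by simp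
  ultimately show ?thesis by simp
qed

text \<open>The square of <k,x> is <2k,x>, which is 1 if 2k = 0 and <t,x> if 2k = t.\<close>

lemma is_sign_p:
  assumes "k \<in> Fs" "k + k \<noteq> 0 \<Longrightarrow> p t x = 1"
  shows "is_sign (p k x)"
proof -
  have "p k x * p k x = p (k + k) x"
    by (simp add: p_add_left)
  also have "\<dots> = 1"
    using Fs_double[OF assms(1)] assms(2) t_nonzero by (auto simp: p_0_left)
  finally show ?thesis
    by (simp add: is_sign_def square_eq_1_iff)
qed

lemma q_t_eq:
  assumes "k \<in> Fs"
  shows "q (k + t) = q t * p t k * q k"
  by (simp add: q_add p_sym[of k t] mult_ac)

text \<open>A group of order 4 is cyclic iff some element is not killed by 2. In F such an element
  lies in \<open>Fs\<close>, and there all doubles coincide because 2t = 0, so a single k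
  decides.\<close>

lemma cyclic_iff:
  assumes k: "k \<in> Fs"
  shows "additive_structure F \<cong> integer_mod_group 4 \<longleftrightarrow> k + k \<noteq> 0"
proof
  assume "additive_structure F \<cong> integer_mod_group 4"
  then obtain h where h: "h \<in> hom (additive_structure F) (integer_mod_group 4)"
    and bij: "bij_betw h F (carrier (integer_mod_group 4))"
    by (auto simp: is_iso_def iso_def additive_structure_def)
  have add: "h (x + y) = (h x + h y) mod 4" if "x \<in> F" "y \<in> F" for x y
    using hom_mult[OF h] that by (simp add: additive_structure_def mult_integer_mod_group)
  have "1 \<in> carrier (integer_mod_group 4)"
    by (simp add: carrier_integer_mod_group)
  then have "1 \<in> h ` F"
    using bij by (simp add: bij_betw_def)
  then obtain x where x: "x \<in> F" "h x = 1"
    by auto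
  have "h 0 \<in> {0..<4}"
    using bij F_0 by (auto simp: bij_betw_def carrier_integer_mod_group)
  then have h0: "h 0 = 0"
    using add[OF F_0 F_0] by simp presburger
  have xx: "x + x \<noteq> 0"
    using add[OF x(1) x(1)] x(2) h0 by auto
  then have "x \<in> Fs"
    using x(1) t_double by auto
  then show "k + k \<noteq> 0"
    using Fs_cases[OF k, of x] xx t_double by (auto simp: add.assoc add.left_commute[of t])
next
  assume "k + k \<noteq> 0"
  then have kk: "k + k = t"
    using Fs_double[OF k] by simp
  then have add: "k + (k + x) = t + x" "t + (t + x) = x" for x
    by (simp_all add: t_double flip: add.assoc)
  have F_eq: "F = {0, t, k, k + t}"
    using Fs_eq[OF k] F_0 t_fix by blast
  have ne: "t \<noteq> 0" "k \<noteq> 0" "k \<noteq> t" "k + t \<noteq> 0" "t \<noteq> k"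
    using Fs_add_t[OF k] k t_nonzero by auto
  \<comment> \<open>The discrete logarithm to the base k: the multiples 0, k, 2k = t and 3k = k + t
    go to 0, 1, 2, 3.\<close>
  define h :: "'a \<Rightarrow> int" where "h = (\<lambda>x. if x = 0 then 0 else if x = k then 1 else if x = t then 2 else 3)"
  have h: "h 0 = 0" "h k = 1" "h t = 2" "h (k + t) = 3" "h (t + k) = 3"
    using ne by (simp_all add: h_def add.commute)
  have im: "h ` F = {0..<4}"
    unfolding F_eq by (auto simp: h)
  then have inj: "inj_on h F"
    using card_fix by (intro eq_card_imp_inj_on) simp_all
  have hom: "h (x + y) = (h x + h y) mod 4" if "x \<in> F" "y \<in> F" for x y
    using that unfolding F_eq by (auto simp: h kk t_double add add_ac)
  have "h \<in> hom (additive_structure F) (integer_mod_group 4)"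
    using im hom by (intro homI) (auto simp: additive_structure_def carrier_integer_mod_group)
  moreover have "bij_betw h (carrier (additive_structure F)) (carrier (integer_mod_group 4))"
    using im inj by (simp add: bij_betw_def additive_structure_def carrier_integer_mod_group)
  ultimately show "additive_structure F \<cong> integer_mod_group 4"
    by (auto simp: is_iso_def iso_def)
qed

section \<open>Character sums over \<theta>-orbits\<close>

lemma R_not_fixed: "g \<in> R \<Longrightarrow> g \<notin> F"
  using transversal by (auto simp: is_transversal_def)

lemma sum_UNIV:
  fixes f :: "'a \<Rightarrow> complex"
  assumes "\<And>h. f (\<theta> h) = f h"
  shows "(\<Sum>h\<in>UNIV. f h) = f 0 + f t + (\<Sum>h\<in>Fs. f h) + 2 * (\<Sum>h\<in>R. f h)"
proof -
  have un: "UNIV = (F \<union> R) \<union> \<theta> ` R"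
    and dj: "F \<inter> R = {}" "(F \<union> R) \<inter> \<theta> ` R = {}"
    using transversal unfolding is_transversal_def by blast+
  have "(\<Sum>h\<in>UNIV. f h) = (\<Sum>h\<in>F. f h) + (\<Sum>h\<in>R. f h) + (\<Sum>h\<in>\<theta> ` R. f h)"
    unfolding un using dj by (simp add: sum.union_disjoint)
  moreover have "(\<Sum>h\<in>\<theta> ` R. f h) = (\<Sum>h\<in>R. f h)"
  proof -
    have "inj_on \<theta> R" by (rule inj_on_inverseI[of _ \<theta>]) (rule theta_theta)
    then show ?thesis by (simp add: sum.reindex assms)
  qed
  moreover have "(\<Sum>h\<in>F. f h) = f 0 + f t + (\<Sum>h\<in>Fs. f h)"
  proof -
    have "(\<Sum>h\<in>F. f h) = (\<Sum>h\<in>Fs. f h) + (\<Sum>h\<in>{0, t}. f h)"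
      using F_0 t_fix by (intro sum.subset_diff) simp_all
    then show ?thesis using t_nonzero by simp
  qed
  ultimately show ?thesis by (simp add: algebra_simps)
qed

lemma sum_character3:
  "(\<Sum>h\<in>UNIV. cnj (p h x) * cnj (p h y) * cnj (p h z)) = of_nat CARD('a) * of_bool (x + y + z = 0)"
  using sum_character[of "x + y + z"] by (simp add: p_add_right)

lemma fixed_add_eq_0: "x \<in> F \<Longrightarrow> y \<in> F \<Longrightarrow> x + y + z = 0 \<Longrightarrow> z \<in> F"
  using F_uminus[OF F_add, of x y] by (simp add: add_eq_0_iff)

lemma theta_fixed_iff: "\<theta> x \<in> F \<longleftrightarrow> x \<in> F"
  using theta_theta[of x] by (auto simp: fixed_points_def)

lemma sum_character_orbit1:
  assumes "x \<in> F" "y \<in> F" "g \<in> R"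
  shows "(\<Sum>h\<in>UNIV. cnj (p h x) * cnj (p h y) * (cnj (p h g) + cnj (p h (\<theta> g)))) = 0"
proof -
  have "x + y + g \<noteq> 0" "x + y + \<theta> g \<noteq> 0"
    using fixed_add_eq_0 assms R_not_fixed theta_fixed_iff by blast+
  then show ?thesis
    by (simp add: distrib_left sum.distrib sum_character3)
qed

text \<open>A product of two or three orbit sums expands into 4 or 8 characters. This equivalence
  pairs the resulting conditions, which is the origin of the factor 2 in the orbit formulas
  below.\<close>

lemma theta_sum_eq_0: "\<theta> x + \<theta> y + \<theta> z = 0 \<longleftrightarrow> x + y + z = 0"
  using theta_eq_0[of "x + y + z"] by (simp add: theta_add)

lemma sum_character_orbit2:
  assumes "x \<in> F"
  shows "(\<Sum>h\<in>UNIV. cnj (p h x) * (cnj (p h g) + cnj (p h (\<theta> g))) * (cnj (p h g') + cnj (p h (\<theta> g')))) =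
    2 * of_nat CARD('a) * (of_bool (x + g + g' = 0) + of_bool (x + g + \<theta> g' = 0))"
proof -
  have "\<theta> x = x" using assms by (simp add: fixed_points_def)
  then have "x + \<theta> g + \<theta> g' = 0 \<longleftrightarrow> x + g + g' = 0" "x + \<theta> g + g' = 0 \<longleftrightarrow> x + g + \<theta> g' = 0"
    using theta_sum_eq_0[of x g g'] theta_sum_eq_0[of x g "\<theta> g'"] by (simp_all add: theta_theta)
  then show ?thesis
    by (simp add: distrib_left distrib_right sum.distrib sum_character3)
qed

lemma sum_character_orbit3:
  "(\<Sum>h\<in>UNIV. (cnj (p h g) + cnj (p h (\<theta> g))) * (cnj (p h g') + cnj (p h (\<theta> g'))) *
      (cnj (p h g'') + cnj (p h (\<theta> g'')))) =
    2 * of_nat CARD('a) * (of_bool (g + g' + g'' = 0) + of_bool (\<theta> g + g' + g'' = 0)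
      + of_bool (g + \<theta> g' + g'' = 0) + of_bool (g + g' + \<theta> g'' = 0))"
proof -
  note theta_sum_eq_0[of g g' g''] theta_sum_eq_0[of "\<theta> g" g' g'']
    theta_sum_eq_0[of g "\<theta> g'" g''] theta_sum_eq_0[of g g' "\<theta> g''"]
  then show ?thesis
    by (simp add: distrib_left distrib_right sum.distrib sum_character3 theta_theta)
qed

text \<open>At most one of the four sums is 0: if two vanish, their difference, after applying
  \<theta> to one of them if necessary, is up to sign \<theta> y - y for one of the three elements
  y, none of which is fixed. On \<Gamma> the four deltas are subtracted from at most 2, so this
  bound is needed there.\<close>

lemma orbit_deltas:
  assumes "g \<in> R" "g' \<in> R" "g'' \<in> R"
  shows "of_bool (g + g' + g'' = 0) + of_bool (\<theta> g + g' + g'' = 0)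
      + of_bool (g + \<theta> g' + g'' = 0) + of_bool (g + g' + \<theta> g'' = 0) =
      (of_bool (g + g' + g'' = 0 \<or> \<theta> g + g' + g'' = 0 \<or> g + \<theta> g' + g'' = 0 \<or> g + g' + \<theta> g'' = 0) :: complex)"
proof -
  have nf: "\<theta> g \<noteq> g" "\<theta> g' \<noteq> g'" "\<theta> g'' \<noteq> g''"
    using assms R_not_fixed by (auto simp: fixed_points_def)
  have 1: "\<theta> g + g' + g'' \<noteq> 0 \<and> g + \<theta> g' + g'' \<noteq> 0 \<and> g + g' + \<theta> g'' \<noteq> 0" if "g + g' + g'' = 0"
    using nf by (simp flip: that)
  have 2: "g + \<theta> g' + g'' \<noteq> 0 \<and> g + g' + \<theta> g'' \<noteq> 0" if "\<theta> g + g' + g'' = 0"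
  proof -
    have *: "g + \<theta> g' + \<theta> g'' = 0"
      using that theta_sum_eq_0[of "\<theta> g" g' g''] by (simp add: theta_theta)
    show ?thesis using nf by (simp flip: *)
  qed
  have 3: "g + g' + \<theta> g'' \<noteq> 0" if "g + \<theta> g' + g'' = 0"
  proof -
    have *: "\<theta> g + g' + \<theta> g'' = 0"
      using that theta_sum_eq_0[of g "\<theta> g'" g''] by (simp add: theta_theta)
    show ?thesis using nf by (simp flip: *)
  qed
  show ?thesis
    using 1 2 3 by (auto simp: of_bool_def)
qed

end

section \<open>The columns of the matrix\<close>

lemma UNIV_bit: "(UNIV :: bit set) = {0, 1}"
proof -
  have "x \<in> {0, 1}" for x :: bit by (cases x) simp_all
  then show ?thesis by blast
qed

text \<open>The contribution of \<open>(u, 0)\<close> and \<open>(u, \<pi>)\<close>: after completing the sums over \<open>G\<close> and \<open>\<Gamma>\<close> what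
  remains factorizes.\<close>

lemma partial_fractions:
  fixes a b :: complex
  assumes "a \<noteq> b" "a + b \<noteq> 0"
  shows "(a / 2 * x + b / 2 * x') * (a / 2 * y + b / 2 * y') * (a / 2 * z + b / 2 * z') / ((a - b) / 2) +
      (a / 2 * x - b / 2 * x') * (a / 2 * y - b / 2 * y') * (a / 2 * z - b / 2 * z') / ((a + b) / 2) =
    a * a / 2 * (x * y * z) - b * b / 2 * (x' * y' * z') +
    (a * a) * (b * b) / (a * a - b * b) / 2 * ((x + x') * (y + y') * (z + z'))"
proof -
  define D where "D = (a - b) * (a + b)"
  define A where "A = (a * x + b * x') * (a * y + b * y') * (a * z + b * z')"
  define B where "B = (a * x - b * x') * (a * y - b * y') * (a * z - b * z')"
  define C where "C = (x + x') * (y + y') * (z + z')"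
  have D: "D \<noteq> 0"
    using assms by (simp add: D_def)
  have D_eq: "a * a - b * b = D"
    by (simp add: D_def algebra_simps)
  have A8: "(a / 2 * x + b / 2 * x') * (a / 2 * y + b / 2 * y') * (a / 2 * z + b / 2 * z') = A / 8"
    and B8: "(a / 2 * x - b / 2 * x') * (a / 2 * y - b / 2 * y') * (a / 2 * z - b / 2 * z') = B / 8"
    unfolding A_def B_def by (simp_all add: field_simps)
  have "A / 8 / ((a - b) / 2) = A * (a + b) / (4 * D)" "B / 8 / ((a + b) / 2) = B * (a - b) / (4 * D)"
    using assms by (simp_all add: D_def)
  then have "A / 8 / ((a - b) / 2) + B / 8 / ((a + b) / 2) = (A * (a + b) + B * (a - b)) / (4 * D)"
    by (simp add: add_divide_distrib)
  \<comment> \<open>Only a^4, a^2 b^2 and b^4 survive. The mixed products all have the weight a^2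
    b^2; adding the two pure ones with the same weight completes them to C, and taking these out
    again leaves the factor D.\<close>
  also have "A * (a + b) + B * (a - b) =
      2 * (a * a * (x * y * z) - b * b * (x' * y' * z')) * D + 2 * (a * a) * (b * b) * C"
    unfolding A_def B_def C_def D_def by algebra
  also have "\<dots> / (4 * D) = a * a / 2 * (x * y * z) - b * b / 2 * (x' * y' * z') + (a * a) * (b * b) / D / 2 * C"
    using D by (simp add: divide_simps)
  finally show ?thesis
    unfolding A8 B8 D_eq C_def .
qed

text \<open>
  \<open>\<alpha>\<close> is the common value of the pairing of \<open>u\<^sub>0\<close> with the elements of \<open>K\<close>; either of (A1) and (A2)
  makes the pairing of \<open>u\<^sub>0\<close> with the elements of \<open>\<Sigma>\<close> equal to \<open>- \<alpha>\<close>.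
\<close>

locale fusion_data =
  S_matrix q\<^sub>1 \<theta>\<^sub>1 k\<^sub>0 Gs q\<^sub>2 \<theta>\<^sub>2 \<sigma>\<^sub>0 \<Gamma>s s f +
  G: metric_side q\<^sub>1 \<theta>\<^sub>1 k\<^sub>0 Gs + H: metric_side q\<^sub>2 \<theta>\<^sub>2 \<sigma>\<^sub>0 \<Gamma>s
  for q\<^sub>1 :: "'g::{ab_group_add,finite} \<Rightarrow> complex" and \<theta>\<^sub>1 :: "'g \<Rightarrow> 'g"
    and k\<^sub>0 :: 'g and Gs :: "'g set"
    and q\<^sub>2 :: "'h::{ab_group_add,finite} \<Rightarrow> complex" and \<theta>\<^sub>2 :: "'h \<Rightarrow> 'h"
    and \<sigma>\<^sub>0 :: 'h and \<Gamma>s :: "'h set"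
    and s :: complex and f :: "'g \<Rightarrow> 'h \<Rightarrow> complex" +
  fixes \<alpha> :: complex
  assumes s4: "s ^ 4 = 1" and sign_alpha: "is_sign \<alpha>"
    and pairing_k\<^sub>0: "k \<in> G.Fs \<Longrightarrow> pairing q\<^sub>1 k\<^sub>0 k = \<alpha>"
    and pairing_\<sigma>\<^sub>0: "\<sigma> \<in> H.Fs \<Longrightarrow> pairing q\<^sub>2 \<sigma>\<^sub>0 \<sigma> = - \<alpha>"
    and f_values: "k \<in> G.Fs \<Longrightarrow> \<sigma> \<in> H.Fs \<Longrightarrow> f k \<sigma> = s \<or> f k \<sigma> = - s"
    and f_add_k\<^sub>0: "k \<in> G.Fs \<Longrightarrow> \<sigma> \<in> H.Fs \<Longrightarrow> f (k + k\<^sub>0) \<sigma> = - \<alpha> * f k \<sigma>"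
    and f_add_\<sigma>\<^sub>0: "k \<in> G.Fs \<Longrightarrow> \<sigma> \<in> H.Fs \<Longrightarrow> f k (\<sigma> + \<sigma>\<^sub>0) = \<alpha> * f k \<sigma>"
begin

abbreviation Ks :: "'g set" where "Ks \<equiv> G.Fs"
abbreviation \<Sigma>s :: "'h set" where "\<Sigma>s \<equiv> H.Fs"
abbreviation pG :: "'g \<Rightarrow> 'g \<Rightarrow> complex" where "pG \<equiv> pairing q\<^sub>1"
abbreviation p\<Gamma> :: "'h \<Rightarrow> 'h \<Rightarrow> complex" where "p\<Gamma> \<equiv> pairing q\<^sub>2"

fun \<xi> :: "('g, 'h) label \<Rightarrow> 'g \<Rightarrow> complex" where
  "\<xi> (LZero u) h = cG h (iG u)"
| "\<xi> (LPi u) h = cG h (iG u)"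
| "\<xi> (LK k \<epsilon>) h = cG h k"
| "\<xi> (LG g) h = cG h g + cG h (\<theta>\<^sub>1 g)"
| "\<xi> (LSig \<sigma> \<epsilon>) h = 0"
| "\<xi> (LGam \<gamma>) h = 0"

text \<open>The sign is fixed by the row (u,0), which becomes a/2 \<xi> + b/2 \<omega>; the rows
  (u,\<pi>), (\<sigma>,\<epsilon>) and \<gamma> then carry \<omega> with a negative
  coefficient.\<close>

fun \<omega> :: "('g, 'h) label \<Rightarrow> 'h \<Rightarrow> complex" where
  "\<omega> (LZero u) h = - c\<Gamma> h (i\<Gamma> u)"
| "\<omega> (LPi u) h = c\<Gamma> h (i\<Gamma> u)"
| "\<omega> (LK k \<epsilon>) h = 0"
| "\<omega> (LG g) h = 0"
| "\<omega> (LSig \<sigma> \<epsilon>) h = c\<Gamma> h \<sigma>"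
| "\<omega> (LGam \<gamma>) h = c\<Gamma> h \<gamma> + c\<Gamma> h (\<theta>\<^sub>2 \<gamma>)"

text \<open>The part of the rows (k,1) and (k,-1) that is odd in the row's sign. Summing over this
  sign leaves only terms with an even number of factors \<psi>.\<close>

fun \<psi> :: "('g, 'h) label \<Rightarrow> 'g \<Rightarrow> complex" where
  "\<psi> (LZero u) h = 0"
| "\<psi> (LPi u) h = 0"
| "\<psi> (LK k \<epsilon>) h = \<epsilon> * s / 4 * cG h k"
| "\<psi> (LG g) h = 0"
| "\<psi> (LSig \<sigma> \<epsilon>) h = \<epsilon> / 4 * f h \<sigma>"
| "\<psi> (LGam \<gamma>) h = 0"

fun \<phi> :: "('g, 'h) label \<Rightarrow> 'h \<Rightarrow> complex" where
  "\<phi> (LZero u) h = 0"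
| "\<phi> (LPi u) h = 0"
| "\<phi> (LK k \<epsilon>) h = \<epsilon> / 4 * f k h"
| "\<phi> (LG g) h = 0"
| "\<phi> (LSig \<sigma> \<epsilon>) h = \<epsilon> * s / 4 * c\<Gamma> h \<sigma>"
| "\<phi> (LGam \<gamma>) h = 0"

lemma iG_fixed: "iG u \<in> G.F"
  by (simp add: from_U_def G.F_0 G.t_fix)

lemma i\<Gamma>_fixed: "i\<Gamma> u \<in> H.F"
  by (simp add: from_U_def H.F_0 H.t_fix)

lemma pG_iG_iG: "pG (iG u) (iG v) = 1"
  by (simp add: from_U_def G.p_0_left G.p_0_right G.pairing_t_t)

lemma p\<Gamma>_i\<Gamma>_i\<Gamma>: "p\<Gamma> (i\<Gamma> u) (i\<Gamma> v) = 1"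
  by (simp add: from_U_def H.p_0_left H.p_0_right H.pairing_t_t)

text \<open>Pairings within U are 1 in both groups, which is why the entry (a - b)/2 splits into a
  G-part and a \<Gamma>-part. On fixed points an orbit sum is twice a character, so a/2 and b/2
  become the entries a and b of the columns g and \<gamma>.\<close>

lemma S_LZero: "S (LZero u) x = a / 2 * \<xi> x (iG u) + b / 2 * \<omega> x (i\<Gamma> u)"
  by (cases x)
    (simp_all add: pG_iG_iG p\<Gamma>_i\<Gamma>_i\<Gamma> G.p_fixed_theta H.p_fixed_theta iG_fixed i\<Gamma>_fixed field_simps)

lemma S_LPi: "S (LPi u) x = a / 2 * \<xi> x (iG u) - b / 2 * \<omega> x (i\<Gamma> u)"
  by (cases x)
    (simp_all add: pG_iG_iG p\<Gamma>_i\<Gamma>_i\<Gamma> G.p_fixed_theta H.p_fixed_theta iG_fixed i\<Gamma>_fixed field_simps)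

lemma S_LK: "k \<in> Ks \<Longrightarrow> S (LK k \<epsilon>) x = a / 2 * \<xi> x k + \<epsilon> * \<psi> x k"
  by (cases x) (simp_all add: G.p_fixed_theta field_simps)

lemma S_LG: "S (LG g) x = a * \<xi> x g"
  by (cases x) simp_all

lemma S_LSig: "\<sigma> \<in> \<Sigma>s \<Longrightarrow> S (LSig \<sigma> \<epsilon>) x = - b / 2 * \<omega> x \<sigma> + \<epsilon> * \<phi> x \<sigma>"
  by (cases x) (simp_all add: H.p_fixed_theta field_simps)

lemma S_LGam: "S (LGam \<gamma>) x = - b * \<omega> x \<gamma>"
  by (cases x) simp_all

lemma J_cases:
  assumes "x \<in> J"
  obtains u where "x = LZero u" | u where "x = LPi u"
    | k \<epsilon> where "x = LK k \<epsilon>" "k \<in> Ks" "\<epsilon> \<in> {1, -1}"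
    | g where "x = LG g" "g \<in> Gs"
    | \<sigma> \<epsilon> where "x = LSig \<sigma> \<epsilon>" "\<sigma> \<in> \<Sigma>s" "\<epsilon> \<in> {1, -1}"
    | \<gamma> where "x = LGam \<gamma>" "\<gamma> \<in> \<Gamma>s"
  using assms by (auto simp: J_def)

lemma \<xi>_theta: "x \<in> J \<Longrightarrow> \<xi> x (\<theta>\<^sub>1 h) = \<xi> x h"
  by (erule J_cases)
    (auto simp: G.p_theta_left G.theta_theta fixed_points_def from_U_def G.theta_0
      G.t_fix[unfolded fixed_points_def, simplified])

lemma \<omega>_theta: "x \<in> J \<Longrightarrow> \<omega> x (\<theta>\<^sub>2 h) = \<omega> x h"
  by (erule J_cases)
    (auto simp: H.p_theta_left H.theta_theta fixed_points_def from_U_def H.theta_0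
      H.t_fix[unfolded fixed_points_def, simplified])

lemma sum_J:
  fixes F :: "('g, 'h) label \<Rightarrow> complex"
  shows "(\<Sum>w\<in>J. F w) = (\<Sum>u\<in>UNIV. F (LZero u) + F (LPi u)) +
    (\<Sum>k\<in>Ks. F (LK k 1) + F (LK k (-1))) + (\<Sum>g\<in>Gs. F (LG g)) +
    (\<Sum>\<sigma>\<in>\<Sigma>s. F (LSig \<sigma> 1) + F (LSig \<sigma> (-1))) + (\<Sum>\<gamma>\<in>\<Gamma>s. F (LGam \<gamma>))"
proof -
  have J: "J = LZero ` UNIV \<union> LPi ` UNIV \<union> (\<lambda>k. LK k 1) ` Ks \<union> (\<lambda>k. LK k (-1)) ` Ks \<union> LG ` Gs \<union>
      (\<lambda>k. LSig k 1) ` \<Sigma>s \<union> (\<lambda>k. LSig k (-1)) ` \<Sigma>s \<union> LGam ` \<Gamma>s"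
    unfolding J_def by auto
  have "finite (UNIV :: bit set)"
    by (simp add: UNIV_bit)
  then have fin: "finite (range LZero)" "finite (range LPi)"
    by simp_all
  show ?thesis
    unfolding J
    by (subst sum.union_disjoint, simp add: fin, simp add: fin, force)+
      (simp add: sum.reindex inj_on_def sum.distrib)
qed

section \<open>Splitting the coefficients into T, the term in \<kappa>, and W\<close>

lemma a_nonzero: "a \<noteq> 0" and b_nonzero: "b \<noteq> 0"
  by (simp_all add: inv_sqrt_order_def)

lemma a_sq: "a * a = 1 / of_nat CARD('g)" and b_sq: "b * b = 1 / of_nat CARD('h)"
  unfolding inv_sqrt_order_def of_real_mult[symmetric] by (simp_all flip: of_real_mult)

lemma a_plus_b_nonzero: "a + b \<noteq> 0"
proof -
  have "1 / sqrt (real CARD('g)) + 1 / sqrt (real CARD('h)) > 0"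
    by (intro add_pos_pos) simp_all
  then show ?thesis
    unfolding inv_sqrt_order_def of_real_add[symmetric] of_real_eq_0_iff by linarith
qed

text \<open>Adding the two rows of opposite sign removes the odd powers of \<psi> and \<phi>. The
  fixed points outside U then get half the weight of the representatives in \<open>Gs\<close> and
  \<open>\<Gamma>s\<close>, as in the sum over the whole group, from which only the two points of U
  are missing. The case a = b is included: the quotients by (a - b) / 2 are then 0 on both
  sides.\<close>

lemma N_split:
  assumes "x \<in> J" "y \<in> J" "z \<in> J"
  shows "N x y z =
    (\<Sum>u\<in>UNIV. S (LZero u) x * S (LZero u) y * S (LZero u) z / ((a - b) / 2) +
       S (LPi u) x * S (LPi u) y * S (LPi u) z / ((a + b) / 2)) +
    a * a / 2 * ((\<Sum>h\<in>UNIV. \<xi> x h * \<xi> y h * \<xi> z h)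
      - \<xi> x 0 * \<xi> y 0 * \<xi> z 0 - \<xi> x k\<^sub>0 * \<xi> y k\<^sub>0 * \<xi> z k\<^sub>0) -
    b * b / 2 * ((\<Sum>h\<in>UNIV. \<omega> x h * \<omega> y h * \<omega> z h)
      - \<omega> x 0 * \<omega> y 0 * \<omega> z 0 - \<omega> x \<sigma>\<^sub>0 * \<omega> y \<sigma>\<^sub>0 * \<omega> z \<sigma>\<^sub>0) +
    2 * (\<Sum>k\<in>Ks. \<xi> x k * \<psi> y k * \<psi> z k + \<psi> x k * \<xi> y k * \<psi> z k + \<psi> x k * \<psi> y k * \<xi> z k) -
    2 * (\<Sum>\<sigma>\<in>\<Sigma>s. \<omega> x \<sigma> * \<phi> y \<sigma> * \<phi> z \<sigma> + \<phi> x \<sigma> * \<omega> y \<sigma> * \<phi> z \<sigma> + \<phi> x \<sigma> * \<phi> y \<sigma> * \<omega> z \<sigma>)"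
proof -
  define F where "F = (\<lambda>w. S w x * S w y * S w z / S (LZero 0) w)"
  define X where "X = (\<lambda>h. \<xi> x h * \<xi> y h * \<xi> z h)"
  define Y where "Y = (\<lambda>h. \<omega> x h * \<omega> y h * \<omega> z h)"
  define P where "P = (\<lambda>k. \<xi> x k * \<psi> y k * \<psi> z k + \<psi> x k * \<xi> y k * \<psi> z k + \<psi> x k * \<psi> y k * \<xi> z k)"
  define Q where "Q = (\<lambda>\<sigma>. \<omega> x \<sigma> * \<phi> y \<sigma> * \<phi> z \<sigma> + \<phi> x \<sigma> * \<omega> y \<sigma> * \<phi> z \<sigma> + \<phi> x \<sigma> * \<phi> y \<sigma> * \<omega> z \<sigma>)"
  have Z: "F (LZero u) = S (LZero u) x * S (LZero u) y * S (LZero u) z / ((a - b) / 2)"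
    "F (LPi u) = S (LPi u) x * S (LPi u) y * S (LPi u) z / ((a + b) / 2)" for u
    by (simp_all add: F_def G.p_0_left from_U_def)
  have K: "F (LK k 1) + F (LK k (-1)) = a * a / 2 * X k + 2 * P k" if "k \<in> Ks" for k
    using that a_nonzero
    by (simp add: F_def X_def P_def S_LK G.p_0_left from_U_def) (simp add: field_simps power2_eq_square)
  have G: "F (LG g) = a * a * X g" for g
    using a_nonzero by (simp add: F_def X_def S_LG G.p_0_left from_U_def)
  have Sg: "F (LSig k 1) + F (LSig k (-1)) = - (b * b / 2) * Y k - 2 * Q k" if "k \<in> \<Sigma>s" for k
    using that b_nonzero
    by (simp add: F_def Y_def Q_def S_LSig H.p_0_left from_U_def) (simp add: field_simps power2_eq_square)
  have H: "F (LGam g) = - (b * b) * Y g" for g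
    using b_nonzero by (simp add: F_def Y_def S_LGam H.p_0_left from_U_def)
  have "(\<Sum>h\<in>UNIV. X h) = X 0 + X k\<^sub>0 + (\<Sum>h\<in>Ks. X h) + 2 * (\<Sum>h\<in>Gs. X h)"
    using assms by (intro G.sum_UNIV) (simp add: X_def \<xi>_theta)
  moreover have "(\<Sum>h\<in>UNIV. Y h) = Y 0 + Y \<sigma>\<^sub>0 + (\<Sum>h\<in>\<Sigma>s. Y h) + 2 * (\<Sum>h\<in>\<Gamma>s. Y h)"
    using assms by (intro H.sum_UNIV) (simp add: Y_def \<omega>_theta)
  moreover have N: "N x y z = (\<Sum>u\<in>UNIV. F (LZero u) + F (LPi u)) + (\<Sum>k\<in>Ks. a * a / 2 * X k + 2 * P k)
      + (\<Sum>g\<in>Gs. a * a * X g) + (\<Sum>k\<in>\<Sigma>s. - (b * b / 2) * Y k - 2 * Q k) + (\<Sum>g\<in>\<Gamma>s. - (b * b) * Y g)"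
    unfolding N_def F_def[symmetric] sum_J by (simp add: K G Sg H)
  have lin: "(\<Sum>k\<in>A. r * g k + 2 * h k) = r * sum g A + 2 * sum h A"
    "(\<Sum>k\<in>B. r * g' k - 2 * h' k) = r * sum g' B - 2 * sum h' B"
    "(\<Sum>k\<in>A. r * g k) = r * sum g A" "(\<Sum>k\<in>B. r * g' k) = r * sum g' B"
    for r and g h :: "'g \<Rightarrow> complex" and A and g' h' :: "'h \<Rightarrow> complex" and B
    by (simp_all add: sum.distrib sum_subtractf sum_distrib_left)
  with calculation N have "N x y z = (\<Sum>u\<in>UNIV. F (LZero u) + F (LPi u)) +
      a * a / 2 * ((\<Sum>h\<in>UNIV. X h) - X 0 - X k\<^sub>0) - b * b / 2 * ((\<Sum>h\<in>UNIV. Y h) - Y 0 - Y \<sigma>\<^sub>0)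
      + 2 * (\<Sum>k\<in>Ks. P k) - 2 * (\<Sum>k\<in>\<Sigma>s. Q k)"
    by (simp only: lin) (simp add: algebra_simps)
  then show ?thesis
    by (simp add: Z X_def Y_def P_def Q_def)
qed

definition \<kappa> :: complex where "\<kappa> = 1 / (of_nat CARD('h) - of_nat CARD('g))"

text \<open>The value of \<xi> + \<omega> at 0; its companion \<open>v\<^sub>1\<close> is the value
  at u0. At the label (u,0) the parts from G and \<Gamma> cancel, so \<kappa> drops out of every
  coefficient with such a label.\<close>

fun v\<^sub>0 :: "('g, 'h) label \<Rightarrow> complex" where
  "v\<^sub>0 (LZero u) = 0"
| "v\<^sub>0 (LPi u) = 2"
| "v\<^sub>0 (LK k \<epsilon>) = 1"
| "v\<^sub>0 (LG g) = 2"
| "v\<^sub>0 (LSig \<sigma> \<epsilon>) = 1"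
| "v\<^sub>0 (LGam \<gamma>) = 2"

fun v\<^sub>1 :: "('g, 'h) label \<Rightarrow> complex" where
  "v\<^sub>1 (LZero u) = 0"
| "v\<^sub>1 (LPi u) = 2"
| "v\<^sub>1 (LK k \<epsilon>) = \<alpha>"
| "v\<^sub>1 (LG g) = 2 * pG k\<^sub>0 g"
| "v\<^sub>1 (LSig \<sigma> \<epsilon>) = - \<alpha>"
| "v\<^sub>1 (LGam \<gamma>) = 2 * p\<Gamma> \<sigma>\<^sub>0 \<gamma>"

lemma v\<^sub>0: "\<xi> x 0 + \<omega> x 0 = v\<^sub>0 x"
  by (cases x) (simp_all add: G.p_0_left H.p_0_left)

lemma v\<^sub>1: "x \<in> J \<Longrightarrow> \<xi> x k\<^sub>0 + \<omega> x \<sigma>\<^sub>0 = v\<^sub>1 x"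
  using pG_iG_iG[of 1] p\<Gamma>_i\<Gamma>_i\<Gamma>[of 1]
  by (erule_tac J_cases)
    (simp_all add: pairing_k\<^sub>0 pairing_\<sigma>\<^sub>0 is_sign_cnj[OF sign_alpha] is_sign_cnj[OF G.is_sign_p_t]
      is_sign_cnj[OF H.is_sign_p_t] G.p_fixed_theta[OF G.t_fix] H.p_fixed_theta[OF H.t_fix] from_U_def)

lemma a_ne_b: "CARD('g) \<noteq> CARD('h) \<Longrightarrow> a \<noteq> b"
  by (simp add: inv_sqrt_order_def)

lemma \<kappa>_eq: "CARD('g) \<noteq> CARD('h) \<Longrightarrow> (a * a) * (b * b) / (a * a - b * b) = \<kappa>"
proof -
  assume ne: "CARD('g) \<noteq> CARD('h)"
  show ?thesis
    unfolding a_sq b_sq \<kappa>_def using ne by (simp add: divide_simps)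
qed

definition T :: "('g, 'h) label \<Rightarrow> ('g, 'h) label \<Rightarrow> ('g, 'h) label \<Rightarrow> complex" where
  "T x y z = a * a * (\<Sum>h\<in>UNIV. \<xi> x h * \<xi> y h * \<xi> z h) - b * b * (\<Sum>h\<in>UNIV. \<omega> x h * \<omega> y h * \<omega> z h)"

definition W :: "('g, 'h) label \<Rightarrow> ('g, 'h) label \<Rightarrow> ('g, 'h) label \<Rightarrow> complex" where
  "W x y z =
    (\<Sum>k\<in>Ks. \<xi> x k * \<psi> y k * \<psi> z k + \<psi> x k * \<xi> y k * \<psi> z k + \<psi> x k * \<psi> y k * \<xi> z k) -
    (\<Sum>\<sigma>\<in>\<Sigma>s. \<omega> x \<sigma> * \<phi> y \<sigma> * \<phi> z \<sigma> + \<phi> x \<sigma> * \<omega> y \<sigma> * \<phi> z \<sigma> + \<phi> x \<sigma> * \<phi> y \<sigma> * \<omega> z \<sigma>)"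

text \<open>The pure products in \<open>partial_fractions\<close> are exactly the terms at 0 and u0
  that \<open>N_split\<close> subtracts, so complete sums over both groups appear and only the
  product of the sums \<xi> + \<omega> is left over.\<close>

lemma N_eq:
  assumes ne: "CARD('g) \<noteq> CARD('h)" and J: "x \<in> J" "y \<in> J" "z \<in> J"
  shows "N x y z = T x y z / 2 + \<kappa> / 2 * (v\<^sub>0 x * v\<^sub>0 y * v\<^sub>0 z + v\<^sub>1 x * v\<^sub>1 y * v\<^sub>1 z) + 2 * W x y z"
proof -
  have U: "S (LZero u) x * S (LZero u) y * S (LZero u) z / ((a - b) / 2) +
      S (LPi u) x * S (LPi u) y * S (LPi u) z / ((a + b) / 2) =
     a * a / 2 * (\<xi> x (iG u) * \<xi> y (iG u) * \<xi> z (iG u)) - b * b / 2 * (\<omega> x (i\<Gamma> u) * \<omega> y (i\<Gamma> u) * \<omega> z (i\<Gamma> u)) +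
     \<kappa> / 2 * ((\<xi> x (iG u) + \<omega> x (i\<Gamma> u)) * (\<xi> y (iG u) + \<omega> y (i\<Gamma> u)) * (\<xi> z (iG u) + \<omega> z (i\<Gamma> u)))" for u
    unfolding S_LZero S_LPi partial_fractions[OF a_ne_b[OF ne] a_plus_b_nonzero] \<kappa>_eq[OF ne] ..
  show ?thesis
    unfolding N_split[OF J] U UNIV_bit T_def W_def v\<^sub>0[symmetric]
      v\<^sub>1[OF J(1), symmetric] v\<^sub>1[OF J(2), symmetric] v\<^sub>1[OF J(3), symmetric]
    by (simp add: from_U_def) (simp add: field_simps)
qed

section \<open>Evaluation of T and of the pairings with U, K and \<Sigma>\<close>

lemma J_intros:
  "LZero u \<in> J" "LPi u \<in> J" "k \<in> Ks \<Longrightarrow> \<epsilon> \<in> {1, -1} \<Longrightarrow> LK k \<epsilon> \<in> J" "g \<in> Gs \<Longrightarrow> LG g \<in> J"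
  "\<sigma> \<in> \<Sigma>s \<Longrightarrow> \<epsilon> \<in> {1, -1} \<Longrightarrow> LSig \<sigma> \<epsilon> \<in> J" "\<gamma> \<in> \<Gamma>s \<Longrightarrow> LGam \<gamma> \<in> J"
  by (auto simp: J_def)

lemma p_iG_1: "pG x (iG 1) = pG k\<^sub>0 x" "pG (iG 1) x = pG k\<^sub>0 x"
  and p_i\<Gamma>_1: "p\<Gamma> y (i\<Gamma> 1) = p\<Gamma> \<sigma>\<^sub>0 y" "p\<Gamma> (i\<Gamma> 1) y = p\<Gamma> \<sigma>\<^sub>0 y"
  by (simp_all add: from_U_def G.p_sym[of _ k\<^sub>0] H.p_sym[of _ \<sigma>\<^sub>0])

lemma p_k\<^sub>0_iG: "pG k\<^sub>0 (iG u) = 1" and p_\<sigma>\<^sub>0_i\<Gamma>: "p\<Gamma> \<sigma>\<^sub>0 (i\<Gamma> u) = 1"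
  by (simp_all add: from_U_def G.p_0_right G.pairing_t_t H.p_0_right H.pairing_t_t)

lemma iG_cases: "iG u = 0 \<or> iG u = k\<^sub>0" and i\<Gamma>_cases: "i\<Gamma> u = 0 \<or> i\<Gamma> u = \<sigma>\<^sub>0"
  by (simp_all add: from_U_def)

text \<open>K and \<Sigma> are the nontrivial cosets of U among the fixed points, so a sum with an
  odd number of terms from the coset stays outside U.\<close>

lemma fixed_sum_ne_0:
  "k \<in> Ks \<Longrightarrow> iG u + iG u' + k \<noteq> 0" "k \<in> Ks \<Longrightarrow> k' \<in> Ks \<Longrightarrow> k'' \<in> Ks \<Longrightarrow> k + k' + k'' \<noteq> 0"
  "\<sigma> \<in> \<Sigma>s \<Longrightarrow> i\<Gamma> u + i\<Gamma> u' + \<sigma> \<noteq> 0"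
  "\<sigma> \<in> \<Sigma>s \<Longrightarrow> \<sigma>' \<in> \<Sigma>s \<Longrightarrow> \<sigma>'' \<in> \<Sigma>s \<Longrightarrow> \<sigma> + \<sigma>' + \<sigma>'' \<noteq> 0"
proof -
  show "k \<in> Ks \<Longrightarrow> iG u + iG u' + k \<noteq> 0"
    using iG_cases[of u] iG_cases[of u'] G.t_double G.Fs_add_t[of k] by (auto simp: add.commute)
  show "k \<in> Ks \<Longrightarrow> k' \<in> Ks \<Longrightarrow> k'' \<in> Ks \<Longrightarrow> k + k' + k'' \<noteq> 0"
    using G.Fs_add_Fs[of k k'] G.Fs_add_t[of k''] by (auto simp: add.commute)
  show "\<sigma> \<in> \<Sigma>s \<Longrightarrow> i\<Gamma> u + i\<Gamma> u' + \<sigma> \<noteq> 0"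
    using i\<Gamma>_cases[of u] i\<Gamma>_cases[of u'] H.t_double H.Fs_add_t[of \<sigma>] by (auto simp: add.commute)
  show "\<sigma> \<in> \<Sigma>s \<Longrightarrow> \<sigma>' \<in> \<Sigma>s \<Longrightarrow> \<sigma>'' \<in> \<Sigma>s \<Longrightarrow> \<sigma> + \<sigma>' + \<sigma>'' \<noteq> 0"
    using H.Fs_add_Fs[of \<sigma> \<sigma>'] H.Fs_add_t[of \<sigma>''] by (auto simp: add.commute)
qed

lemma iG_sum_eq_0: "iG u + iG u' + iG u'' = 0 \<longleftrightarrow> u + u' + u'' = 0"
  and i\<Gamma>_sum_eq_0: "i\<Gamma> u + i\<Gamma> u' + i\<Gamma> u'' = 0 \<longleftrightarrow> u + u' + u'' = 0"
  using G.t_double G.t_nonzero H.t_double H.t_nonzero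
  by (cases u; cases u'; cases u''; simp add: from_U_def)+

lemmas T_simps = T_def a_sq b_sq sum_negf G.sum_character3 H.sum_character3
  G.sum_character_orbit1 H.sum_character_orbit1
  G.sum_character_orbit2 H.sum_character_orbit2 G.sum_character_orbit3 H.sum_character_orbit3
  iG_fixed i\<Gamma>_fixed fixed_sum_ne_0 iG_sum_eq_0 i\<Gamma>_sum_eq_0

lemmas p_simps = p_iG_1 p_i\<Gamma>_1 p_k\<^sub>0_iG p_\<sigma>\<^sub>0_i\<Gamma> pairing_k\<^sub>0 pairing_\<sigma>\<^sub>0
  G.p_add_right H.p_add_right

text \<open>Although s is a fourth root of unity, the coefficients see it only through s^2 and
  through products s f, and both are signs.\<close>

definition \<eta> :: complex where "\<eta> = s\<^sup>2"

lemma \<eta>_sq: "\<eta> * \<eta> = 1" "\<eta> * (\<eta> * x) = x"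
  using s4 by (simp_all add: \<eta>_def flip: power_add mult.assoc)

lemma s_sq: "s\<^sup>2 = \<eta>" "s * s = \<eta>" "s * (s * x) = \<eta> * x"
  by (simp_all add: \<eta>_def power2_eq_square)

lemma \<eta>_cases: "\<eta> = 1 \<or> \<eta> = -1"
  using \<eta>_sq by (simp add: square_eq_1_iff)

lemma cnj_\<eta>: "cnj \<eta> = \<eta>"
  using \<eta>_cases by auto

lemma f_sq: 
  assumes "k \<in> Ks" "\<sigma> \<in> \<Sigma>s" 
  shows "f k \<sigma> * f k \<sigma> = \<eta>" "f k \<sigma> * (f k \<sigma> * x) = \<eta> * x"
  using f_values[OF assms] by (elim disjE; simp add: s_sq)+

lemma \<alpha>_cases: "\<alpha> = 1 \<or> \<alpha> = -1"
  using sign_alpha by (simp add: is_sign_def)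

lemma \<alpha>_sq: "\<alpha> * \<alpha> = 1" "\<alpha> * (\<alpha> * x) = x"
  using \<alpha>_cases by auto

lemma pG_k\<^sub>0_right: "k \<in> Ks \<Longrightarrow> pG k k\<^sub>0 = \<alpha>" and p\<Gamma>_\<sigma>\<^sub>0_right: "\<sigma> \<in> \<Sigma>s \<Longrightarrow> p\<Gamma> \<sigma> \<sigma>\<^sub>0 = - \<alpha>"
  by (simp_all add: G.p_sym[of _ k\<^sub>0] H.p_sym[of _ \<sigma>\<^sub>0] pairing_k\<^sub>0 pairing_\<sigma>\<^sub>0)

lemma cnj_pG_k\<^sub>0: "cnj (pG k\<^sub>0 x) = pG k\<^sub>0 x" and cnj_p\<Gamma>_\<sigma>\<^sub>0: "cnj (p\<Gamma> \<sigma>\<^sub>0 y) = p\<Gamma> \<sigma>\<^sub>0 y"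
  by (rule is_sign_cnj[OF G.is_sign_p_t] is_sign_cnj[OF H.is_sign_p_t])+

lemma W_eq: "k \<in> Ks \<Longrightarrow> \<sigma> \<in> \<Sigma>s \<Longrightarrow>
  W x y z =
    (\<xi> x k * \<psi> y k * \<psi> z k + \<psi> x k * \<xi> y k * \<psi> z k + \<psi> x k * \<psi> y k * \<xi> z k +
     (\<xi> x (k + k\<^sub>0) * \<psi> y (k + k\<^sub>0) * \<psi> z (k + k\<^sub>0) + \<psi> x (k + k\<^sub>0) * \<xi> y (k + k\<^sub>0) * \<psi> z (k + k\<^sub>0) +
      \<psi> x (k + k\<^sub>0) * \<psi> y (k + k\<^sub>0) * \<xi> z (k + k\<^sub>0))) -
    (\<omega> x \<sigma> * \<phi> y \<sigma> * \<phi> z \<sigma> + \<phi> x \<sigma> * \<omega> y \<sigma> * \<phi> z \<sigma> + \<phi> x \<sigma> * \<phi> y \<sigma> * \<omega> z \<sigma> +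
     (\<omega> x (\<sigma> + \<sigma>\<^sub>0) * \<phi> y (\<sigma> + \<sigma>\<^sub>0) * \<phi> z (\<sigma> + \<sigma>\<^sub>0) + \<phi> x (\<sigma> + \<sigma>\<^sub>0) * \<omega> y (\<sigma> + \<sigma>\<^sub>0) * \<phi> z (\<sigma> + \<sigma>\<^sub>0) +
      \<phi> x (\<sigma> + \<sigma>\<^sub>0) * \<phi> y (\<sigma> + \<sigma>\<^sub>0) * \<omega> z (\<sigma> + \<sigma>\<^sub>0)))"
  unfolding W_def by (simp add: G.sum_Fs H.sum_Fs)

text \<open>The square <k,k>^2 = <2k,k> is 1 or <\<open>k\<^sub>0\<close>,k>, hence real, although
  <k,k> itself may be a primitive fourth root of unity.\<close>

lemma cG_self_sq:
  assumes "k \<in> Ks"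
  shows "cG k k * cG k k = pG k k * pG k k" "cG k k * (cG k k * x) = pG k k * (pG k k * x)"
proof -
  have "cnj (pG (k + k) k) = pG (k + k) k"
    using G.Fs_double[OF assms] by (elim disjE) (simp_all add: G.p_0_left cnj_pG_k\<^sub>0)
  then show "cG k k * cG k k = pG k k * pG k k"
    by (simp add: G.p_add_left)
  then show "cG k k * (cG k k * x) = pG k k * (pG k k * x)"
    by (simp flip: mult.assoc)
qed

lemma from_U_0: "from_U t 0 = 0"
  by (simp add: from_U_def)

lemma iG_add_Ks: "k \<in> Ks \<Longrightarrow> k' \<in> Ks \<Longrightarrow> iG u + k + k' = 0 \<or> iG u + k + k' = k\<^sub>0"
  using iG_cases[of u] G.Fs_add_Fs[of k k'] G.t_double by (auto simp: add.assoc)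

lemma i\<Gamma>_add_\<Sigma>s: "\<sigma> \<in> \<Sigma>s \<Longrightarrow> \<sigma>' \<in> \<Sigma>s \<Longrightarrow> i\<Gamma> u + \<sigma> + \<sigma>' = 0 \<or> i\<Gamma> u + \<sigma> + \<sigma>' = \<sigma>\<^sub>0"
  using i\<Gamma>_cases[of u] H.Fs_add_Fs[of \<sigma> \<sigma>'] H.t_double by (auto simp: add.assoc)

text \<open>The three characters combine to the one at \<open>iG u + k + k'\<close>, an element of
  U, and pairing with an element of U is constant on K: 1 for 0 and \<alpha> for
  \<open>k\<^sub>0\<close>.\<close>

lemma sum_cG_Ks:
  assumes "k \<in> Ks" "k' \<in> Ks"
  shows "(\<Sum>h\<in>Ks. cG h (iG u) * (cG h k * cG h k')) = (if iG u + k + k' = 0 then 2 else 2 * \<alpha>)"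
proof -
  have "(\<Sum>h\<in>Ks. cG h (iG u) * (cG h k * cG h k')) = (\<Sum>h\<in>Ks. cG h (iG u + k + k'))"
    by (simp add: G.p_add_right mult.assoc)
  also have "\<dots> = (if iG u + k + k' = 0 then 2 else 2 * \<alpha>)"
    using iG_add_Ks[OF assms, of u] G.t_nonzero
    by (elim disjE) (simp_all add: G.card_Fs G.p_0_right pG_k\<^sub>0_right is_sign_cnj[OF sign_alpha])
  finally show ?thesis .
qed

lemma sum_c\<Gamma>_\<Sigma>s:
  assumes "k \<in> \<Sigma>s" "k' \<in> \<Sigma>s"
  shows "(\<Sum>h\<in>\<Sigma>s. c\<Gamma> h (i\<Gamma> u) * (c\<Gamma> h k * c\<Gamma> h k')) = (if i\<Gamma> u + k + k' = 0 then 2 else - 2 * \<alpha>)"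
proof -
  have "(\<Sum>h\<in>\<Sigma>s. c\<Gamma> h (i\<Gamma> u) * (c\<Gamma> h k * c\<Gamma> h k')) = (\<Sum>h\<in>\<Sigma>s. c\<Gamma> h (i\<Gamma> u + k + k'))"
    by (simp add: H.p_add_right mult.assoc)
  also have "\<dots> = (if i\<Gamma> u + k + k' = 0 then 2 else - 2 * \<alpha>)"
    using i\<Gamma>_add_\<Sigma>s[OF assms, of u] H.t_nonzero
    by (elim disjE) (simp_all add: H.card_Fs H.p_0_right p\<Gamma>_\<sigma>\<^sub>0_right is_sign_cnj[OF sign_alpha])
  finally show ?thesis .
qed

section \<open>The correction W on labels from K and \<Sigma>\<close>

lemma W_Zero_K_K_eq: "W (LZero u) (LK k \<epsilon>) (LK k' \<epsilon>') =
    \<epsilon> * \<epsilon>' / 16 * (\<eta> * (\<Sum>h\<in>Ks. cG h (iG u) * (cG h k * cG h k')) +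
      (\<Sum>\<sigma>\<in>\<Sigma>s. c\<Gamma> \<sigma> (i\<Gamma> u) * (f k \<sigma> * f k' \<sigma>)))"
  by (simp add: W_def sum_negf distrib_left right_diff_distrib sum_distrib_left mult_ac s_sq)

lemma W_Pi_K_K_eq: "W (LPi u) (LK k \<epsilon>) (LK k' \<epsilon>') =
    \<epsilon> * \<epsilon>' / 16 * (\<eta> * (\<Sum>h\<in>Ks. cG h (iG u) * (cG h k * cG h k')) -
      (\<Sum>\<sigma>\<in>\<Sigma>s. c\<Gamma> \<sigma> (i\<Gamma> u) * (f k \<sigma> * f k' \<sigma>)))"
  by (simp add: W_def sum_negf distrib_left right_diff_distrib sum_distrib_left mult_ac s_sq)

lemma W_Zero_Sig_Sig_eq: "W (LZero u) (LSig \<sigma> \<epsilon>) (LSig \<sigma>' \<epsilon>') =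
    \<epsilon> * \<epsilon>' / 16 * ((\<Sum>k\<in>Ks. cG k (iG u) * (f k \<sigma> * f k \<sigma>')) +
      \<eta> * (\<Sum>h\<in>\<Sigma>s. c\<Gamma> h (i\<Gamma> u) * (c\<Gamma> h \<sigma> * c\<Gamma> h \<sigma>')))"
  by (simp add: W_def sum_negf distrib_left right_diff_distrib sum_distrib_left mult_ac s_sq)

lemma W_Pi_Sig_Sig_eq: "W (LPi u) (LSig \<sigma> \<epsilon>) (LSig \<sigma>' \<epsilon>') =
    \<epsilon> * \<epsilon>' / 16 * ((\<Sum>k\<in>Ks. cG k (iG u) * (f k \<sigma> * f k \<sigma>')) -
      \<eta> * (\<Sum>h\<in>\<Sigma>s. c\<Gamma> h (i\<Gamma> u) * (c\<Gamma> h \<sigma> * c\<Gamma> h \<sigma>')))"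
  by (simp add: W_def sum_negf distrib_left right_diff_distrib sum_distrib_left mult_ac s_sq)

lemma W_K_K_K_eq: "W (LK k \<epsilon>) (LK k' \<epsilon>') (LK k'' \<epsilon>'') =
    (\<epsilon> * \<epsilon>' + \<epsilon>' * \<epsilon>'' + \<epsilon>'' * \<epsilon>) / 16 * (\<eta> * (\<Sum>h\<in>Ks. cG h k * (cG h k' * cG h k'')))"
  by (simp add: W_def sum.distrib distrib_left distrib_right add_divide_distrib sum_distrib_left mult_ac s_sq)

lemma W_Sig_Sig_Sig_eq: "W (LSig \<sigma> \<epsilon>) (LSig \<sigma>' \<epsilon>') (LSig \<sigma>'' \<epsilon>'') =
    - ((\<epsilon> * \<epsilon>' + \<epsilon>' * \<epsilon>'' + \<epsilon>'' * \<epsilon>) / 16) *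
      (\<eta> * (\<Sum>h\<in>\<Sigma>s. c\<Gamma> h \<sigma> * (c\<Gamma> h \<sigma>' * c\<Gamma> h \<sigma>'')))"
  by (simp add: W_def sum.distrib distrib_left distrib_right left_diff_distrib right_diff_distrib add_divide_distrib
      sum_negf sum_subtractf sum_distrib_left sum_distrib_right mult_ac s_sq)

text \<open>The characters combine to the one at w = k + k' + k'', again in K; evaluating it at w
  and at w + \<open>k\<^sub>0\<close> gives the factor 1 + \<alpha>.\<close>

lemma sum_cG3_eq:
  assumes "k \<in> Ks" "k' \<in> Ks" "k'' \<in> Ks"
  shows "k + k' + k'' \<in> Ks"
    and "(\<Sum>h\<in>Ks. cG h k * (cG h k' * cG h k'')) = (1 + \<alpha>) * cG (k + k' + k'') (k + k' + k'')"
proof -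
  define w where "w = k + k' + k''"
  have "k + k' = 0 \<or> k + k' = k\<^sub>0"
    using G.Fs_add_Fs[of k k'] assms by simp
  then have w: "w \<in> Ks"
    unfolding w_def using assms G.Fs_add_t[of k''] by (elim disjE) (simp_all add: add.commute)
  have "(\<Sum>h\<in>Ks. cG h k * (cG h k' * cG h k'')) = (\<Sum>h\<in>Ks. cG h w)"
    by (simp add: w_def G.p_add_right mult.assoc)
  also have "\<dots> = (1 + \<alpha>) * cG w w"
    using w by (subst G.sum_Fs[OF w])
      (simp add: G.p_add_left pairing_k\<^sub>0 is_sign_cnj[OF sign_alpha] algebra_simps)
  finally show "(\<Sum>h\<in>Ks. cG h k * (cG h k' * cG h k'')) = (1 + \<alpha>) * cG (k + k' + k'') (k + k' + k'')"
    unfolding w_def .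
  show "k + k' + k'' \<in> Ks"
    using w unfolding w_def .
qed

lemma sum_c\<Gamma>3_eq:
  assumes "k \<in> \<Sigma>s" "k' \<in> \<Sigma>s" "k'' \<in> \<Sigma>s"
  shows "k + k' + k'' \<in> \<Sigma>s"
    and "(\<Sum>h\<in>\<Sigma>s. c\<Gamma> h k * (c\<Gamma> h k' * c\<Gamma> h k'')) = (1 - \<alpha>) * c\<Gamma> (k + k' + k'') (k + k' + k'')"
proof -
  define w where "w = k + k' + k''"
  have "k + k' = 0 \<or> k + k' = \<sigma>\<^sub>0"
    using H.Fs_add_Fs[of k k'] assms by simp
  then have w: "w \<in> \<Sigma>s"
    unfolding w_def using assms H.Fs_add_t[of k''] by (elim disjE) (simp_all add: add.commute)
  have "(\<Sum>h\<in>\<Sigma>s. c\<Gamma> h k * (c\<Gamma> h k' * c\<Gamma> h k'')) = (\<Sum>h\<in>\<Sigma>s. c\<Gamma> h w)"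
    by (simp add: w_def H.p_add_right mult.assoc)
  also have "\<dots> = (1 - \<alpha>) * c\<Gamma> w w"
    using w by (subst H.sum_Fs[OF w])
      (simp add: H.p_add_left pairing_\<sigma>\<^sub>0 is_sign_cnj[OF sign_alpha] algebra_simps)
  finally show "(\<Sum>h\<in>\<Sigma>s. c\<Gamma> h k * (c\<Gamma> h k' * c\<Gamma> h k'')) = (1 - \<alpha>) * c\<Gamma> (k + k' + k'') (k + k' + k'')"
    unfolding w_def .
  show "k + k' + k'' \<in> \<Sigma>s"
    using w unfolding w_def .
qed

end

section \<open>The fusion coefficients\<close>

text \<open>The five conditions in terms of \<alpha>. If the fixed points are cyclic,
  \<open>q_t_of_double\<close> gives q0(u0) = \<alpha> on the side of G and q0(u0) = -\<alpha> on
  the side of \<Gamma>; thus q0(u0) = -1 reads \<alpha> = -1 in (4) and \<alpha> = 1 in (5).\<close>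

locale fusion_conditions =
  fusion_data q\<^sub>1 \<theta>\<^sub>1 k\<^sub>0 Gs q\<^sub>2 \<theta>\<^sub>2 \<sigma>\<^sub>0 \<Gamma>s s f \<alpha>
  for q\<^sub>1 :: "'g::{ab_group_add,finite} \<Rightarrow> complex" and \<theta>\<^sub>1 :: "'g \<Rightarrow> 'g"
    and k\<^sub>0 :: 'g and Gs :: "'g set"
    and q\<^sub>2 :: "'h::{ab_group_add,finite} \<Rightarrow> complex" and \<theta>\<^sub>2 :: "'h \<Rightarrow> 'h"
    and \<sigma>\<^sub>0 :: 'h and \<Gamma>s :: "'h set"
    and s :: complex and f :: "'g \<Rightarrow> 'h \<Rightarrow> complex" and \<alpha> :: complex +
  assumes card_eq: "CARD('h) = CARD('g) + 4"
    and cond_k: "k \<in> Ks \<Longrightarrow> (1 + \<alpha>) * (1 - s\<^sup>2 * pG k k) = 0"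
    and cond_\<sigma>: "\<sigma> \<in> \<Sigma>s \<Longrightarrow> (1 - \<alpha>) * (1 + s\<^sup>2 * p\<Gamma> \<sigma> \<sigma>) = 0"
    and cyclic_k: "k \<in> Ks \<Longrightarrow> k + k \<noteq> 0 \<Longrightarrow> \<alpha> = -1"
    and cyclic_\<sigma>: "\<sigma> \<in> \<Sigma>s \<Longrightarrow> \<sigma> + \<sigma> \<noteq> 0 \<Longrightarrow> \<alpha> = 1"
begin

lemma N_eq_quarter: "x \<in> J \<Longrightarrow> y \<in> J \<Longrightarrow> z \<in> J \<Longrightarrow>
    N x y z = T x y z / 2 + (v\<^sub>0 x * v\<^sub>0 y * v\<^sub>0 z + v\<^sub>1 x * v\<^sub>1 y * v\<^sub>1 z) / 8 + 2 * W x y z"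
  using card_eq by (subst N_eq) (simp_all add: \<kappa>_def)

section \<open>Coefficients with at most one label in K or \<Sigma>, where W vanishes\<close>

lemma N_Zero_Zero_Zero:
  shows "N (LZero u) (LZero u') (LZero u'') = of_bool (u + u' + u'' = 0)"
  by (simp add: N_eq_quarter J_intros T_simps p_simps W_def) (simp add: field_simps)?

lemma N_Zero_Pi_Pi:
  shows "N (LZero u) (LPi u') (LPi u'') = of_bool (u + u' + u'' = 0)"
  by (simp add: N_eq_quarter J_intros T_simps p_simps W_def) (simp add: field_simps)?

lemma N_Zero_Zero_Pi:
  shows "N (LZero u) (LZero u') (LPi u'') = 0"
  by (simp add: N_eq_quarter J_intros T_simps p_simps W_def) (simp add: field_simps)?

lemma N_Zero_Zero_K:
  assumes "k \<in> Ks" "\<epsilon> \<in> {1, -1}"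
  shows "N (LZero u) (LZero u') (LK k \<epsilon>) = 0"
  using assms by (simp add: N_eq_quarter J_intros T_simps p_simps W_def) (simp add: field_simps)?

lemma N_Zero_Zero_G:
  assumes "g \<in> Gs"
  shows "N (LZero u) (LZero u') (LG g) = 0"
  using assms by (simp add: N_eq_quarter J_intros T_simps p_simps W_def) (simp add: field_simps)?

lemma N_Zero_Zero_Sig:
  assumes "\<sigma> \<in> \<Sigma>s" "\<epsilon> \<in> {1, -1}"
  shows "N (LZero u) (LZero u') (LSig \<sigma> \<epsilon>) = 0"
  using assms by (simp add: N_eq_quarter J_intros T_simps p_simps W_def) (simp add: field_simps)?

lemma N_Zero_Zero_Gam:
  assumes "\<gamma> \<in> \<Gamma>s"
  shows "N (LZero u) (LZero u') (LGam \<gamma>) = 0"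
  using assms by (simp add: N_eq_quarter J_intros T_simps p_simps W_def) (simp add: field_simps)?

lemma N_Zero_Pi_K:
  assumes "k \<in> Ks" "\<epsilon> \<in> {1, -1}"
  shows "N (LZero u) (LPi u') (LK k \<epsilon>) = 0"
  using assms by (simp add: N_eq_quarter J_intros T_simps p_simps W_def) (simp add: field_simps)?

lemma N_Zero_Pi_G:
  assumes "g \<in> Gs"
  shows "N (LZero u) (LPi u') (LG g) = 0"
  using assms by (simp add: N_eq_quarter J_intros T_simps p_simps W_def) (simp add: field_simps)?

lemma N_Zero_Pi_Sig:
  assumes "\<sigma> \<in> \<Sigma>s" "\<epsilon> \<in> {1, -1}"
  shows "N (LZero u) (LPi u') (LSig \<sigma> \<epsilon>) = 0"
  using assms by (simp add: N_eq_quarter J_intros T_simps p_simps W_def) (simp add: field_simps)?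

lemma N_Zero_Pi_Gam:
  assumes "\<gamma> \<in> \<Gamma>s"
  shows "N (LZero u) (LPi u') (LGam \<gamma>) = 0"
  using assms by (simp add: N_eq_quarter J_intros T_simps p_simps W_def) (simp add: field_simps)?

lemma N_Zero_G_G:
  assumes "g \<in> Gs" "g' \<in> Gs"
  shows "N (LZero u) (LG g) (LG g') =
    of_bool (iG u + g + g' = 0) + of_bool (iG u + g + \<theta>\<^sub>1 g' = 0)"
  using assms by (simp add: N_eq_quarter J_intros T_simps p_simps W_def) (simp add: field_simps)?

lemma N_Zero_Gam_Gam:
  assumes "\<gamma> \<in> \<Gamma>s" "\<gamma>' \<in> \<Gamma>s"
  shows "N (LZero u) (LGam \<gamma>) (LGam \<gamma>') =
    of_bool (i\<Gamma> u + \<gamma> + \<gamma>' = 0) + of_bool (i\<Gamma> u + \<gamma> + \<theta>\<^sub>2 \<gamma>' = 0)"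
  using assms by (simp add: N_eq_quarter J_intros T_simps p_simps W_def) (simp add: field_simps)?

lemma N_Zero_K_G:
  assumes "k \<in> Ks" "\<epsilon> \<in> {1, -1}" "g \<in> Gs"
  shows "N (LZero u) (LK k \<epsilon>) (LG g) = 0"
  using assms by (simp add: N_eq_quarter J_intros T_simps p_simps W_def) (simp add: field_simps)?

lemma N_Zero_K_Gam:
  assumes "k \<in> Ks" "\<epsilon> \<in> {1, -1}" "\<gamma> \<in> \<Gamma>s"
  shows "N (LZero u) (LK k \<epsilon>) (LGam \<gamma>) = 0"
  using assms by (simp add: N_eq_quarter J_intros T_simps p_simps W_def) (simp add: field_simps)?

lemma N_Zero_G_Sig:
  assumes "g \<in> Gs" "\<sigma> \<in> \<Sigma>s" "\<epsilon> \<in> {1, -1}"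
  shows "N (LZero u) (LG g) (LSig \<sigma> \<epsilon>) = 0"
  using assms by (simp add: N_eq_quarter J_intros T_simps p_simps W_def) (simp add: field_simps)?

lemma N_Zero_G_Gam:
  assumes "g \<in> Gs" "\<gamma> \<in> \<Gamma>s"
  shows "N (LZero u) (LG g) (LGam \<gamma>) = 0"
  using assms by (simp add: N_eq_quarter J_intros T_simps p_simps W_def) (simp add: field_simps)?

lemma N_Zero_Sig_Gam:
  assumes "\<sigma> \<in> \<Sigma>s" "\<epsilon> \<in> {1, -1}" "\<gamma> \<in> \<Gamma>s"
  shows "N (LZero u) (LSig \<sigma> \<epsilon>) (LGam \<gamma>) = 0"
  using assms by (simp add: N_eq_quarter J_intros T_simps p_simps W_def) (simp add: field_simps)?

lemma N_Pi_Pi_Pi: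
  shows "N (LPi u) (LPi u') (LPi u'') = 2"
  by (simp add: N_eq_quarter J_intros T_simps p_simps W_def) (simp add: field_simps)?

lemma N_Pi_Pi_K:
  assumes "k \<in> Ks" "\<epsilon> \<in> {1, -1}"
  shows "N (LPi u) (LPi u') (LK k \<epsilon>) = (1 + pG k (iG 1)) / 2"
  using assms by (simp add: N_eq_quarter J_intros T_simps p_simps W_def) (simp add: field_simps)?

lemma N_Pi_Pi_G:
  assumes "g \<in> Gs"
  shows "N (LPi u) (LPi u') (LG g) = 1 + pG g (iG 1)"
  using assms by (simp add: N_eq_quarter J_intros T_simps p_simps W_def) (simp add: field_simps)?

lemma N_Pi_Pi_Sig:
  assumes "\<sigma> \<in> \<Sigma>s" "\<epsilon> \<in> {1, -1}"
  shows "N (LPi u) (LPi u') (LSig \<sigma> \<epsilon>) = (1 + p\<Gamma> \<sigma> (i\<Gamma> 1)) / 2"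
  using assms by (simp add: N_eq_quarter J_intros T_simps p_simps W_def) (simp add: field_simps)?

lemma N_Pi_Pi_Gam:
  assumes "\<gamma> \<in> \<Gamma>s"
  shows "N (LPi u) (LPi u') (LGam \<gamma>) = 1 + p\<Gamma> \<gamma> (i\<Gamma> 1)"
  using assms by (simp add: N_eq_quarter J_intros T_simps p_simps W_def) (simp add: field_simps)?

lemma N_Pi_K_G:
  assumes "k \<in> Ks" "\<epsilon> \<in> {1, -1}" "g \<in> Gs"
  shows "N (LPi u) (LK k \<epsilon>) (LG g) = (1 + pG (k + g) (iG 1)) / 2"
  using assms by (simp add: N_eq_quarter J_intros T_simps p_simps W_def) (simp add: field_simps)?

lemma N_Pi_K_Gam:
  assumes "k \<in> Ks" "\<epsilon> \<in> {1, -1}" "\<gamma> \<in> \<Gamma>s"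
  shows "N (LPi u) (LK k \<epsilon>) (LGam \<gamma>) = (1 + pG k (iG 1) * p\<Gamma> \<gamma> (i\<Gamma> 1)) / 2"
  using assms by (simp add: N_eq_quarter J_intros T_simps p_simps W_def) (simp add: field_simps)?

lemma N_Pi_G_G:
  assumes "g \<in> Gs" "g' \<in> Gs"
  shows "N (LPi u) (LG g) (LG g') =
    1 + pG (g + g') (iG 1) + of_bool (iG u + g + g' = 0) + of_bool (iG u + g + \<theta>\<^sub>1 g' = 0)"
  using assms by (simp add: N_eq_quarter J_intros T_simps p_simps W_def) (simp add: field_simps)?

lemma N_Pi_G_Sig:
  assumes "g \<in> Gs" "\<sigma> \<in> \<Sigma>s" "\<epsilon> \<in> {1, -1}"
  shows "N (LPi u) (LG g) (LSig \<sigma> \<epsilon>) = (1 + pG g (iG 1) * p\<Gamma> \<sigma> (i\<Gamma> 1)) / 2"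
  using assms by (simp add: N_eq_quarter J_intros T_simps p_simps W_def) (simp add: field_simps)?

lemma N_Pi_G_Gam:
  assumes "g \<in> Gs" "\<gamma> \<in> \<Gamma>s"
  shows "N (LPi u) (LG g) (LGam \<gamma>) = 1 + pG g (iG 1) * p\<Gamma> \<gamma> (i\<Gamma> 1)"
  using assms by (simp add: N_eq_quarter J_intros T_simps p_simps W_def) (simp add: field_simps)?

lemma N_Pi_Sig_Gam:
  assumes "\<sigma> \<in> \<Sigma>s" "\<epsilon> \<in> {1, -1}" "\<gamma> \<in> \<Gamma>s"
  shows "N (LPi u) (LSig \<sigma> \<epsilon>) (LGam \<gamma>) = (1 + p\<Gamma> (\<sigma> + \<gamma>) (i\<Gamma> 1)) / 2"
  using assms by (simp add: N_eq_quarter J_intros T_simps p_simps W_def) (simp add: field_simps)?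

lemma N_Pi_Gam_Gam:
  assumes "\<gamma> \<in> \<Gamma>s" "\<gamma>' \<in> \<Gamma>s"
  shows "N (LPi u) (LGam \<gamma>) (LGam \<gamma>') =
    1 + p\<Gamma> (\<gamma> + \<gamma>') (i\<Gamma> 1) - of_bool (i\<Gamma> u + \<gamma> + \<gamma>' = 0) - of_bool (i\<Gamma> u + \<gamma> + \<theta>\<^sub>2 \<gamma>' = 0)"
  using assms by (simp add: N_eq_quarter J_intros T_simps p_simps W_def) (simp add: field_simps)?

lemma N_K_G_G:
  assumes "k \<in> Ks" "\<epsilon> \<in> {1, -1}" "g \<in> Gs" "g' \<in> Gs"
  shows "N (LK k \<epsilon>) (LG g) (LG g') =
    (1 + pG (k + g + g') (iG 1)) / 2 + of_bool (k + g + g' = 0) + of_bool (k + g + \<theta>\<^sub>1 g' = 0)"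
  using assms by (simp add: N_eq_quarter J_intros T_simps p_simps W_def) (simp add: field_simps)?

lemma N_K_G_Gam:
  assumes "k \<in> Ks" "\<epsilon> \<in> {1, -1}" "g \<in> Gs" "\<gamma> \<in> \<Gamma>s"
  shows "N (LK k \<epsilon>) (LG g) (LGam \<gamma>) = (1 + pG (k + g) (iG 1) * p\<Gamma> \<gamma> (i\<Gamma> 1)) / 2"
  using assms by (simp add: N_eq_quarter J_intros T_simps p_simps W_def) (simp add: field_simps)?

lemma N_K_Gam_Gam:
  assumes "k \<in> Ks" "\<epsilon> \<in> {1, -1}" "\<gamma> \<in> \<Gamma>s" "\<gamma>' \<in> \<Gamma>s"
  shows "N (LK k \<epsilon>) (LGam \<gamma>) (LGam \<gamma>') = (1 + pG k (iG 1) * p\<Gamma> (\<gamma> + \<gamma>') (i\<Gamma> 1)) / 2"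
  using assms by (simp add: N_eq_quarter J_intros T_simps p_simps W_def) (simp add: field_simps)?

lemma N_G_G_G:
  assumes "g \<in> Gs" "g' \<in> Gs" "g'' \<in> Gs"
  shows "N (LG g) (LG g') (LG g'') =
    1 + pG (g + g' + g'') (iG 1) + of_bool (g + g' + g'' = 0) + of_bool (\<theta>\<^sub>1 g + g' + g'' = 0) +
      of_bool (g + \<theta>\<^sub>1 g' + g'' = 0) + of_bool (g + g' + \<theta>\<^sub>1 g'' = 0)"
  using assms by (simp add: N_eq_quarter J_intros T_simps p_simps W_def) (simp add: field_simps)?

lemma N_G_G_Sig:
  assumes "g \<in> Gs" "g' \<in> Gs" "\<sigma> \<in> \<Sigma>s" "\<epsilon> \<in> {1, -1}"
  shows "N (LG g) (LG g') (LSig \<sigma> \<epsilon>) = (1 + pG (g + g') (iG 1) * p\<Gamma> \<sigma> (i\<Gamma> 1)) / 2"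
  using assms by (simp add: N_eq_quarter J_intros T_simps p_simps W_def) (simp add: field_simps)?

lemma N_G_G_Gam:
  assumes "g \<in> Gs" "g' \<in> Gs" "\<gamma> \<in> \<Gamma>s"
  shows "N (LG g) (LG g') (LGam \<gamma>) = 1 + pG (g + g') (iG 1) * p\<Gamma> \<gamma> (i\<Gamma> 1)"
  using assms by (simp add: N_eq_quarter J_intros T_simps p_simps W_def) (simp add: field_simps)?

lemma N_G_Sig_Gam:
  assumes "g \<in> Gs" "\<sigma> \<in> \<Sigma>s" "\<epsilon> \<in> {1, -1}" "\<gamma> \<in> \<Gamma>s"
  shows "N (LG g) (LSig \<sigma> \<epsilon>) (LGam \<gamma>) = (1 + pG g (iG 1) * p\<Gamma> (\<sigma> + \<gamma>) (i\<Gamma> 1)) / 2"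
  using assms by (simp add: N_eq_quarter J_intros T_simps p_simps W_def) (simp add: field_simps)?

lemma N_G_Gam_Gam:
  assumes "g \<in> Gs" "\<gamma> \<in> \<Gamma>s" "\<gamma>' \<in> \<Gamma>s"
  shows "N (LG g) (LGam \<gamma>) (LGam \<gamma>') = 1 + pG g (iG 1) * p\<Gamma> (\<gamma> + \<gamma>') (i\<Gamma> 1)"
  using assms by (simp add: N_eq_quarter J_intros T_simps p_simps W_def) (simp add: field_simps)?

lemma N_Sig_Gam_Gam:
  assumes "\<sigma> \<in> \<Sigma>s" "\<epsilon> \<in> {1, -1}" "\<gamma> \<in> \<Gamma>s" "\<gamma>' \<in> \<Gamma>s"
  shows "N (LSig \<sigma> \<epsilon>) (LGam \<gamma>) (LGam \<gamma>') =
    (1 + p\<Gamma> (\<sigma> + \<gamma> + \<gamma>') (i\<Gamma> 1)) / 2 - of_bool (\<sigma> + \<gamma> + \<gamma>' = 0) - of_bool (\<sigma> + \<gamma> + \<theta>\<^sub>2 \<gamma>' = 0)"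
  using assms by (simp add: N_eq_quarter J_intros T_simps p_simps W_def) (simp add: field_simps)?

lemma N_Gam_Gam_Gam:
  assumes "\<gamma> \<in> \<Gamma>s" "\<gamma>' \<in> \<Gamma>s" "\<gamma>'' \<in> \<Gamma>s"
  shows "N (LGam \<gamma>) (LGam \<gamma>') (LGam \<gamma>'') =
    1 + p\<Gamma> (\<gamma> + \<gamma>' + \<gamma>'') (i\<Gamma> 1) - of_bool (\<gamma> + \<gamma>' + \<gamma>'' = 0) - of_bool (\<theta>\<^sub>2 \<gamma> + \<gamma>' + \<gamma>'' = 0) -
      of_bool (\<gamma> + \<theta>\<^sub>2 \<gamma>' + \<gamma>'' = 0) - of_bool (\<gamma> + \<gamma>' + \<theta>\<^sub>2 \<gamma>'' = 0)"
  using assms by (simp add: N_eq_quarter J_intros T_simps p_simps W_def) (simp add: field_simps)?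

section \<open>Values of W under the conditions\<close>

lemma pG_self:
  assumes "k \<in> Ks" "\<alpha> = 1"
  shows "pG k k = \<eta>"
proof -
  have "\<eta> * pG k k = 1" using cond_k[of k] assms by (simp add: s_sq)
  then show ?thesis using \<eta>_sq(2)[of "pG k k"] by simp
qed

lemma p\<Gamma>_self:
  assumes "\<sigma> \<in> \<Sigma>s" "\<alpha> = -1"
  shows "p\<Gamma> \<sigma> \<sigma> = - \<eta>"
proof -
  have "\<eta> * p\<Gamma> \<sigma> \<sigma> = -1" using cond_\<sigma>[of \<sigma>] assms by (simp add: s_sq add_eq_0_iff)
  then show ?thesis using \<eta>_sq(2)[of "p\<Gamma> \<sigma> \<sigma>"] by simp
qed

lemmas value_simps = cG_self_sq s_sq \<eta>_sq cnj_\<eta> f_sq pG_self p\<Gamma>_self pG_k\<^sub>0_right p\<Gamma>_\<sigma>\<^sub>0_right cnj_pG_k\<^sub>0 cnj_p\<Gamma>_\<sigma>\<^sub>0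
  G.p_add_left H.p_add_left f_add_k\<^sub>0 f_add_\<sigma>\<^sub>0 G.pairing_t_t H.pairing_t_t G.p_0_left H.p_0_left G.p_0_right H.p_0_right
  G.p_fixed_theta H.p_fixed_theta is_sign_cnj[OF sign_alpha] \<alpha>_sq G.t_fix H.t_fix

text \<open>For \<alpha> = -1 both branches are \<eta> and no factor depends on u or k'. For
  \<alpha> = 1 condition (4) gives 2k = 0, so the sum vanishes exactly if u = 0, k' = k or u = 1, k'
  = k + \<open>k\<^sub>0\<close>; in the second case the character and f each contribute a factor
  -\<alpha>.\<close>

lemma f_f_left:
  assumes "k \<in> Ks" "k' \<in> Ks" "\<sigma> \<in> \<Sigma>s"
  shows "c\<Gamma> \<sigma> (i\<Gamma> u) * (f k \<sigma> * f k' \<sigma>) = (if iG u + k + k' = 0 then \<eta> else - \<alpha> * \<eta>)"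
proof (cases "\<alpha> = 1")
  case True
  then have "k + k = 0" using cyclic_k[of k] assms by auto
  then have kk: "k + k + x = x" "k + (k + x) = x" "k\<^sub>0 + (k\<^sub>0 + x) = x" for x
    by (simp_all add: G.t_double flip: add.assoc)
  show ?thesis
    using G.Fs_cases[of k k'] assms True G.t_nonzero
    by (cases u) (auto simp: from_U_def H.p_0_right f_sq p\<Gamma>_\<sigma>\<^sub>0_right f_add_k\<^sub>0 kk add_ac G.t_double \<open>k + k = 0\<close>)
next
  case False
  then have "\<alpha> = -1" using \<alpha>_cases by simp
  then show ?thesis
    using G.Fs_cases[of k k'] assms
    by (cases u) (auto simp: from_U_def H.p_0_right f_sq p\<Gamma>_\<sigma>\<^sub>0_right f_add_k\<^sub>0)
qed

text \<open>The mirror image: the factors are \<alpha> instead of -\<alpha>, so \<alpha> = 1 is the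
  trivial case and condition (5) serves \<alpha> = -1.\<close>

lemma f_f_right:
  assumes "k \<in> Ks" "\<sigma> \<in> \<Sigma>s" "\<sigma>' \<in> \<Sigma>s"
  shows "cG k (iG u) * (f k \<sigma> * f k \<sigma>') = (if i\<Gamma> u + \<sigma> + \<sigma>' = 0 then \<eta> else \<alpha> * \<eta>)"
proof (cases "\<alpha> = 1")
  case False
  then have "\<alpha> = -1" using \<alpha>_cases by simp
  then have "\<sigma> + \<sigma> = 0" using cyclic_\<sigma>[of \<sigma>] assms by auto
  then have kk: "\<sigma> + \<sigma> + x = x" "\<sigma> + (\<sigma> + x) = x" "\<sigma>\<^sub>0 + (\<sigma>\<^sub>0 + x) = x" for x
    by (simp_all add: H.t_double flip: add.assoc)
  show ?thesis
    using H.Fs_cases[of \<sigma> \<sigma>'] assms \<open>\<alpha> = -1\<close> H.t_nonzero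
    by (cases u) (auto simp: from_U_def G.p_0_right f_sq pG_k\<^sub>0_right f_add_\<sigma>\<^sub>0 kk add_ac H.t_double \<open>\<sigma> + \<sigma> = 0\<close>)
next
  case True
  then show ?thesis
    using H.Fs_cases[of \<sigma> \<sigma>'] assms
    by (cases u) (auto simp: from_U_def G.p_0_right f_sq pG_k\<^sub>0_right f_add_\<sigma>\<^sub>0)
qed

lemma sum_f_f_left:
  assumes "k \<in> Ks" "k' \<in> Ks"
  shows "(\<Sum>\<sigma>\<in>\<Sigma>s. c\<Gamma> \<sigma> (i\<Gamma> u) * (f k \<sigma> * f k' \<sigma>)) = (if iG u + k + k' = 0 then 2 * \<eta> else - 2 * \<alpha> * \<eta>)"
  using assms by (simp only: f_f_left cong: sum.cong) (simp add: H.card_Fs)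

lemma sum_f_f_right:
  assumes "\<sigma> \<in> \<Sigma>s" "\<sigma>' \<in> \<Sigma>s"
  shows "(\<Sum>k\<in>Ks. cG k (iG u) * (f k \<sigma> * f k \<sigma>')) = (if i\<Gamma> u + \<sigma> + \<sigma>' = 0 then 2 * \<eta> else 2 * \<alpha> * \<eta>)"
  using assms by (simp only: f_f_right cong: sum.cong) (simp add: G.card_Fs)

text \<open>For \<alpha> = -1 the character sum is 0; for \<alpha> = 1 condition (2) makes <w,w> =
  s^2, which cancels the factor \<eta>.\<close>

lemma W_K_K_K:
  assumes "k \<in> Ks" "k' \<in> Ks" "k'' \<in> Ks"
  shows "W (LK k \<epsilon>) (LK k' \<epsilon>') (LK k'' \<epsilon>'') = (1 + \<alpha>) * (\<epsilon> * \<epsilon>' + \<epsilon>' * \<epsilon>'' + \<epsilon>'' * \<epsilon>) / 16"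
proof -
  obtain w where "w \<in> Ks" "(\<Sum>h\<in>Ks. cG h k * (cG h k' * cG h k'')) = (1 + \<alpha>) * cG w w"
    using sum_cG3_eq[OF assms] by blast
  then have "\<eta> * (\<Sum>h\<in>Ks. cG h k * (cG h k' * cG h k'')) = 1 + \<alpha>"
    using \<alpha>_cases by (elim disjE) (simp_all add: pG_self cnj_\<eta> \<eta>_sq)
  then show ?thesis
    unfolding W_K_K_K_eq by simp
qed

lemma W_Sig_Sig_Sig:
  assumes "\<sigma> \<in> \<Sigma>s" "\<sigma>' \<in> \<Sigma>s" "\<sigma>'' \<in> \<Sigma>s"
  shows "W (LSig \<sigma> \<epsilon>) (LSig \<sigma>' \<epsilon>') (LSig \<sigma>'' \<epsilon>'') = (1 - \<alpha>) * (\<epsilon> * \<epsilon>' + \<epsilon>' * \<epsilon>'' + \<epsilon>'' * \<epsilon>) / 16"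
proof -
  obtain w where "w \<in> \<Sigma>s" "(\<Sum>h\<in>\<Sigma>s. c\<Gamma> h \<sigma> * (c\<Gamma> h \<sigma>' * c\<Gamma> h \<sigma>'')) = (1 - \<alpha>) * c\<Gamma> w w"
    using sum_c\<Gamma>3_eq[OF assms] by blast
  then have *: "\<eta> * (\<Sum>h\<in>\<Sigma>s. c\<Gamma> h \<sigma> * (c\<Gamma> h \<sigma>' * c\<Gamma> h \<sigma>'')) = - (1 - \<alpha>)"
    using \<alpha>_cases by (elim disjE) (simp_all add: p\<Gamma>_self cnj_\<eta> \<eta>_sq)
  show ?thesis
    unfolding W_Sig_Sig_Sig_eq * by (simp add: field_simps)
qed

text \<open>The sums over K and over \<Sigma> agree where the delta fires and are opposite
  elsewhere. Since \<omega> has opposite signs at (u,0) and (u,\<pi>), the first label keeps one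
  case and the second label the other.\<close>

lemma W_K_K:
  assumes "k \<in> Ks" "k' \<in> Ks"
  shows "W (LZero u) (LK k \<epsilon>) (LK k' \<epsilon>') = (if iG u + k + k' = 0 then \<epsilon> * \<epsilon>' * \<eta> / 4 else 0)"
    and "W (LPi u) (LK k \<epsilon>) (LK k' \<epsilon>') = (if iG u + k + k' = 0 then 0 else \<epsilon> * \<epsilon>' * \<eta> * \<alpha> / 4)"
  unfolding W_Zero_K_K_eq W_Pi_K_K_eq sum_cG_Ks[OF assms] sum_f_f_left[OF assms]
  by (simp_all add: algebra_simps)

lemma W_Sig_Sig:
  assumes "\<sigma> \<in> \<Sigma>s" "\<sigma>' \<in> \<Sigma>s"
  shows "W (LZero u) (LSig \<sigma> \<epsilon>) (LSig \<sigma>' \<epsilon>') = (if i\<Gamma> u + \<sigma> + \<sigma>' = 0 then \<epsilon> * \<epsilon>' * \<eta> / 4 else 0)"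
    and "W (LPi u) (LSig \<sigma> \<epsilon>) (LSig \<sigma>' \<epsilon>') = (if i\<Gamma> u + \<sigma> + \<sigma>' = 0 then 0 else \<epsilon> * \<epsilon>' * \<eta> * \<alpha> / 4)"
  unfolding W_Zero_Sig_Sig_eq W_Pi_Sig_Sig_eq sum_c\<Gamma>_\<Sigma>s[OF assms] sum_f_f_right[OF assms]
  by (simp_all add: algebra_simps)

section \<open>Coefficients with two or three labels in K or \<Sigma>\<close>

lemma N_Zero_K_K:
  assumes "k \<in> Ks" "\<epsilon> \<in> {1, -1}" "k' \<in> Ks" "\<epsilon>' \<in> {1, -1}"
  shows "N (LZero u) (LK k \<epsilon>) (LK k' \<epsilon>') = of_bool (iG u + k + k' = 0) * of_bool (\<epsilon> = s\<^sup>2 * \<epsilon>')"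
  \<comment> \<open>Where the delta fires, the coefficient is (1 + \<epsilon> \<epsilon>' \<eta>) /
    2. So the dual of (k,\<epsilon>) carries the sign s^2 \<epsilon>: the sign factor is the
    Kronecker delta of \<epsilon> and \<epsilon>' for s^2 = 1, but for s^2 = -1 it asks for opposite
    signs.\<close>
  using assms iG_add_Ks[OF assms(1,3), of u] \<eta>_cases
  by (elim disjE) (auto simp: N_eq_quarter J_intros T_simps W_K_K s_sq G.t_nonzero)

lemma N_Zero_Sig_Sig:
  assumes "\<sigma> \<in> \<Sigma>s" "\<epsilon> \<in> {1, -1}" "\<sigma>' \<in> \<Sigma>s" "\<epsilon>' \<in> {1, -1}"
  shows "N (LZero u) (LSig \<sigma> \<epsilon>) (LSig \<sigma>' \<epsilon>') =
    of_bool (i\<Gamma> u + \<sigma> + \<sigma>' = 0) * of_bool (\<epsilon> = s\<^sup>2 * \<epsilon>')"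
  using assms i\<Gamma>_add_\<Sigma>s[OF assms(1,3), of u] \<eta>_cases
  by (elim disjE) (auto simp: N_eq_quarter J_intros T_simps W_Sig_Sig s_sq H.t_nonzero)

text \<open>Passing from h to h + \<open>k\<^sub>0\<close> multiplies <h,k> by \<alpha> and
  f(h,\<sigma>) by -\<alpha>, so the two terms of W over K cancel; over \<Sigma> the factors are
  -\<alpha> and \<alpha>. The same happens with (u,\<pi>) in place of (u,0).\<close>

lemma N_Zero_K_Sig:
  assumes "k \<in> Ks" "\<epsilon> \<in> {1, -1}" "\<sigma> \<in> \<Sigma>s" "\<epsilon>' \<in> {1, -1}"
  shows "N (LZero u) (LK k \<epsilon>) (LSig \<sigma> \<epsilon>') = 0"
proof -
  have k: "k \<in> Ks" using assms by blast
  have \<sigma>: "\<sigma> \<in> \<Sigma>s" using assms by blast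
  have J: "LZero u \<in> J" "LK k \<epsilon> \<in> J" "LSig \<sigma> \<epsilon>' \<in> J"
    using assms by (simp_all add: J_intros)
  show ?thesis
    unfolding N_eq_quarter[OF J] W_eq[OF k \<sigma>]
    using k \<sigma> G.Fs_add_t[OF k] H.Fs_add_t[OF \<sigma>] assms(1,3)
    by - (simp add: T_simps p_simps value_simps;
      rule disjE[OF \<alpha>_cases]; (simp add: field_simps value_simps)?)
qed

text \<open>The last bracket does not depend on the choice of \<open>k\<^sub>1\<close> and
  \<open>\<sigma>\<^sub>1\<close>: it is 0 if the sum is 0, and \<alpha> - (-\<alpha>) = 2 \<alpha>
  if the sum is u0.\<close>

lemma N_Pi_K_K:
  assumes "k \<in> Ks" "\<epsilon> \<in> {1, -1}" "k' \<in> Ks" "\<epsilon>' \<in> {1, -1}" "k\<^sub>1 \<in> Ks" "\<sigma>\<^sub>1 \<in> \<Sigma>s"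
  shows "N (LPi u) (LK k \<epsilon>) (LK k' \<epsilon>') =
    (1 + of_bool (iG u + k + k' = 0)) / 2 + \<epsilon> * \<epsilon>' * s\<^sup>2 / 4 * (pG (iG u + k + k') k\<^sub>1 - p\<Gamma> (i\<Gamma>
      (to_U (iG u + k + k'))) \<sigma>\<^sub>1)"
  using assms iG_add_Ks[OF assms(1,3), of u]
  by (elim disjE; simp add: N_eq_quarter J_intros T_simps W_K_K p_simps s_sq to_U_def from_U_0 G.p_0_left H.p_0_left
    G.t_nonzero; simp add: mult.assoc \<alpha>_sq)

lemma N_Pi_K_Sig:
  assumes "k \<in> Ks" "\<epsilon> \<in> {1, -1}" "\<sigma> \<in> \<Sigma>s" "\<epsilon>' \<in> {1, -1}"
  shows "N (LPi u) (LK k \<epsilon>) (LSig \<sigma> \<epsilon>') = 0"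
proof -
  have k: "k \<in> Ks" using assms by blast
  have \<sigma>: "\<sigma> \<in> \<Sigma>s" using assms by blast
  have J: "LPi u \<in> J" "LK k \<epsilon> \<in> J" "LSig \<sigma> \<epsilon>' \<in> J"
    using assms by (simp_all add: J_intros)
  show ?thesis
    unfolding N_eq_quarter[OF J] W_eq[OF k \<sigma>]
    using k \<sigma> G.Fs_add_t[OF k] H.Fs_add_t[OF \<sigma>] assms(1,3)
    by - (simp add: T_simps p_simps value_simps;
      rule disjE[OF \<alpha>_cases]; (simp add: field_simps value_simps)?)
qed

lemma N_Pi_Sig_Sig:
  assumes "\<sigma> \<in> \<Sigma>s" "\<epsilon> \<in> {1, -1}" "\<sigma>' \<in> \<Sigma>s" "\<epsilon>' \<in> {1, -1}" "k\<^sub>1 \<in> Ks"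
  shows "N (LPi u) (LSig \<sigma> \<epsilon>) (LSig \<sigma>' \<epsilon>') =
    (1 - of_bool (i\<Gamma> u + \<sigma> + \<sigma>' = 0)) / 2 + \<epsilon> * \<epsilon>' * s\<^sup>2 / 4 * (pG (iG (to_U (i\<Gamma> u + \<sigma> + \<sigma>'))) k\<^sub>1
      - p\<Gamma> (i\<Gamma> u + \<sigma> + \<sigma>') \<sigma>)"
  using assms i\<Gamma>_add_\<Sigma>s[OF assms(1,3), of u]
  by (elim disjE; simp add: N_eq_quarter J_intros T_simps W_Sig_Sig p_simps s_sq to_U_def from_U_0 G.p_0_left H.p_0_left
    H.t_nonzero; simp add: mult.assoc \<alpha>_sq)

lemma N_K_K_K:
  assumes "k \<in> Ks" "\<epsilon> \<in> {1, -1}" "k' \<in> Ks" "\<epsilon>' \<in> {1, -1}" "k'' \<in> Ks" "\<epsilon>'' \<in> {1, -1}"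
  shows "N (LK k \<epsilon>) (LK k' \<epsilon>') (LK k'' \<epsilon>'') =
    (1 + pG (iG 1) (k + k' + k'')) * (1 + \<epsilon> * \<epsilon>' + \<epsilon>' * \<epsilon>'' + \<epsilon>'' * \<epsilon>) / 8"
  using assms by (simp add: N_eq_quarter J_intros T_simps p_simps W_K_K_K) (simp add: field_simps \<alpha>_sq)

lemma N_K_K_G:
  assumes "k \<in> Ks" "\<epsilon> \<in> {1, -1}" "k' \<in> Ks" "\<epsilon>' \<in> {1, -1}" "g \<in> Gs"
  shows "N (LK k \<epsilon>) (LK k' \<epsilon>') (LG g) =
    (1 + s\<^sup>2 * \<epsilon> * \<epsilon>' * cnj (pG k (k + k' + g))) * (1 + pG g (iG 1)) / 4"
proof -
  have k: "k \<in> Ks" using assms by blast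
  \<comment> \<open>Any element of \<Sigma> will do: \<open>W_eq\<close> asks for one, and the terms
    over \<Sigma> vanish for these labels.\<close>
  obtain \<sigma> where \<sigma>: "\<sigma> \<in> \<Sigma>s" using H.Fs_nonempty by blast
  have "k' = k \<or> k' = k + k\<^sub>0"
    using G.Fs_cases[OF k] H.Fs_cases[OF \<sigma>] assms by blast+
  moreover have J: "LK k \<epsilon> \<in> J" "LK k' \<epsilon>' \<in> J" "LG g \<in> J"
    using assms by (simp_all add: J_intros)
  moreover have T: "T (LK k \<epsilon>) (LK k' \<epsilon>') (LG g) = 0"
    using assms by (simp add: T_simps)
  ultimately show ?thesis
    unfolding N_eq_quarter[OF J] W_eq[OF k \<sigma>] T
    using k \<sigma> G.Fs_add_t[OF k] H.Fs_add_t[OF \<sigma>] assms(1,3,5)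
    by - (elim disjE; simp add: T_simps p_simps value_simps;
      rule disjE[OF \<alpha>_cases]; (simp add: field_simps value_simps)?)
qed

text \<open>For \<alpha> = 1 both sides are 0. For \<alpha> = -1 condition (3) gives
  <\<sigma>,\<sigma>> = -s^2, so the product of f(k,\<sigma>), f(k',\<sigma>) and
  <\<sigma>,\<sigma>> in the terms over \<Sigma> is -1.\<close>

lemma N_K_K_Sig:
  assumes "k \<in> Ks" "\<epsilon> \<in> {1, -1}" "k' \<in> Ks" "\<epsilon>' \<in> {1, -1}" "\<sigma> \<in> \<Sigma>s" "\<epsilon>'' \<in> {1, -1}"
  shows "N (LK k \<epsilon>) (LK k' \<epsilon>') (LSig \<sigma> \<epsilon>'') =
    (1 + p\<Gamma> \<sigma> (i\<Gamma> 1)) * (1 + \<epsilon> * \<epsilon>' + \<epsilon>'' * (\<epsilon> + \<epsilon>') * pG (k + k') k * s * f k \<sigma>) / 8"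
proof -
  have k: "k \<in> Ks" using assms by blast
  have \<sigma>: "\<sigma> \<in> \<Sigma>s" using assms by blast
  have "k' = k \<or> k' = k + k\<^sub>0"
    using G.Fs_cases[OF k] H.Fs_cases[OF \<sigma>] assms by blast+
  moreover have J: "LK k \<epsilon> \<in> J" "LK k' \<epsilon>' \<in> J" "LSig \<sigma> \<epsilon>'' \<in> J"
    using assms by (simp_all add: J_intros)
  ultimately show ?thesis
    unfolding N_eq_quarter[OF J] W_eq[OF k \<sigma>]
    using k \<sigma> G.Fs_add_t[OF k] H.Fs_add_t[OF \<sigma>] assms(1,3,5)
    by - (elim disjE; simp add: T_simps p_simps value_simps;
      rule disjE[OF \<alpha>_cases]; (simp add: field_simps value_simps)?)
qed

text \<open>The product f(k,h) f(k',h) is s^2 for k' = k and -\<alpha> s^2 for k' = k +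
  \<open>k\<^sub>0\<close>, that is, s^2 times the pairing of k - k', read in \<Gamma>, with any
  element of \<Sigma>.\<close>

lemma N_K_K_Gam:
  assumes "k \<in> Ks" "\<epsilon> \<in> {1, -1}" "k' \<in> Ks" "\<epsilon>' \<in> {1, -1}" "\<gamma> \<in> \<Gamma>s" "\<sigma>\<^sub>1 \<in> \<Sigma>s"
  shows "N (LK k \<epsilon>) (LK k' \<epsilon>') (LGam \<gamma>) =
    (1 + p\<Gamma> \<gamma> (i\<Gamma> 1)) * (1 - \<epsilon> * \<epsilon>' * s\<^sup>2 * p\<Gamma> (i\<Gamma> (to_U (k - k'))) \<sigma>\<^sub>1 * cnj (p\<Gamma> \<gamma> \<sigma>\<^sub>1)) / 4"
proof -
  have k: "k \<in> Ks" using assms by blast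
  have \<sigma>: "\<sigma>\<^sub>1 \<in> \<Sigma>s" using assms by blast
  have "k' = k \<or> k' = k + k\<^sub>0"
    using G.Fs_cases[OF k] H.Fs_cases[OF \<sigma>] assms by blast+
  moreover have J: "LK k \<epsilon> \<in> J" "LK k' \<epsilon>' \<in> J" "LGam \<gamma> \<in> J"
    using assms by (simp_all add: J_intros)
  ultimately show ?thesis
    unfolding N_eq_quarter[OF J] W_eq[OF k \<sigma>]
    using k \<sigma> G.Fs_add_t[OF k] H.Fs_add_t[OF \<sigma>] assms(1,3,5,6)
    by - (elim disjE; simp add: T_simps p_simps value_simps H.p_sym[of \<gamma> \<sigma>\<^sub>1] to_U_def from_U_0 G.t_nonzero;
      rule disjE[OF \<alpha>_cases]; (simp add: field_simps value_simps H.p_sym[of \<gamma> \<sigma>\<^sub>1] to_U_def from_U_0 G.t_nonzero)?)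
qed

text \<open>Under h to h + \<open>k\<^sub>0\<close> the factors \<alpha> and -\<alpha> of <h,k> and
  f combine to -1, whence 1 - <g,u0> instead of 1 + <g,u0>. The term in \<kappa> yields the same
  factor, since <u0,k> and <u0,\<sigma>> have product -1.\<close>

lemma N_K_G_Sig:
  assumes "k \<in> Ks" "\<epsilon> \<in> {1, -1}" "g \<in> Gs" "\<sigma> \<in> \<Sigma>s" "\<epsilon>' \<in> {1, -1}"
  shows "N (LK k \<epsilon>) (LG g) (LSig \<sigma> \<epsilon>') =
    (1 + \<epsilon> * \<epsilon>' * s * f k \<sigma> * cnj (pG (k + g) k)) * (1 - pG g (iG 1)) / 4"
proof -
  have k: "k \<in> Ks" using assms by blast
  have \<sigma>: "\<sigma> \<in> \<Sigma>s" using assms by blast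
  have J: "LK k \<epsilon> \<in> J" "LG g \<in> J" "LSig \<sigma> \<epsilon>' \<in> J"
    using assms by (simp_all add: J_intros)
  show ?thesis
    unfolding N_eq_quarter[OF J] W_eq[OF k \<sigma>]
    using k \<sigma> G.Fs_add_t[OF k] H.Fs_add_t[OF \<sigma>] assms(1,3,4)
    by - (simp add: T_simps p_simps value_simps G.p_sym[of g k];
      rule disjE[OF \<alpha>_cases]; (simp add: field_simps value_simps G.p_sym[of g k])?)
qed

lemma N_K_Sig_Sig:
  assumes "k \<in> Ks" "\<epsilon>'' \<in> {1, -1}" "\<sigma> \<in> \<Sigma>s" "\<epsilon> \<in> {1, -1}" "\<sigma>' \<in> \<Sigma>s" "\<epsilon>' \<in> {1, -1}"
  shows "N (LK k \<epsilon>'') (LSig \<sigma> \<epsilon>) (LSig \<sigma>' \<epsilon>') =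
    (1 + \<epsilon> * \<epsilon>' - \<epsilon>'' * (\<epsilon> + \<epsilon>') * s * f k \<sigma> * cnj (p\<Gamma> (\<sigma> + \<sigma>') \<sigma>)) * (1 + pG k (iG 1)) / 8"
proof -
  have k: "k \<in> Ks" using assms by blast
  have \<sigma>: "\<sigma> \<in> \<Sigma>s" using assms by blast
  have "\<sigma>' = \<sigma> \<or> \<sigma>' = \<sigma> + \<sigma>\<^sub>0"
    using G.Fs_cases[OF k] H.Fs_cases[OF \<sigma>] assms by blast+
  moreover have J: "LK k \<epsilon>'' \<in> J" "LSig \<sigma> \<epsilon> \<in> J" "LSig \<sigma>' \<epsilon>' \<in> J"
    using assms by (simp_all add: J_intros)
  ultimately show ?thesis
    unfolding N_eq_quarter[OF J] W_eq[OF k \<sigma>]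
    using k \<sigma> G.Fs_add_t[OF k] H.Fs_add_t[OF \<sigma>] assms(1,3,5)
    by - (elim disjE; simp add: T_simps p_simps value_simps;
      rule disjE[OF \<alpha>_cases]; (simp add: field_simps value_simps)?)
qed

lemma N_K_Sig_Gam:
  assumes "k \<in> Ks" "\<epsilon> \<in> {1, -1}" "\<sigma> \<in> \<Sigma>s" "\<epsilon>' \<in> {1, -1}" "\<gamma> \<in> \<Gamma>s"
  shows "N (LK k \<epsilon>) (LSig \<sigma> \<epsilon>') (LGam \<gamma>) =
    (1 - \<epsilon> * \<epsilon>' * s * f k \<sigma> * cnj (p\<Gamma> (\<sigma> + \<gamma>) \<sigma>)) * (1 - p\<Gamma> \<gamma> (i\<Gamma> 1)) / 4"
proof -
  have k: "k \<in> Ks" using assms by blast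
  have \<sigma>: "\<sigma> \<in> \<Sigma>s" using assms by blast
  have J: "LK k \<epsilon> \<in> J" "LSig \<sigma> \<epsilon>' \<in> J" "LGam \<gamma> \<in> J"
    using assms by (simp_all add: J_intros)
  show ?thesis
    unfolding N_eq_quarter[OF J] W_eq[OF k \<sigma>]
    using k \<sigma> G.Fs_add_t[OF k] H.Fs_add_t[OF \<sigma>] assms(1,3,5)
    by - (simp add: T_simps p_simps value_simps H.p_sym[of \<gamma> \<sigma>];
      rule disjE[OF \<alpha>_cases]; (simp add: field_simps value_simps H.p_sym[of \<gamma> \<sigma>])?)
qed

lemma N_G_Sig_Sig:
  assumes "g \<in> Gs" "\<sigma> \<in> \<Sigma>s" "\<epsilon> \<in> {1, -1}" "\<sigma>' \<in> \<Sigma>s" "\<epsilon>' \<in> {1, -1}" "k\<^sub>1 \<in> Ks"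
  shows "N (LG g) (LSig \<sigma> \<epsilon>) (LSig \<sigma>' \<epsilon>') =
    (1 + \<epsilon> * \<epsilon>' * s\<^sup>2 * cnj (pG g k\<^sub>1) * pG k\<^sub>1 (iG (to_U (\<sigma> - \<sigma>')))) * (1 + pG g (iG 1)) / 4"
proof -
  have k: "k\<^sub>1 \<in> Ks" using assms by blast
  have \<sigma>: "\<sigma> \<in> \<Sigma>s" using assms by blast
  have "\<sigma>' = \<sigma> \<or> \<sigma>' = \<sigma> + \<sigma>\<^sub>0"
    using G.Fs_cases[OF k] H.Fs_cases[OF \<sigma>] assms by blast+
  moreover have J: "LG g \<in> J" "LSig \<sigma> \<epsilon> \<in> J" "LSig \<sigma>' \<epsilon>' \<in> J"
    using assms by (simp_all add: J_intros)
  ultimately show ?thesis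
    unfolding N_eq_quarter[OF J] W_eq[OF k \<sigma>]
    using k \<sigma> G.Fs_add_t[OF k] H.Fs_add_t[OF \<sigma>] assms(1,2,4,6)
    by - (elim disjE; simp add: T_simps p_simps value_simps G.p_sym[of g k\<^sub>1] to_U_def from_U_0 H.t_nonzero;
      rule disjE[OF \<alpha>_cases]; (simp add: field_simps value_simps G.p_sym[of g k\<^sub>1] to_U_def from_U_0 H.t_nonzero)?)
qed

lemma N_Sig_Sig_Sig:
  assumes "\<sigma> \<in> \<Sigma>s" "\<epsilon> \<in> {1, -1}" "\<sigma>' \<in> \<Sigma>s" "\<epsilon>' \<in> {1, -1}" "\<sigma>'' \<in> \<Sigma>s" "\<epsilon>'' \<in> {1, -1}"
  shows "N (LSig \<sigma> \<epsilon>) (LSig \<sigma>' \<epsilon>') (LSig \<sigma>'' \<epsilon>'') =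
    (1 + p\<Gamma> (\<sigma> + \<sigma>' + \<sigma>'') (i\<Gamma> 1)) * (1 + \<epsilon> * \<epsilon>' + \<epsilon>' * \<epsilon>'' + \<epsilon>'' * \<epsilon>) / 8"
  using assms by (simp add: N_eq_quarter J_intros T_simps p_simps W_Sig_Sig_Sig) (simp add: field_simps \<alpha>_sq)

lemma N_Sig_Sig_Gam:
  assumes "\<sigma> \<in> \<Sigma>s" "\<epsilon> \<in> {1, -1}" "\<sigma>' \<in> \<Sigma>s" "\<epsilon>' \<in> {1, -1}" "\<gamma> \<in> \<Gamma>s"
  shows "N (LSig \<sigma> \<epsilon>) (LSig \<sigma>' \<epsilon>') (LGam \<gamma>) =
    (1 - \<epsilon> * \<epsilon>' * s\<^sup>2 * cnj (p\<Gamma> (\<sigma> + \<sigma>' + \<gamma>) \<sigma>)) * (1 + p\<Gamma> (\<sigma> + \<sigma>' + \<gamma>) (i\<Gamma> 1)) / 4"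
proof -
  obtain k where k: "k \<in> Ks" using G.Fs_nonempty by blast
  have \<sigma>: "\<sigma> \<in> \<Sigma>s" using assms by blast
  have "\<sigma>' = \<sigma> \<or> \<sigma>' = \<sigma> + \<sigma>\<^sub>0"
    using G.Fs_cases[OF k] H.Fs_cases[OF \<sigma>] assms by blast+
  moreover have J: "LSig \<sigma> \<epsilon> \<in> J" "LSig \<sigma>' \<epsilon>' \<in> J" "LGam \<gamma> \<in> J"
    using assms by (simp_all add: J_intros)
  moreover have T: "T (LSig \<sigma> \<epsilon>) (LSig \<sigma>' \<epsilon>') (LGam \<gamma>) = 0"
    using assms by (simp add: T_simps)
  ultimately show ?thesis
    unfolding N_eq_quarter[OF J] W_eq[OF k \<sigma>] T
    using k \<sigma> G.Fs_add_t[OF k] H.Fs_add_t[OF \<sigma>] assms(1,3,5)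
    by - (elim disjE; simp add: T_simps p_simps value_simps H.p_sym[of \<gamma> \<sigma>];
      rule disjE[OF \<alpha>_cases]; (simp add: field_simps value_simps H.p_sym[of \<gamma> \<sigma>])?)
qed

section \<open>Integrality\<close>

lemma sign_simps: "is_sign 1" "\<epsilon> \<in> {1, -1} \<Longrightarrow> is_sign \<epsilon>" "is_sign \<alpha>" "is_sign \<eta>"
  "is_sign (pG k\<^sub>0 x)" "is_sign (p\<Gamma> \<sigma>\<^sub>0 y)"
  using \<eta>_cases by (auto simp: is_sign_def sign_alpha[unfolded is_sign_def] G.is_sign_p_t[unfolded is_sign_def]
    H.is_sign_p_t[unfolded is_sign_def])

lemma sign_sf:
  assumes "k \<in> Ks" "\<sigma> \<in> \<Sigma>s"
  shows "is_sign (s * f k \<sigma>)"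
  using f_values[OF assms] sign_simps(4) by (elim disjE) (simp_all add: s_sq is_sign_uminus)

lemma sign_iG: "is_sign (pG (iG u) x)" "is_sign (p\<Gamma> (i\<Gamma> u) y)" "is_sign (pG x (iG u))" "is_sign (p\<Gamma> y (i\<Gamma> u))"
  by (simp_all add: from_U_def G.p_0_left H.p_0_left G.p_0_right H.p_0_right sign_simps
    G.p_sym[of _ k\<^sub>0] H.p_sym[of _ \<sigma>\<^sub>0])

lemma p_k\<^sub>0_Ks_add: "k \<in> Ks \<Longrightarrow> k' \<in> Ks \<Longrightarrow> pG k\<^sub>0 (k + k') = 1"
  by (simp add: G.p_add_right pairing_k\<^sub>0 \<alpha>_sq)

text \<open>The coefficient is 1 if the sum is 0, and (1 + \<epsilon> \<epsilon>' \<eta> \<alpha>) /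
  2 if the sum is u0.\<close>

lemma N_Pi_K_K_in_Nats:
  assumes "k \<in> Ks" "\<epsilon> \<in> {1, -1}" "k' \<in> Ks" "\<epsilon>' \<in> {1, -1}"
  shows "N (LPi u) (LK k \<epsilon>) (LK k' \<epsilon>') \<in> \<nat>"
proof -
  have "is_sign (\<epsilon> * \<epsilon>' * \<eta> * \<alpha>)"
    using assms by (intro is_sign_mult sign_simps)
  moreover have "N (LPi u) (LK k \<epsilon>) (LK k' \<epsilon>') =
      (1 + of_bool (iG u + k + k' = 0)) / 2 + 2 * W (LPi u) (LK k \<epsilon>) (LK k' \<epsilon>')"
    using assms by (simp add: N_eq_quarter J_intros T_simps) (simp add: field_simps \<alpha>_sq)
  ultimately show ?thesis
    using iG_add_Ks[OF assms(1,3), of u] sign_in_Nats(2)[of "\<epsilon> * \<epsilon>' * \<eta> * \<alpha>"]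
    by (elim disjE) (simp_all add: W_K_K[OF assms(1,3)] G.t_nonzero add_divide_distrib mult_ac)
qed

lemma N_Pi_Sig_Sig_in_Nats:
  assumes "\<sigma> \<in> \<Sigma>s" "\<epsilon> \<in> {1, -1}" "\<sigma>' \<in> \<Sigma>s" "\<epsilon>' \<in> {1, -1}"
  shows "N (LPi u) (LSig \<sigma> \<epsilon>) (LSig \<sigma>' \<epsilon>') \<in> \<nat>"
proof -
  have "is_sign (\<epsilon> * \<epsilon>' * \<eta> * \<alpha>)"
    using assms by (intro is_sign_mult sign_simps)
  moreover have "N (LPi u) (LSig \<sigma> \<epsilon>) (LSig \<sigma>' \<epsilon>') =
      (1 - of_bool (i\<Gamma> u + \<sigma> + \<sigma>' = 0)) / 2 + 2 * W (LPi u) (LSig \<sigma> \<epsilon>) (LSig \<sigma>' \<epsilon>')"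
    using assms by (simp add: N_eq_quarter J_intros T_simps) (simp add: field_simps \<alpha>_sq)
  ultimately show ?thesis
    using i\<Gamma>_add_\<Sigma>s[OF assms(1,3), of u] sign_in_Nats(2)[of "\<epsilon> * \<epsilon>' * \<eta> * \<alpha>"]
    by (elim disjE) (simp_all add: W_Sig_Sig[OF assms(1,3)] H.t_nonzero add_divide_distrib mult_ac)
qed

lemma N_Pi_Gam_Gam_in_Nats:
  assumes "\<gamma> \<in> \<Gamma>s" "\<gamma>' \<in> \<Gamma>s"
  shows "N (LPi u) (LGam \<gamma>) (LGam \<gamma>') \<in> \<nat>"
proof -
  have 1: "p\<Gamma> (x + y) (i\<Gamma> 1) = 1" if "i\<Gamma> u + x + y = 0" for x y
  proof -
    have "p\<Gamma> (i\<Gamma> u + x + y) (i\<Gamma> 1) = 1" using that by (simp add: H.p_0_left)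
    then show ?thesis by (simp add: H.p_add_left p\<Gamma>_i\<Gamma>_i\<Gamma>)
  qed
  have 2: "p\<Gamma> (\<gamma> + \<theta>\<^sub>2 \<gamma>') (i\<Gamma> 1) = p\<Gamma> (\<gamma> + \<gamma>') (i\<Gamma> 1)"
    by (simp add: p_i\<Gamma>_1 H.p_add_right H.p_fixed_theta H.t_fix)
  show ?thesis
    unfolding N_Pi_Gam_Gam[OF assms] using 1[of \<gamma> \<gamma>'] 1[of \<gamma> "\<theta>\<^sub>2 \<gamma>'"] 2
    by (intro deltas_in_Nats) (auto simp: sign_iG)
qed

text \<open>If both deltas fired, \<gamma>' would be fixed by \<theta>; so at most 1 is subtracted,
  and then the main term is 1.\<close>

lemma N_Sig_Gam_Gam_in_Nats:
  assumes "\<sigma> \<in> \<Sigma>s" "\<epsilon> \<in> {1, -1}" "\<gamma> \<in> \<Gamma>s" "\<gamma>' \<in> \<Gamma>s"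
  shows "N (LSig \<sigma> \<epsilon>) (LGam \<gamma>) (LGam \<gamma>') \<in> \<nat>"
proof -
  have 2: "p\<Gamma> (\<sigma> + \<gamma> + \<theta>\<^sub>2 \<gamma>') (i\<Gamma> 1) = p\<Gamma> (\<sigma> + \<gamma> + \<gamma>') (i\<Gamma> 1)"
    by (simp add: p_i\<Gamma>_1 H.p_add_right H.p_fixed_theta H.t_fix)
  have "\<theta>\<^sub>2 \<gamma>' \<noteq> \<gamma>'"
    using H.R_not_fixed[OF assms(4)] by (simp add: fixed_points_def)
  then have "\<not> (\<sigma> + \<gamma> + \<gamma>' = 0 \<and> \<sigma> + \<gamma> + \<theta>\<^sub>2 \<gamma>' = 0)"
    by (auto simp: add_eq_0_iff)
  moreover have "\<sigma> + \<gamma> + \<gamma>' = 0 \<or> \<sigma> + \<gamma> + \<theta>\<^sub>2 \<gamma>' = 0 \<Longrightarrow> p\<Gamma> (\<sigma> + \<gamma> + \<gamma>') (i\<Gamma> 1) = 1"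
    using 2 by (auto simp: H.p_0_left)
  ultimately show ?thesis
    unfolding N_Sig_Gam_Gam[OF assms] by (intro deltas_in_Nats(2) sign_iG)
qed

lemma N_Gam_Gam_Gam_in_Nats:
  assumes "\<gamma> \<in> \<Gamma>s" "\<gamma>' \<in> \<Gamma>s" "\<gamma>'' \<in> \<Gamma>s"
  shows "N (LGam \<gamma>) (LGam \<gamma>') (LGam \<gamma>'') \<in> \<nat>"
proof -
  define P where "P \<longleftrightarrow> \<gamma> + \<gamma>' + \<gamma>'' = 0 \<or> \<theta>\<^sub>2 \<gamma> + \<gamma>' + \<gamma>'' = 0 \<or> \<gamma> + \<theta>\<^sub>2 \<gamma>' + \<gamma>'' = 0 \<or> \<gamma> + \<gamma>' + \<theta>\<^sub>2 \<gamma>'' = 0"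
  let ?x = "p\<Gamma> (\<gamma> + \<gamma>' + \<gamma>'') (i\<Gamma> 1)"
  have "p\<Gamma> (\<theta>\<^sub>2 \<gamma> + \<gamma>' + \<gamma>'') (i\<Gamma> 1) = ?x" "p\<Gamma> (\<gamma> + \<theta>\<^sub>2 \<gamma>' + \<gamma>'') (i\<Gamma> 1) = ?x"
    "p\<Gamma> (\<gamma> + \<gamma>' + \<theta>\<^sub>2 \<gamma>'') (i\<Gamma> 1) = ?x"
    by (simp_all add: p_i\<Gamma>_1 H.p_add_right H.p_fixed_theta H.t_fix)
  then have "P \<Longrightarrow> ?x = 1"
    unfolding P_def by (auto simp: H.p_0_left)
  then have "1 + ?x - of_bool P - of_bool False \<in> \<nat>"
    by (intro deltas_in_Nats(1) sign_iG) simp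
  moreover have "N (LGam \<gamma>) (LGam \<gamma>') (LGam \<gamma>'') = 1 + ?x - of_bool P"
    unfolding N_Gam_Gam_Gam[OF assms] P_def H.orbit_deltas[OF assms, symmetric] by simp
  ultimately show ?thesis
    by simp
qed

lemma N_K_K_K_in_Nats:
  assumes "k \<in> Ks" "\<epsilon> \<in> {1, -1}" "k' \<in> Ks" "\<epsilon>' \<in> {1, -1}" "k'' \<in> Ks" "\<epsilon>'' \<in> {1, -1}"
  shows "N (LK k \<epsilon>) (LK k' \<epsilon>') (LK k'' \<epsilon>'') \<in> \<nat>"
  unfolding N_K_K_K[OF assms] using assms by (intro eighth_in_Nats sign_iG)

lemma N_Sig_Sig_Sig_in_Nats:
  assumes "\<sigma> \<in> \<Sigma>s" "\<epsilon> \<in> {1, -1}" "\<sigma>' \<in> \<Sigma>s" "\<epsilon>' \<in> {1, -1}" "\<sigma>'' \<in> \<Sigma>s" "\<epsilon>'' \<in> {1, -1}"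
  shows "N (LSig \<sigma> \<epsilon>) (LSig \<sigma>' \<epsilon>') (LSig \<sigma>'' \<epsilon>'') \<in> \<nat>"
  unfolding N_Sig_Sig_Sig[OF assms] using assms by (intro eighth_in_Nats sign_iG)

text \<open>Only <g,u0> = 1 matters. Then u0 is orthogonal to k + k' + g, so <k,k + k' + g> is a
  sign even if the fixed points are cyclic.\<close>

lemma N_K_K_G_in_Nats:
  assumes "k \<in> Ks" "\<epsilon> \<in> {1, -1}" "k' \<in> Ks" "\<epsilon>' \<in> {1, -1}" "g \<in> Gs"
  shows "N (LK k \<epsilon>) (LK k' \<epsilon>') (LG g) \<in> \<nat>"
proof -
  have "is_sign (\<eta> * \<epsilon> * \<epsilon>' * cnj (pG k (k + k' + g)))" if "pG g (iG 1) = 1"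
  proof -
    have "pG k\<^sub>0 (k + k' + g) = 1"
      using that p_k\<^sub>0_Ks_add[of k k'] assms by (simp add: p_iG_1 G.p_add_right[of _ "k + k'"])
    then show ?thesis
      using assms by (intro is_sign_mult is_sign_cnj_iff[THEN iffD2] G.is_sign_p sign_simps)
  qed
  then show ?thesis
    unfolding N_K_K_G[OF assms] s_sq by (intro quarter_in_Nats sign_iG)
qed

lemma N_K_K_Sig_in_Nats:
  assumes "k \<in> Ks" "\<epsilon> \<in> {1, -1}" "k' \<in> Ks" "\<epsilon>' \<in> {1, -1}" "\<sigma> \<in> \<Sigma>s" "\<epsilon>'' \<in> {1, -1}"
  shows "N (LK k \<epsilon>) (LK k' \<epsilon>') (LSig \<sigma> \<epsilon>'') \<in> \<nat>"
proof -
  have "pG (k + k') k = 1 \<or> pG (k + k') k = \<alpha>"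
    using G.Fs_add_Fs[OF assms(1,3)] assms(1) by (elim disjE) (simp_all add: G.p_0_left pairing_k\<^sub>0)
  then have "is_sign (pG (k + k') k)"
    using sign_simps by auto
  then have "is_sign (\<epsilon>'' * pG (k + k') k * (s * f k \<sigma>))"
    using assms by (simp add: is_sign_mult sign_simps sign_sf)
  from eighth_in_Nats'[OF sign_iG(4) assms(2,4) this, of \<sigma> 1] show ?thesis
    unfolding N_K_K_Sig[OF assms] by (simp add: mult_ac)
qed

lemma N_K_K_Gam_in_Nats:
  assumes "k \<in> Ks" "\<epsilon> \<in> {1, -1}" "k' \<in> Ks" "\<epsilon>' \<in> {1, -1}" "\<gamma> \<in> \<Gamma>s"
  shows "N (LK k \<epsilon>) (LK k' \<epsilon>') (LGam \<gamma>) \<in> \<nat>"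
proof -
  obtain \<sigma> where \<sigma>: "\<sigma> \<in> \<Sigma>s" using H.Fs_nonempty by blast
  have "is_sign (- (\<epsilon> * \<epsilon>' * \<eta> * p\<Gamma> (i\<Gamma> (to_U (k - k'))) \<sigma> * cnj (p\<Gamma> \<gamma> \<sigma>)))" if "p\<Gamma> \<gamma> (i\<Gamma> 1) = 1"
    unfolding is_sign_uminus H.p_sym[of \<gamma> \<sigma>] using assms \<sigma> that
    by (intro is_sign_mult is_sign_cnj_iff[THEN iffD2] H.is_sign_p sign_simps sign_iG) (simp_all add: p_i\<Gamma>_1)
  from quarter_in_Nats[OF sign_iG(4) this] show ?thesis
    unfolding N_K_K_Gam[OF assms \<sigma>] s_sq by (simp add: mult_ac)
qed

text \<open>Only <g,u0> = -1 matters. If then 2k = u0, condition (4) gives \<alpha> = -1, hence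
  <u0,k + g> = 1, and <k,k + g> is a sign again.\<close>

lemma N_K_G_Sig_in_Nats:
  assumes "k \<in> Ks" "\<epsilon> \<in> {1, -1}" "g \<in> Gs" "\<sigma> \<in> \<Sigma>s" "\<epsilon>' \<in> {1, -1}"
  shows "N (LK k \<epsilon>) (LG g) (LSig \<sigma> \<epsilon>') \<in> \<nat>"
proof -
  have "is_sign (\<epsilon> * \<epsilon>' * (s * f k \<sigma>) * cnj (pG (k + g) k))" if "- pG g (iG 1) = 1"
  proof -
    have "pG k\<^sub>0 g = -1"
      using that by (simp add: p_iG_1 minus_equation_iff)
    then have "k + k \<noteq> 0 \<Longrightarrow> pG k\<^sub>0 (k + g) = 1"
      using cyclic_k[OF assms(1)] assms(1) by (simp add: G.p_add_right pairing_k\<^sub>0)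
    then have "is_sign (pG k (k + g))"
      using assms by (intro G.is_sign_p)
    then show ?thesis
      unfolding G.p_sym[of "k + g"] using assms
      by (simp add: is_sign_mult is_sign_cnj_iff sign_simps sign_sf)
  qed
  from quarter_in_Nats[OF is_sign_uminus[THEN iffD2, OF sign_iG(3)] this] show ?thesis
    unfolding N_K_G_Sig[OF assms] by (simp add: mult_ac)
qed

lemma N_K_Sig_Gam_in_Nats:
  assumes "k \<in> Ks" "\<epsilon> \<in> {1, -1}" "\<sigma> \<in> \<Sigma>s" "\<epsilon>' \<in> {1, -1}" "\<gamma> \<in> \<Gamma>s"
  shows "N (LK k \<epsilon>) (LSig \<sigma> \<epsilon>') (LGam \<gamma>) \<in> \<nat>"
proof -
  have "is_sign (- (\<epsilon> * \<epsilon>' * (s * f k \<sigma>) * cnj (p\<Gamma> (\<sigma> + \<gamma>) \<sigma>)))" if "- p\<Gamma> \<gamma> (i\<Gamma> 1) = 1"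
  proof -
    have "p\<Gamma> \<sigma>\<^sub>0 \<gamma> = -1"
      using that by (simp add: p_i\<Gamma>_1 minus_equation_iff)
    then have "\<sigma> + \<sigma> \<noteq> 0 \<Longrightarrow> p\<Gamma> \<sigma>\<^sub>0 (\<sigma> + \<gamma>) = 1"
      using cyclic_\<sigma>[OF assms(3)] assms(3) by (simp add: H.p_add_right pairing_\<sigma>\<^sub>0)
    then have "is_sign (p\<Gamma> \<sigma> (\<sigma> + \<gamma>))"
      using assms by (intro H.is_sign_p)
    then show ?thesis
      unfolding is_sign_uminus H.p_sym[of "\<sigma> + \<gamma>"] using assms
      by (simp add: is_sign_mult is_sign_cnj_iff sign_simps sign_sf)
  qed
  from quarter_in_Nats[OF is_sign_uminus[THEN iffD2, OF sign_iG(4)] this] show ?thesis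
    unfolding N_K_Sig_Gam[OF assms] by (simp add: mult_ac)
qed

lemma N_K_Sig_Sig_in_Nats:
  assumes "k \<in> Ks" "\<epsilon>'' \<in> {1, -1}" "\<sigma> \<in> \<Sigma>s" "\<epsilon> \<in> {1, -1}" "\<sigma>' \<in> \<Sigma>s" "\<epsilon>' \<in> {1, -1}"
  shows "N (LK k \<epsilon>'') (LSig \<sigma> \<epsilon>) (LSig \<sigma>' \<epsilon>') \<in> \<nat>"
proof -
  have "p\<Gamma> (\<sigma> + \<sigma>') \<sigma> = 1 \<or> p\<Gamma> (\<sigma> + \<sigma>') \<sigma> = - \<alpha>"
    using H.Fs_add_Fs[OF assms(3,5)] assms(3) by (elim disjE) (simp_all add: H.p_0_left pairing_\<sigma>\<^sub>0)
  then have "is_sign (p\<Gamma> (\<sigma> + \<sigma>') \<sigma>)"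
    using sign_simps by (auto simp: is_sign_uminus)
  then have "is_sign (- (\<epsilon>'' * (s * f k \<sigma>) * cnj (p\<Gamma> (\<sigma> + \<sigma>') \<sigma>)))"
    unfolding is_sign_uminus using assms
    by (simp add: is_sign_mult is_sign_cnj_iff sign_simps sign_sf)
  from eighth_in_Nats'[OF sign_iG(3) assms(4,6) this, of k 1] show ?thesis
    unfolding N_K_Sig_Sig[OF assms] by (simp add: mult_ac)
qed

lemma N_G_Sig_Sig_in_Nats:
  assumes "g \<in> Gs" "\<sigma> \<in> \<Sigma>s" "\<epsilon> \<in> {1, -1}" "\<sigma>' \<in> \<Sigma>s" "\<epsilon>' \<in> {1, -1}"
  shows "N (LG g) (LSig \<sigma> \<epsilon>) (LSig \<sigma>' \<epsilon>') \<in> \<nat>"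
proof -
  obtain k where k: "k \<in> Ks" using G.Fs_nonempty by blast
  have "is_sign (\<epsilon> * \<epsilon>' * \<eta> * cnj (pG g k) * pG k (iG (to_U (\<sigma> - \<sigma>'))))" if "pG g (iG 1) = 1"
    unfolding G.p_sym[of g k] using assms k that
    by (intro is_sign_mult is_sign_cnj_iff[THEN iffD2] G.is_sign_p sign_simps sign_iG) (simp_all add: p_iG_1)
  then show ?thesis
    unfolding N_G_Sig_Sig[OF assms k] s_sq by (intro quarter_in_Nats sign_iG)
qed

lemma N_Sig_Sig_Gam_in_Nats:
  assumes "\<sigma> \<in> \<Sigma>s" "\<epsilon> \<in> {1, -1}" "\<sigma>' \<in> \<Sigma>s" "\<epsilon>' \<in> {1, -1}" "\<gamma> \<in> \<Gamma>s"
  shows "N (LSig \<sigma> \<epsilon>) (LSig \<sigma>' \<epsilon>') (LGam \<gamma>) \<in> \<nat>"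
proof -
  have "is_sign (- (\<epsilon> * \<epsilon>' * \<eta> * cnj (p\<Gamma> (\<sigma> + \<sigma>' + \<gamma>) \<sigma>)))" if "p\<Gamma> (\<sigma> + \<sigma>' + \<gamma>) (i\<Gamma> 1) = 1"
    unfolding is_sign_uminus H.p_sym[of _ \<sigma>] using assms that
    by (intro is_sign_mult is_sign_cnj_iff[THEN iffD2] H.is_sign_p sign_simps) (simp_all add: p_i\<Gamma>_1)
  from quarter_in_Nats[OF sign_iG(4) this] show ?thesis
    unfolding N_Sig_Sig_Gam[OF assms] s_sq by (simp add: mult_ac)
qed

end

section \<open>Reduction to sorted triples of labels\<close>

fun label_rank :: "('g, 'h) label \<Rightarrow> nat" where
  "label_rank (LZero u) = 0"
| "label_rank (LPi u) = 1"
| "label_rank (LK k \<epsilon>) = 2"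
| "label_rank (LG g) = 3"
| "label_rank (LSig \<sigma> \<epsilon>) = 4"
| "label_rank (LGam \<gamma>) = 5"

context S_matrix begin

lemma N_swap_left: "N x y z = N y x z"
  by (simp add: N_def mult_ac)

lemma N_swap_right: "N x y z = N x z y"
  by (simp add: N_def mult_ac)

text \<open>By symmetry, of the 216 triples of label kinds only the 56 with non-decreasing rank have
  to be inspected.\<close>

lemma N_in_Nats_if_sorted:
  assumes sorted: "\<And>x y z. x \<in> J \<Longrightarrow> y \<in> J \<Longrightarrow> z \<in> J \<Longrightarrow>
      label_rank x \<le> label_rank y \<Longrightarrow> label_rank y \<le> label_rank z \<Longrightarrow> N x y z \<in> \<nat>"
    and J: "x \<in> J" "y \<in> J" "z \<in> J"
  shows "N x y z \<in> \<nat>"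
proof -
  have *: "N x y z \<in> \<nat>" if "x \<in> J" "y \<in> J" "z \<in> J" "label_rank x \<le> label_rank y" for x y z
  proof -
    consider "label_rank y \<le> label_rank z" | "label_rank x \<le> label_rank z" "label_rank z \<le> label_rank y"
      | "label_rank z \<le> label_rank x"
      by linarith
    then show ?thesis
    proof cases
      case 1
      then show ?thesis using sorted[of x y z] that by simp
    next
      case 2
      then show ?thesis using sorted[of x z y] that N_swap_right[of x y z] by simp
    next
      case 3
      then show ?thesis using sorted[of z x y] that N_swap_right[of x y z] N_swap_left[of x z y] by simp
    qed
  qed
  show ?thesis
    using *[of x y z] *[of y x z] J N_swap_left[of x y z] by (cases "label_rank x \<le> label_rank y") simp_all
qed

end

context fusion_conditions begin

lemma N_in_Nats:
  assumes "x \<in> J" "y \<in> J" "z \<in> J"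
  shows "N x y z \<in> \<nat>"
proof (rule N_in_Nats_if_sorted[OF _ assms])
  fix x y z
  assume "x \<in> J" "y \<in> J" "z \<in> J" "label_rank x \<le> label_rank y" "label_rank y \<le> label_rank z"
  then show "N x y z \<in> \<nat>"
    by (elim J_cases)
      (simp_all add: of_bool_in_Nats sign_in_Nats is_sign_mult sign_iG
        N_Pi_K_K_in_Nats N_Pi_Sig_Sig_in_Nats N_Pi_Gam_Gam_in_Nats N_Sig_Gam_Gam_in_Nats
        N_Gam_Gam_Gam_in_Nats N_K_K_K_in_Nats N_Sig_Sig_Sig_in_Nats N_K_K_G_in_Nats
        N_K_K_Sig_in_Nats N_K_K_Gam_in_Nats N_K_G_Sig_in_Nats N_K_Sig_Gam_in_Nats
        N_K_Sig_Sig_in_Nats N_G_Sig_Sig_in_Nats N_Sig_Sig_Gam_in_Nats N_Zero_Zero_Zero N_Zero_Pi_Pi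
        N_Zero_Zero_Pi N_Zero_Zero_K N_Zero_Zero_G N_Zero_Zero_Sig N_Zero_Zero_Gam N_Zero_Pi_K
        N_Zero_Pi_G N_Zero_Pi_Sig N_Zero_Pi_Gam N_Zero_K_K N_Zero_G_G N_Zero_Sig_Sig N_Zero_Gam_Gam
        N_Zero_K_G N_Zero_K_Sig N_Zero_K_Gam N_Zero_G_Sig N_Zero_G_Gam N_Zero_Sig_Gam N_Pi_Pi_Pi
        N_Pi_Pi_K N_Pi_Pi_G N_Pi_Pi_Sig N_Pi_Pi_Gam N_Pi_K_G N_Pi_K_Sig N_Pi_K_Gam N_Pi_G_G
        N_Pi_G_Sig N_Pi_G_Gam N_Pi_Sig_Gam N_K_G_G N_K_G_Gam N_K_Gam_Gam N_G_G_G N_G_G_Sig N_G_G_Gam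
        N_G_Sig_Gam N_G_Gam_Gam)
qed

end

section \<open>Necessity of the conditions\<close>

context fusion_data begin

lemma \<kappa>_eq_int: "\<kappa> = 1 / of_int (int CARD('h) - int CARD('g))"
  by (simp add: \<kappa>_def)

text \<open>For equal orders the entry of S at (0,0), (u,0) is 0, and these rows contribute 0 by the
  convention x / 0 = 0; the rows (u,\<pi>) contribute 0 because the column (0,\<pi>) vanishes there.
  What remains is 1 - 2/|G|, strictly between 0 and 1 because |G| is at least 4.\<close>

lemma card_ne_if_in_Nats:
  assumes "N (LZero 0) (LPi 0) (LPi 0) \<in> \<nat>"
  shows "CARD('g) \<noteq> CARD('h)"
proof
  assume eq: "CARD('g) = CARD('h)"
  then have ab: "b = a"
    by (simp add: inv_sqrt_order_def)
  have S: "S (LPi u) (LZero 0) = a" "S (LPi u) (LPi 0) = 0" for u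
    by (simp_all add: ab pG_iG_iG)
  have "N (LZero 0) (LPi 0) (LPi 0) = a * a * (of_nat CARD('g) - 2)"
    unfolding N_split[OF J_intros(1) J_intros(2) J_intros(2)] S
    by (simp add: ab from_U_0 G.p_0_right H.p_0_right eq sum_negf field_simps)
  also have "\<dots> = 1 - 2 / of_nat CARD('g)"
    by (simp add: a_sq field_simps)
  finally have "1 - 2 / of_nat CARD('g) \<in> (\<nat> :: complex set)"
    using assms by simp
  then obtain m where "1 - 2 / of_nat CARD('g) = (of_nat m :: complex)"
    by (rule Nats_cases)
  then have "of_nat CARD('g) = (of_nat (m * CARD('g) + 2) :: complex)"
    by (simp add: field_simps)
  then have m: "CARD('g) = m * CARD('g) + 2"
    by (simp only: of_nat_eq_iff)
  have "card G.F \<le> CARD('g)"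
    by (intro card_mono) simp_all
  then have "CARD('g) \<ge> 4"
    using G.card_fix by simp
  with m show False
    by (cases m) simp_all
qed

text \<open>If 2k = u0, no delta fires in T, but for \<alpha> = 1 the two sums in W still add up,
  and the coefficient is \<epsilon> \<eta> / 2.\<close>

lemma Ks_not_cyclic_if_in_Nats:
  assumes ne: "CARD('g) \<noteq> CARD('h)" and \<alpha>: "\<alpha> = 1" and k: "k \<in> Ks"
    and nat: "\<And>\<epsilon>. \<epsilon> \<in> {1, -1} \<Longrightarrow> N (LZero 0) (LK k 1) (LK k \<epsilon>) \<in> \<nat>"
  shows "k + k = 0"
proof (rule ccontr)
  assume "k + k \<noteq> 0"
  then have nz: "iG 0 + k + k \<noteq> 0"
    by (simp add: from_U_0)
  \<comment> \<open>\<open>sum_f_f_left\<close> presupposes the conditions; for u = 0 and k' = k the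
    square of f is enough.\<close>
  have "(\<Sum>\<sigma>\<in>\<Sigma>s. c\<Gamma> \<sigma> (i\<Gamma> 0) * (f k \<sigma> * f k \<sigma>)) = (\<Sum>\<sigma>\<in>\<Sigma>s. \<eta>)"
    using k by (intro sum.cong) (simp_all add: from_U_0 H.p_0_right f_sq)
  then have W: "W (LZero 0) (LK k 1) (LK k \<epsilon>) = \<epsilon> * \<eta> / 4" for \<epsilon>
    unfolding W_Zero_K_K_eq sum_cG_Ks[OF k k] using nz \<alpha> by (simp add: H.card_Fs)
  have N: "N (LZero 0) (LK k 1) (LK k \<epsilon>) = \<epsilon> * \<eta> / 2" if "\<epsilon> \<in> {1, -1}" for \<epsilon>
    unfolding N_eq[OF ne J_intros(1) J_intros(3)[OF k insertI1] J_intros(3)[OF k that]] W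
    using k nz by (simp add: T_simps)
  \<comment> \<open>With \<epsilon> = \<eta> as the sign of the label the coefficient is exactly
    1/2.\<close>
  have "\<eta> \<in> {1, -1}"
    using \<eta>_cases by simp
  from nat[OF this] show False
    unfolding N[OF \<open>\<eta> \<in> {1, -1}\<close>] \<eta>_sq using half_not_in_Nats by simp
qed

lemma \<Sigma>s_not_cyclic_if_in_Nats:
  assumes ne: "CARD('g) \<noteq> CARD('h)" and \<alpha>: "\<alpha> = -1" and \<sigma>: "\<sigma> \<in> \<Sigma>s"
    and nat: "\<And>\<epsilon>. \<epsilon> \<in> {1, -1} \<Longrightarrow> N (LZero 0) (LSig \<sigma> 1) (LSig \<sigma> \<epsilon>) \<in> \<nat>"
  shows "\<sigma> + \<sigma> = 0"
proof (rule ccontr)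
  assume "\<sigma> + \<sigma> \<noteq> 0"
  then have nz: "i\<Gamma> 0 + \<sigma> + \<sigma> \<noteq> 0"
    by (simp add: from_U_0)
  have "(\<Sum>k\<in>Ks. cG k (iG 0) * (f k \<sigma> * f k \<sigma>)) = (\<Sum>k\<in>Ks. \<eta>)"
    using \<sigma> by (intro sum.cong) (simp_all add: from_U_0 G.p_0_right f_sq)
  then have W: "W (LZero 0) (LSig \<sigma> 1) (LSig \<sigma> \<epsilon>) = \<epsilon> * \<eta> / 4" for \<epsilon>
    unfolding W_Zero_Sig_Sig_eq sum_c\<Gamma>_\<Sigma>s[OF \<sigma> \<sigma>] using nz \<alpha> by (simp add: G.card_Fs)
  have N: "N (LZero 0) (LSig \<sigma> 1) (LSig \<sigma> \<epsilon>) = \<epsilon> * \<eta> / 2" if "\<epsilon> \<in> {1, -1}" for \<epsilon>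
    unfolding N_eq[OF ne J_intros(1) J_intros(5)[OF \<sigma> insertI1] J_intros(5)[OF \<sigma> that]] W
    using \<sigma> nz by (simp add: T_simps)
  have "\<eta> \<in> {1, -1}"
    using \<eta>_cases by simp
  from nat[OF this] show False
    unfolding N[OF \<open>\<eta> \<in> {1, -1}\<close>] \<eta>_sq using half_not_in_Nats by simp
qed

text \<open>As 2k = 0, the pairing <k,k> is a sign and k + k + k = k, so W is a multiple of \<delta>
  = s^2 <k,k>. The two values of (1 + 2 \<epsilon>) / 4 are 3/4 and -1/4.\<close>

lemma conditions_if_in_Nats_Ks:
  assumes ne: "CARD('g) \<noteq> CARD('h)" and \<alpha>: "\<alpha> = 1" and k: "k \<in> Ks" "k + k = 0"
    and nat: "\<And>\<epsilon>. \<epsilon> \<in> {1, -1} \<Longrightarrow> N (LK k 1) (LK k 1) (LK k \<epsilon>) \<in> \<nat>"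
  shows "CARD('h) = CARD('g) + 4 \<and> s\<^sup>2 * pG k k = 1"
proof -
  define \<delta> where "\<delta> = \<eta> * cG k k"
  have "is_sign (pG k k)"
    using k by (intro G.is_sign_p) simp_all
  then have \<delta>: "is_sign \<delta>" "\<delta> = s\<^sup>2 * pG k k"
    using \<eta>_cases by (auto simp: \<delta>_def s_sq is_sign_def)
  have "k + k + k = k"
    using k by simp
  then have W: "W (LK k 1) (LK k 1) (LK k \<epsilon>) = (1 + 2 * \<epsilon>) / 8 * \<delta>" for \<epsilon>
    unfolding W_K_K_K_eq sum_cG3_eq(2)[OF k(1) k(1) k(1)] using \<alpha> by (simp add: \<delta>_def field_simps)
  have N: "N (LK k 1) (LK k 1) (LK k \<epsilon>) = \<kappa> + (1 + 2 * \<epsilon>) / 4 * \<delta>" if "\<epsilon> \<in> {1, -1}" for \<epsilon>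
    unfolding N_eq[OF ne J_intros(3)[OF k(1) insertI1] J_intros(3)[OF k(1) insertI1] J_intros(3)[OF k(1) that]] W
    using k by (simp add: T_simps) (simp add: \<alpha> field_simps)
  have "int CARD('h) - int CARD('g) = 4 \<and> \<delta> = 1"
    using nat[of 1] nat[of "-1"] N[of 1] N[of "-1"] ne \<delta>(1)
    by (intro reciprocal_plus_quarter_in_Nats) (simp_all add: \<kappa>_eq_int)
  then show ?thesis
    using \<delta>(2) by auto
qed

lemma conditions_if_in_Nats_\<Sigma>s:
  assumes ne: "CARD('g) \<noteq> CARD('h)" and \<alpha>: "\<alpha> = -1" and \<sigma>: "\<sigma> \<in> \<Sigma>s" "\<sigma> + \<sigma> = 0"
    and nat: "\<And>\<epsilon>. \<epsilon> \<in> {1, -1} \<Longrightarrow> N (LSig \<sigma> 1) (LSig \<sigma> 1) (LSig \<sigma> \<epsilon>) \<in> \<nat>"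
  shows "CARD('h) = CARD('g) + 4 \<and> s\<^sup>2 * p\<Gamma> \<sigma> \<sigma> = -1"
proof -
  define \<delta> where "\<delta> = - \<eta> * c\<Gamma> \<sigma> \<sigma>"
  have "is_sign (p\<Gamma> \<sigma> \<sigma>)"
    using \<sigma> by (intro H.is_sign_p) simp_all
  then have \<delta>: "is_sign \<delta>" "\<delta> = - (s\<^sup>2 * p\<Gamma> \<sigma> \<sigma>)"
    using \<eta>_cases by (auto simp: \<delta>_def s_sq is_sign_def)
  have "\<sigma> + \<sigma> + \<sigma> = \<sigma>"
    using \<sigma> by simp
  then have W: "W (LSig \<sigma> 1) (LSig \<sigma> 1) (LSig \<sigma> \<epsilon>) = (1 + 2 * \<epsilon>) / 8 * \<delta>" for \<epsilon>
    unfolding W_Sig_Sig_Sig_eq sum_c\<Gamma>3_eq(2)[OF \<sigma>(1) \<sigma>(1) \<sigma>(1)] using \<alpha> by (simp add: \<delta>_def field_simps)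
  have N: "N (LSig \<sigma> 1) (LSig \<sigma> 1) (LSig \<sigma> \<epsilon>) = \<kappa> + (1 + 2 * \<epsilon>) / 4 * \<delta>" if "\<epsilon> \<in> {1, -1}" for \<epsilon>
    unfolding N_eq[OF ne J_intros(5)[OF \<sigma>(1) insertI1] J_intros(5)[OF \<sigma>(1) insertI1] J_intros(5)[OF \<sigma>(1) that]] W
    using \<sigma> by (simp add: T_simps) (simp add: \<alpha> field_simps)
  have "int CARD('h) - int CARD('g) = 4 \<and> \<delta> = 1"
    using nat[of 1] nat[of "-1"] N[of 1] N[of "-1"] ne \<delta>(1)
    by (intro reciprocal_plus_quarter_in_Nats) (simp_all add: \<kappa>_eq_int)
  then show ?thesis
    using \<delta>(2) by (auto simp: minus_equation_iff)
qed

text \<open>For \<alpha> = 1 condition (3) holds through its factor 1 - \<alpha> and (5) through its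
  conclusion, so only K has to be examined; for \<alpha> = -1 the roles are exchanged.\<close>

lemma fusion_conditions_if_in_Nats:
  assumes nat: "\<And>x y z. x \<in> J \<Longrightarrow> y \<in> J \<Longrightarrow> z \<in> J \<Longrightarrow> N x y z \<in> \<nat>"
  shows "fusion_conditions q\<^sub>1 \<theta>\<^sub>1 k\<^sub>0 Gs q\<^sub>2 \<theta>\<^sub>2 \<sigma>\<^sub>0 \<Gamma>s s f \<alpha>"
proof -
  have ne: "CARD('g) \<noteq> CARD('h)"
    by (intro card_ne_if_in_Nats nat J_intros)
  obtain k\<^sub>1 \<sigma>\<^sub>1 where k\<^sub>1: "k\<^sub>1 \<in> Ks" and \<sigma>\<^sub>1: "\<sigma>\<^sub>1 \<in> \<Sigma>s"
    using G.Fs_nonempty H.Fs_nonempty by blast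
  from \<alpha>_cases show ?thesis
  proof
    assume \<alpha>: "\<alpha> = 1"
    have 1: "k + k = 0" if "k \<in> Ks" for k
      using that by (intro Ks_not_cyclic_if_in_Nats[OF ne \<alpha>] nat J_intros) simp_all
    have 2: "CARD('h) = CARD('g) + 4 \<and> s\<^sup>2 * pG k k = 1" if "k \<in> Ks" for k
      using that by (intro conditions_if_in_Nats_Ks[OF ne \<alpha>] 1 nat J_intros) simp_all
    show ?thesis
      using 1 2 2[OF k\<^sub>1] \<alpha> by unfold_locales simp_all
  next
    assume \<alpha>: "\<alpha> = -1"
    have 1: "k + k = 0" if "k \<in> \<Sigma>s" for k
      using that by (intro \<Sigma>s_not_cyclic_if_in_Nats[OF ne \<alpha>] nat J_intros) simp_all
    have 2: "CARD('h) = CARD('g) + 4 \<and> s\<^sup>2 * p\<Gamma> k k = -1" if "k \<in> \<Sigma>s" for k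
      using that by (intro conditions_if_in_Nats_\<Sigma>s[OF ne \<alpha>] 1 nat J_intros) simp_all
    show ?thesis
      using 1 2 2[OF \<sigma>\<^sub>1] \<alpha> by unfold_locales simp_all
  qed
qed

end

section \<open>The equivalence and the table of coefficients\<close>

theorem theorem5p6:
  fixes q\<^sub>1 :: "'g::{ab_group_add,finite} \<Rightarrow> complex" and \<theta>\<^sub>1 :: "'g \<Rightarrow> 'g"
    and q\<^sub>2 :: "'h::{ab_group_add,finite} \<Rightarrow> complex" and \<theta>\<^sub>2 :: "'h \<Rightarrow> 'h"
    and c s :: complex and k\<^sub>0 k\<^sub>1 k\<^sub>2 :: 'g and \<sigma>\<^sub>0 \<sigma>\<^sub>1 \<sigma>\<^sub>2 :: 'h
    and Gs :: "'g set" and \<Gamma>s :: "'h set" and f :: "'g \<Rightarrow> 'h \<Rightarrow> complex"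
  defines "Ks \<equiv> fixed_points \<theta>\<^sub>1 - {0, k\<^sub>0}"
    and "\<Sigma>s \<equiv> fixed_points \<theta>\<^sub>2 - {0, \<sigma>\<^sub>0}"
    and "u\<^sub>0 \<equiv> (1 :: bit)"
    and "iG \<equiv> from_U k\<^sub>0"
    and "i\<Gamma> \<equiv> from_U \<sigma>\<^sub>0"
    and "q\<^sub>0 \<equiv> (\<lambda>u. q\<^sub>1 (from_U k\<^sub>0 u))"
    and "pG \<equiv> pairing q\<^sub>1"
    and "p\<Gamma> \<equiv> pairing q\<^sub>2"
    and "E \<equiv> {1, -1 :: complex}"
    and "J \<equiv> S_matrix.J \<theta>\<^sub>1 k\<^sub>0 Gs \<theta>\<^sub>2 \<sigma>\<^sub>0 \<Gamma>s"
    and "N \<equiv> S_matrix.N q\<^sub>1 \<theta>\<^sub>1 k\<^sub>0 Gs q\<^sub>2 \<theta>\<^sub>2 \<sigma>\<^sub>0 \<Gamma>s s f"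
    and "d \<equiv> (\<lambda>P. of_bool P :: complex)"
  assumes "involutive_metric_group q\<^sub>1 \<theta>\<^sub>1" and "involutive_metric_group q\<^sub>2 \<theta>\<^sub>2"
    and "c = gauss_sum q\<^sub>1" and "c = - gauss_sum q\<^sub>2"
    and "card (fixed_points \<theta>\<^sub>1) = 4" and "card (fixed_points \<theta>\<^sub>2) = 4"
    and "k\<^sub>0 \<in> fixed_points \<theta>\<^sub>1" and "k\<^sub>0 \<noteq> 0" and "k\<^sub>0 + k\<^sub>0 = 0"
    and "\<sigma>\<^sub>0 \<in> fixed_points \<theta>\<^sub>2" and "\<sigma>\<^sub>0 \<noteq> 0" and "\<sigma>\<^sub>0 + \<sigma>\<^sub>0 = 0"
    and "q\<^sub>1 k\<^sub>0 = q\<^sub>2 \<sigma>\<^sub>0"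
    and "Ks = {k\<^sub>1, k\<^sub>2}" and "\<Sigma>s = {\<sigma>\<^sub>1, \<sigma>\<^sub>2}"
    and "q\<^sub>1 k\<^sub>1 = q\<^sub>1 k\<^sub>2 \<and> q\<^sub>2 \<sigma>\<^sub>1 = - q\<^sub>2 \<sigma>\<^sub>2 \<and> s = c / q\<^sub>1 k\<^sub>1 \<and> s ^ 4 = 1 \<or>
         q\<^sub>1 k\<^sub>1 = - q\<^sub>1 k\<^sub>2 \<and> q\<^sub>2 \<sigma>\<^sub>1 = q\<^sub>2 \<sigma>\<^sub>2 \<and> s = c / q\<^sub>2 \<sigma>\<^sub>1 \<and> s ^ 4 = 1"
    and "is_transversal \<theta>\<^sub>1 Gs" and "is_transversal \<theta>\<^sub>2 \<Gamma>s"
    and "\<forall>k\<in>Ks. \<forall>\<sigma>\<in>\<Sigma>s. f k \<sigma> \<in> {s, - s}"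
    and "\<forall>k\<in>Ks. \<forall>\<sigma>\<in>\<Sigma>s. f (k + k\<^sub>0) \<sigma> = f k \<sigma> * cnj (p\<Gamma> (i\<Gamma> u\<^sub>0) \<sigma>)"
    and "\<forall>k\<in>Ks. \<forall>\<sigma>\<in>\<Sigma>s. f k (\<sigma> + \<sigma>\<^sub>0) = f k \<sigma> * cnj (pG k (iG u\<^sub>0))"
  defines "conditions \<equiv>
      CARD('h) = CARD('g) + 4 \<and>
      (\<forall>k\<in>Ks. (1 + pG (iG u\<^sub>0) k) * (1 - s\<^sup>2 * pG k k) = 0) \<and>
      (\<forall>\<sigma>\<in>\<Sigma>s. (1 + p\<Gamma> (i\<Gamma> u\<^sub>0) \<sigma>) * (1 + s\<^sup>2 * p\<Gamma> \<sigma> \<sigma>) = 0) \<and>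
      (additive_structure (fixed_points \<theta>\<^sub>1) \<cong> integer_mod_group 4 \<longrightarrow> q\<^sub>0 u\<^sub>0 = -1) \<and>
      (additive_structure (fixed_points \<theta>\<^sub>2) \<cong> integer_mod_group 4 \<longrightarrow> q\<^sub>0 u\<^sub>0 = -1)"
  shows "((\<forall>x\<in>J. \<forall>y\<in>J. \<forall>z\<in>J. N x y z \<in> \<nat>) \<longleftrightarrow> conditions) \<and>
    (conditions \<longrightarrow>
      (\<forall>x\<in>J. \<forall>y\<in>J. \<forall>z\<in>J. N x y z = N y x z \<and> N x y z = N x z y) \<and>

      (\<forall>u u' u''. N (LZero u) (LZero u') (LZero u'') = d (u + u' + u'' = 0)) \<and>
      (\<forall>u u' u''. N (LZero u) (LPi u') (LPi u'') = d (u + u' + u'' = 0)) \<and>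
      (\<forall>u u' u''. N (LZero u) (LZero u') (LPi u'') = 0) \<and>
      (\<forall>u u'. \<forall>k\<in>Ks. \<forall>\<epsilon>\<in>E. N (LZero u) (LZero u') (LK k \<epsilon>) = 0) \<and>
      (\<forall>u u'. \<forall>g\<in>Gs. N (LZero u) (LZero u') (LG g) = 0) \<and>
      (\<forall>u u'. \<forall>\<sigma>\<in>\<Sigma>s. \<forall>\<epsilon>\<in>E. N (LZero u) (LZero u') (LSig \<sigma> \<epsilon>) = 0) \<and>
      (\<forall>u u'. \<forall>\<gamma>\<in>\<Gamma>s. N (LZero u) (LZero u') (LGam \<gamma>) = 0) \<and>
      (\<forall>u u'. \<forall>k\<in>Ks. \<forall>\<epsilon>\<in>E. N (LZero u) (LPi u') (LK k \<epsilon>) = 0) \<and>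
      (\<forall>u u'. \<forall>g\<in>Gs. N (LZero u) (LPi u') (LG g) = 0) \<and>
      (\<forall>u u'. \<forall>\<sigma>\<in>\<Sigma>s. \<forall>\<epsilon>\<in>E. N (LZero u) (LPi u') (LSig \<sigma> \<epsilon>) = 0) \<and>
      (\<forall>u u'. \<forall>\<gamma>\<in>\<Gamma>s. N (LZero u) (LPi u') (LGam \<gamma>) = 0) \<and>
      (\<forall>u. \<forall>k\<in>Ks. \<forall>\<epsilon>\<in>E. \<forall>k'\<in>Ks. \<forall>\<epsilon>'\<in>E.
        N (LZero u) (LK k \<epsilon>) (LK k' \<epsilon>') = d (iG u + k + k' = 0) * d (\<epsilon> = s\<^sup>2 * \<epsilon>')) \<and>
      (\<forall>u. \<forall>g\<in>Gs. \<forall>g'\<in>Gs.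
        N (LZero u) (LG g) (LG g') = d (iG u + g + g' = 0) + d (iG u + g + \<theta>\<^sub>1 g' = 0)) \<and>
      (\<forall>u. \<forall>\<sigma>\<in>\<Sigma>s. \<forall>\<epsilon>\<in>E. \<forall>\<sigma>'\<in>\<Sigma>s. \<forall>\<epsilon>'\<in>E.
        N (LZero u) (LSig \<sigma> \<epsilon>) (LSig \<sigma>' \<epsilon>') = d (i\<Gamma> u + \<sigma> + \<sigma>' = 0) * d (\<epsilon> = s\<^sup>2 * \<epsilon>')) \<and>
      (\<forall>u. \<forall>\<gamma>\<in>\<Gamma>s. \<forall>\<gamma>'\<in>\<Gamma>s.
        N (LZero u) (LGam \<gamma>) (LGam \<gamma>') = d (i\<Gamma> u + \<gamma> + \<gamma>' = 0) + d (i\<Gamma> u + \<gamma> + \<theta>\<^sub>2 \<gamma>' = 0)) \<and>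
      (\<forall>u. \<forall>k\<in>Ks. \<forall>\<epsilon>\<in>E. \<forall>g\<in>Gs. N (LZero u) (LK k \<epsilon>) (LG g) = 0) \<and>
      (\<forall>u. \<forall>k\<in>Ks. \<forall>\<epsilon>\<in>E. \<forall>\<sigma>\<in>\<Sigma>s. \<forall>\<epsilon>'\<in>E. N (LZero u) (LK k \<epsilon>) (LSig \<sigma> \<epsilon>') = 0) \<and>
      (\<forall>u. \<forall>k\<in>Ks. \<forall>\<epsilon>\<in>E. \<forall>\<gamma>\<in>\<Gamma>s. N (LZero u) (LK k \<epsilon>) (LGam \<gamma>) = 0) \<and>
      (\<forall>u. \<forall>g\<in>Gs. \<forall>\<sigma>\<in>\<Sigma>s. \<forall>\<epsilon>\<in>E. N (LZero u) (LG g) (LSig \<sigma> \<epsilon>) = 0) \<and>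
      (\<forall>u. \<forall>g\<in>Gs. \<forall>\<gamma>\<in>\<Gamma>s. N (LZero u) (LG g) (LGam \<gamma>) = 0) \<and>
      (\<forall>u. \<forall>\<sigma>\<in>\<Sigma>s. \<forall>\<epsilon>\<in>E. \<forall>\<gamma>\<in>\<Gamma>s. N (LZero u) (LSig \<sigma> \<epsilon>) (LGam \<gamma>) = 0) \<and>

      (\<forall>u u' u''. N (LPi u) (LPi u') (LPi u'') = 2) \<and>
      (\<forall>u u'. \<forall>k\<in>Ks. \<forall>\<epsilon>\<in>E. N (LPi u) (LPi u') (LK k \<epsilon>) = (1 + pG k (iG u\<^sub>0)) / 2) \<and>
      (\<forall>u u'. \<forall>g\<in>Gs. N (LPi u) (LPi u') (LG g) = 1 + pG g (iG u\<^sub>0)) \<and>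
      (\<forall>u u'. \<forall>\<sigma>\<in>\<Sigma>s. \<forall>\<epsilon>\<in>E. N (LPi u) (LPi u') (LSig \<sigma> \<epsilon>) = (1 + p\<Gamma> \<sigma> (i\<Gamma> u\<^sub>0)) / 2) \<and>
      (\<forall>u u'. \<forall>\<gamma>\<in>\<Gamma>s. N (LPi u) (LPi u') (LGam \<gamma>) = 1 + p\<Gamma> \<gamma> (i\<Gamma> u\<^sub>0)) \<and>
      (\<forall>u. \<forall>k\<in>Ks. \<forall>\<epsilon>\<in>E. \<forall>k'\<in>Ks. \<forall>\<epsilon>'\<in>E.
        N (LPi u) (LK k \<epsilon>) (LK k' \<epsilon>') =
          (1 + d (iG u + k + k' = 0)) / 2 +
          \<epsilon> * \<epsilon>' * s\<^sup>2 / 4 *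
            (pG (iG u + k + k') k\<^sub>1 - p\<Gamma> (i\<Gamma> (to_U (iG u + k + k'))) \<sigma>\<^sub>1)) \<and>
      (\<forall>u. \<forall>k\<in>Ks. \<forall>\<epsilon>\<in>E. \<forall>g\<in>Gs.
        N (LPi u) (LK k \<epsilon>) (LG g) = (1 + pG (k + g) (iG u\<^sub>0)) / 2) \<and>
      (\<forall>u. \<forall>k\<in>Ks. \<forall>\<epsilon>\<in>E. \<forall>\<sigma>\<in>\<Sigma>s. \<forall>\<epsilon>'\<in>E. N (LPi u) (LK k \<epsilon>) (LSig \<sigma> \<epsilon>') = 0) \<and>
      (\<forall>u. \<forall>k\<in>Ks. \<forall>\<epsilon>\<in>E. \<forall>\<gamma>\<in>\<Gamma>s.
        N (LPi u) (LK k \<epsilon>) (LGam \<gamma>) = (1 + pG k (iG u\<^sub>0) * p\<Gamma> \<gamma> (i\<Gamma> u\<^sub>0)) / 2) \<and>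
      (\<forall>u. \<forall>g\<in>Gs. \<forall>g'\<in>Gs.
        N (LPi u) (LG g) (LG g') =
          1 + pG (g + g') (iG u\<^sub>0) + d (iG u + g + g' = 0) + d (iG u + g + \<theta>\<^sub>1 g' = 0)) \<and>
      (\<forall>u. \<forall>g\<in>Gs. \<forall>\<sigma>\<in>\<Sigma>s. \<forall>\<epsilon>\<in>E.
        N (LPi u) (LG g) (LSig \<sigma> \<epsilon>) = (1 + pG g (iG u\<^sub>0) * p\<Gamma> \<sigma> (i\<Gamma> u\<^sub>0)) / 2) \<and>
      (\<forall>u. \<forall>g\<in>Gs. \<forall>\<gamma>\<in>\<Gamma>s.
        N (LPi u) (LG g) (LGam \<gamma>) = 1 + pG g (iG u\<^sub>0) * p\<Gamma> \<gamma> (i\<Gamma> u\<^sub>0)) \<and>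
      (\<forall>u. \<forall>\<sigma>\<in>\<Sigma>s. \<forall>\<epsilon>\<in>E. \<forall>\<sigma>'\<in>\<Sigma>s. \<forall>\<epsilon>'\<in>E.
        N (LPi u) (LSig \<sigma> \<epsilon>) (LSig \<sigma>' \<epsilon>') =
          (1 - d (i\<Gamma> u + \<sigma> + \<sigma>' = 0)) / 2 +
          \<epsilon> * \<epsilon>' * s\<^sup>2 / 4 *
            (pG (iG (to_U (i\<Gamma> u + \<sigma> + \<sigma>'))) k\<^sub>1 - p\<Gamma> (i\<Gamma> u + \<sigma> + \<sigma>') \<sigma>)) \<and>
      (\<forall>u. \<forall>\<sigma>\<in>\<Sigma>s. \<forall>\<epsilon>\<in>E. \<forall>\<gamma>\<in>\<Gamma>s.
        N (LPi u) (LSig \<sigma> \<epsilon>) (LGam \<gamma>) = (1 + p\<Gamma> (\<sigma> + \<gamma>) (i\<Gamma> u\<^sub>0)) / 2) \<and>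
      (\<forall>u. \<forall>\<gamma>\<in>\<Gamma>s. \<forall>\<gamma>'\<in>\<Gamma>s.
        N (LPi u) (LGam \<gamma>) (LGam \<gamma>') =
          1 + p\<Gamma> (\<gamma> + \<gamma>') (i\<Gamma> u\<^sub>0) - d (i\<Gamma> u + \<gamma> + \<gamma>' = 0) - d (i\<Gamma> u + \<gamma> + \<theta>\<^sub>2 \<gamma>' = 0)) \<and>

      (\<forall>k\<in>Ks. \<forall>\<epsilon>\<in>E. \<forall>k'\<in>Ks. \<forall>\<epsilon>'\<in>E. \<forall>k''\<in>Ks. \<forall>\<epsilon>''\<in>E.
        N (LK k \<epsilon>) (LK k' \<epsilon>') (LK k'' \<epsilon>'') =
          (1 + pG (iG u\<^sub>0) (k + k' + k'')) * (1 + \<epsilon> * \<epsilon>' + \<epsilon>' * \<epsilon>'' + \<epsilon>'' * \<epsilon>) / 8) \<and>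
      (\<forall>k\<in>Ks. \<forall>\<epsilon>\<in>E. \<forall>k'\<in>Ks. \<forall>\<epsilon>'\<in>E. \<forall>g\<in>Gs.
        N (LK k \<epsilon>) (LK k' \<epsilon>') (LG g) =
          (1 + s\<^sup>2 * \<epsilon> * \<epsilon>' * cnj (pG k (k + k' + g))) * (1 + pG g (iG u\<^sub>0)) / 4) \<and>
      (\<forall>k\<in>Ks. \<forall>\<epsilon>\<in>E. \<forall>k'\<in>Ks. \<forall>\<epsilon>'\<in>E. \<forall>\<sigma>\<in>\<Sigma>s. \<forall>\<epsilon>''\<in>E.
        N (LK k \<epsilon>) (LK k' \<epsilon>') (LSig \<sigma> \<epsilon>'') =
          (1 + p\<Gamma> \<sigma> (i\<Gamma> u\<^sub>0)) *
          (1 + \<epsilon> * \<epsilon>' + \<epsilon>'' * (\<epsilon> + \<epsilon>') * pG (k + k') k * s * f k \<sigma>) / 8) \<and>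
      (\<forall>k\<in>Ks. \<forall>\<epsilon>\<in>E. \<forall>k'\<in>Ks. \<forall>\<epsilon>'\<in>E. \<forall>\<gamma>\<in>\<Gamma>s.
        N (LK k \<epsilon>) (LK k' \<epsilon>') (LGam \<gamma>) =
          (1 + p\<Gamma> \<gamma> (i\<Gamma> u\<^sub>0)) *
          (1 - \<epsilon> * \<epsilon>' * s\<^sup>2 * p\<Gamma> (i\<Gamma> (to_U (k - k'))) \<sigma>\<^sub>1 * cnj (p\<Gamma> \<gamma> \<sigma>\<^sub>1)) / 4) \<and>
      (\<forall>k\<in>Ks. \<forall>\<epsilon>\<in>E. \<forall>g\<in>Gs. \<forall>g'\<in>Gs.
        N (LK k \<epsilon>) (LG g) (LG g') =
          (1 + pG (k + g + g') (iG u\<^sub>0)) / 2 + d (k + g + g' = 0) + d (k + g + \<theta>\<^sub>1 g' = 0)) \<and>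
      (\<forall>k\<in>Ks. \<forall>\<epsilon>\<in>E. \<forall>g\<in>Gs. \<forall>\<sigma>\<in>\<Sigma>s. \<forall>\<epsilon>'\<in>E.
        N (LK k \<epsilon>) (LG g) (LSig \<sigma> \<epsilon>') =
          (1 + \<epsilon> * \<epsilon>' * s * f k \<sigma> * cnj (pG (k + g) k)) * (1 - pG g (iG u\<^sub>0)) / 4) \<and>
      (\<forall>k\<in>Ks. \<forall>\<epsilon>\<in>E. \<forall>g\<in>Gs. \<forall>\<gamma>\<in>\<Gamma>s.
        N (LK k \<epsilon>) (LG g) (LGam \<gamma>) = (1 + pG (k + g) (iG u\<^sub>0) * p\<Gamma> \<gamma> (i\<Gamma> u\<^sub>0)) / 2) \<and>
      (\<forall>k\<in>Ks. \<forall>\<epsilon>''\<in>E. \<forall>\<sigma>\<in>\<Sigma>s. \<forall>\<epsilon>\<in>E. \<forall>\<sigma>'\<in>\<Sigma>s. \<forall>\<epsilon>'\<in>E.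
        N (LK k \<epsilon>'') (LSig \<sigma> \<epsilon>) (LSig \<sigma>' \<epsilon>') =
          (1 + \<epsilon> * \<epsilon>' - \<epsilon>'' * (\<epsilon> + \<epsilon>') * s * f k \<sigma> * cnj (p\<Gamma> (\<sigma> + \<sigma>') \<sigma>)) *
          (1 + pG k (iG u\<^sub>0)) / 8) \<and>
      (\<forall>k\<in>Ks. \<forall>\<epsilon>\<in>E. \<forall>\<sigma>\<in>\<Sigma>s. \<forall>\<epsilon>'\<in>E. \<forall>\<gamma>\<in>\<Gamma>s.
        N (LK k \<epsilon>) (LSig \<sigma> \<epsilon>') (LGam \<gamma>) =
          (1 - \<epsilon> * \<epsilon>' * s * f k \<sigma> * cnj (p\<Gamma> (\<sigma> + \<gamma>) \<sigma>)) * (1 - p\<Gamma> \<gamma> (i\<Gamma> u\<^sub>0)) / 4) \<and>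
      (\<forall>k\<in>Ks. \<forall>\<epsilon>\<in>E. \<forall>\<gamma>\<in>\<Gamma>s. \<forall>\<gamma>'\<in>\<Gamma>s.
        N (LK k \<epsilon>) (LGam \<gamma>) (LGam \<gamma>') = (1 + pG k (iG u\<^sub>0) * p\<Gamma> (\<gamma> + \<gamma>') (i\<Gamma> u\<^sub>0)) / 2) \<and>

      (\<forall>g\<in>Gs. \<forall>g'\<in>Gs. \<forall>g''\<in>Gs.
        N (LG g) (LG g') (LG g'') =
          1 + pG (g + g' + g'') (iG u\<^sub>0) +
          d (g + g' + g'' = 0) + d (\<theta>\<^sub>1 g + g' + g'' = 0) +
          d (g + \<theta>\<^sub>1 g' + g'' = 0) + d (g + g' + \<theta>\<^sub>1 g'' = 0)) \<and>
      (\<forall>g\<in>Gs. \<forall>g'\<in>Gs. \<forall>\<sigma>\<in>\<Sigma>s. \<forall>\<epsilon>\<in>E.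
        N (LG g) (LG g') (LSig \<sigma> \<epsilon>) = (1 + pG (g + g') (iG u\<^sub>0) * p\<Gamma> \<sigma> (i\<Gamma> u\<^sub>0)) / 2) \<and>
      (\<forall>g\<in>Gs. \<forall>g'\<in>Gs. \<forall>\<gamma>\<in>\<Gamma>s.
        N (LG g) (LG g') (LGam \<gamma>) = 1 + pG (g + g') (iG u\<^sub>0) * p\<Gamma> \<gamma> (i\<Gamma> u\<^sub>0)) \<and>
      (\<forall>g\<in>Gs. \<forall>\<sigma>\<in>\<Sigma>s. \<forall>\<epsilon>\<in>E. \<forall>\<sigma>'\<in>\<Sigma>s. \<forall>\<epsilon>'\<in>E.
        N (LG g) (LSig \<sigma> \<epsilon>) (LSig \<sigma>' \<epsilon>') =
          (1 + \<epsilon> * \<epsilon>' * s\<^sup>2 * cnj (pG g k\<^sub>1) * pG k\<^sub>1 (iG (to_U (\<sigma> - \<sigma>')))) *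
          (1 + pG g (iG u\<^sub>0)) / 4) \<and>
      (\<forall>g\<in>Gs. \<forall>\<sigma>\<in>\<Sigma>s. \<forall>\<epsilon>\<in>E. \<forall>\<gamma>\<in>\<Gamma>s.
        N (LG g) (LSig \<sigma> \<epsilon>) (LGam \<gamma>) = (1 + pG g (iG u\<^sub>0) * p\<Gamma> (\<sigma> + \<gamma>) (i\<Gamma> u\<^sub>0)) / 2) \<and>
      (\<forall>g\<in>Gs. \<forall>\<gamma>\<in>\<Gamma>s. \<forall>\<gamma>'\<in>\<Gamma>s.
        N (LG g) (LGam \<gamma>) (LGam \<gamma>') = 1 + pG g (iG u\<^sub>0) * p\<Gamma> (\<gamma> + \<gamma>') (i\<Gamma> u\<^sub>0)) \<and>
      (\<forall>\<sigma>\<in>\<Sigma>s. \<forall>\<epsilon>\<in>E. \<forall>\<sigma>'\<in>\<Sigma>s. \<forall>\<epsilon>'\<in>E. \<forall>\<sigma>''\<in>\<Sigma>s. \<forall>\<epsilon>''\<in>E.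
        N (LSig \<sigma> \<epsilon>) (LSig \<sigma>' \<epsilon>') (LSig \<sigma>'' \<epsilon>'') =
          (1 + p\<Gamma> (\<sigma> + \<sigma>' + \<sigma>'') (i\<Gamma> u\<^sub>0)) * (1 + \<epsilon> * \<epsilon>' + \<epsilon>' * \<epsilon>'' + \<epsilon>'' * \<epsilon>) / 8) \<and>
      (\<forall>\<sigma>\<in>\<Sigma>s. \<forall>\<epsilon>\<in>E. \<forall>\<sigma>'\<in>\<Sigma>s. \<forall>\<epsilon>'\<in>E. \<forall>\<gamma>\<in>\<Gamma>s.
        N (LSig \<sigma> \<epsilon>) (LSig \<sigma>' \<epsilon>') (LGam \<gamma>) =
          (1 - \<epsilon> * \<epsilon>' * s\<^sup>2 * cnj (p\<Gamma> (\<sigma> + \<sigma>' + \<gamma>) \<sigma>)) *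
          (1 + p\<Gamma> (\<sigma> + \<sigma>' + \<gamma>) (i\<Gamma> u\<^sub>0)) / 4) \<and>
      (\<forall>\<sigma>\<in>\<Sigma>s. \<forall>\<epsilon>\<in>E. \<forall>\<gamma>\<in>\<Gamma>s. \<forall>\<gamma>'\<in>\<Gamma>s.
        N (LSig \<sigma> \<epsilon>) (LGam \<gamma>) (LGam \<gamma>') =
          (1 + p\<Gamma> (\<sigma> + \<gamma> + \<gamma>') (i\<Gamma> u\<^sub>0)) / 2 -
          d (\<sigma> + \<gamma> + \<gamma>' = 0) - d (\<sigma> + \<gamma> + \<theta>\<^sub>2 \<gamma>' = 0)) \<and>
      (\<forall>\<gamma>\<in>\<Gamma>s. \<forall>\<gamma>'\<in>\<Gamma>s. \<forall>\<gamma>''\<in>\<Gamma>s.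
        N (LGam \<gamma>) (LGam \<gamma>') (LGam \<gamma>'') =
          1 + p\<Gamma> (\<gamma> + \<gamma>' + \<gamma>'') (i\<Gamma> u\<^sub>0) -
          d (\<gamma> + \<gamma>' + \<gamma>'' = 0) - d (\<theta>\<^sub>2 \<gamma> + \<gamma>' + \<gamma>'' = 0) -
          d (\<gamma> + \<theta>\<^sub>2 \<gamma>' + \<gamma>'' = 0) - d (\<gamma> + \<gamma>' + \<theta>\<^sub>2 \<gamma>'' = 0)))"
proof -
  note defs = Ks_def \<Sigma>s_def u\<^sub>0_def iG_def i\<Gamma>_def q\<^sub>0_def pG_def p\<Gamma>_def E_def J_def N_def d_def
  note A = assms(13-)[unfolded defs]
  have k\<^sub>1: "k\<^sub>1 \<in> fixed_points \<theta>\<^sub>1 - {0, k\<^sub>0}" and k\<^sub>2: "k\<^sub>2 \<in> fixed_points \<theta>\<^sub>1 - {0, k\<^sub>0}"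
    and \<sigma>\<^sub>1: "\<sigma>\<^sub>1 \<in> fixed_points \<theta>\<^sub>2 - {0, \<sigma>\<^sub>0}" and \<sigma>\<^sub>2: "\<sigma>\<^sub>2 \<in> fixed_points \<theta>\<^sub>2 - {0, \<sigma>\<^sub>0}"
    using A(14,15) by auto
  interpret G: metric_side q\<^sub>1 \<theta>\<^sub>1 k\<^sub>0 Gs
    using A(1,5,7-9,16,17) by unfold_locales (auto simp: A(14))
  interpret H: metric_side q\<^sub>2 \<theta>\<^sub>2 \<sigma>\<^sub>0 \<Gamma>s
    using A(2,6,10-12,16,18) by unfold_locales (auto simp: A(15))
  define \<alpha> where "\<alpha> = pairing q\<^sub>1 k\<^sub>0 k\<^sub>1"
  have \<alpha>: "pairing q\<^sub>1 k\<^sub>0 k = \<alpha>" if "k \<in> fixed_points \<theta>\<^sub>1 - {0, k\<^sub>0}" for k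
    using G.Fs_cases[OF k\<^sub>1 that] by (auto simp: \<alpha>_def G.p_t_add_t)
  \<comment> \<open>The enumerations of K and \<Sigma> have no repetition, so
    \<open>k\<^sub>2\<close> and \<open>\<sigma>\<^sub>2\<close> are the translates of
    \<open>k\<^sub>1\<close> and \<open>\<sigma>\<^sub>1\<close> by u0.\<close>
  have "card {k\<^sub>1, k\<^sub>2} = 2" "card {\<sigma>\<^sub>1, \<sigma>\<^sub>2} = 2"
    using G.card_Fs H.card_Fs by (simp_all only: A(14,15))
  then have "k\<^sub>2 \<noteq> k\<^sub>1" "\<sigma>\<^sub>2 \<noteq> \<sigma>\<^sub>1"
    by auto
  then have "k\<^sub>2 = k\<^sub>1 + k\<^sub>0" "\<sigma>\<^sub>2 = \<sigma>\<^sub>1 + \<sigma>\<^sub>0"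
    using G.Fs_cases[OF k\<^sub>1 k\<^sub>2] H.Fs_cases[OF \<sigma>\<^sub>1 \<sigma>\<^sub>2] by simp_all
  then have "q\<^sub>1 k\<^sub>2 = q\<^sub>1 k\<^sub>0 * \<alpha> * q\<^sub>1 k\<^sub>1" "q\<^sub>2 \<sigma>\<^sub>2 = q\<^sub>1 k\<^sub>0 * pairing q\<^sub>2 \<sigma>\<^sub>0 \<sigma>\<^sub>1 * q\<^sub>2 \<sigma>\<^sub>1"
    using G.q_t_eq[OF k\<^sub>1] H.q_t_eq[OF \<sigma>\<^sub>1] A(13) by (simp_all add: \<alpha>_def)
  moreover have cancel: "r \<noteq> 0 \<Longrightarrow> r = x * r \<Longrightarrow> x = 1" "r \<noteq> 0 \<Longrightarrow> r = - (x * r) \<Longrightarrow> x = -1" for r x :: complex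
    using mult_right_cancel[of r x "-1"] equation_minus_iff[of r "x * r"] by simp_all
  \<comment> \<open>These are the ratios of the two values of q on K and on \<Sigma>; (A1) and (A2)
    make one of them 1 and the other -1.\<close>
  ultimately have "q\<^sub>1 k\<^sub>0 * \<alpha> = 1 \<and> q\<^sub>1 k\<^sub>0 * pairing q\<^sub>2 \<sigma>\<^sub>0 \<sigma>\<^sub>1 = -1 \<or>
      q\<^sub>1 k\<^sub>0 * \<alpha> = -1 \<and> q\<^sub>1 k\<^sub>0 * pairing q\<^sub>2 \<sigma>\<^sub>0 \<sigma>\<^sub>1 = 1"
    using A(16) cancel[OF G.q_nonzero[of k\<^sub>1]] cancel[OF H.q_nonzero[of \<sigma>\<^sub>1]] by metis
  then have "q\<^sub>1 k\<^sub>0 * pairing q\<^sub>2 \<sigma>\<^sub>0 \<sigma>\<^sub>1 = q\<^sub>1 k\<^sub>0 * - \<alpha>"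
    by auto
  then have \<sigma>\<^sub>1_eq: "pairing q\<^sub>2 \<sigma>\<^sub>0 \<sigma>\<^sub>1 = - \<alpha>"
    by (rule mult_left_cancel[OF G.q_nonzero, THEN iffD1])
  have \<beta>: "pairing q\<^sub>2 \<sigma>\<^sub>0 \<sigma> = - \<alpha>" if "\<sigma> \<in> fixed_points \<theta>\<^sub>2 - {0, \<sigma>\<^sub>0}" for \<sigma>
    using H.Fs_cases[OF \<sigma>\<^sub>1 that] \<sigma>\<^sub>1_eq by (auto simp: H.p_t_add_t)
  have sign: "is_sign \<alpha>"
    unfolding \<alpha>_def by (rule G.is_sign_p_t)
  interpret D: fusion_data q\<^sub>1 \<theta>\<^sub>1 k\<^sub>0 Gs q\<^sub>2 \<theta>\<^sub>2 \<sigma>\<^sub>0 \<Gamma>s s f \<alpha>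
  proof
    show "s ^ 4 = 1"
      using A(16) by blast
    fix k \<sigma>
    assume k: "k \<in> fixed_points \<theta>\<^sub>1 - {0, k\<^sub>0}" and \<sigma>: "\<sigma> \<in> fixed_points \<theta>\<^sub>2 - {0, \<sigma>\<^sub>0}"
    show "f k \<sigma> = s \<or> f k \<sigma> = - s"
      using A(19) k \<sigma> by blast
    show "f (k + k\<^sub>0) \<sigma> = - \<alpha> * f k \<sigma>"
      using A(20) k \<sigma> \<beta>[OF \<sigma>] is_sign_cnj[OF sign] by (simp add: from_U_def)
    show "f k (\<sigma> + \<sigma>\<^sub>0) = \<alpha> * f k \<sigma>"
      using A(21) k \<sigma> \<alpha>[OF k] is_sign_cnj[OF sign] G.p_sym[of k k\<^sub>0] by (simp add: from_U_def)
  qed (use \<alpha> \<beta> sign in blast)+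
  have q: "k + k \<noteq> 0 \<Longrightarrow> q\<^sub>1 k\<^sub>0 = \<alpha>" if "k \<in> fixed_points \<theta>\<^sub>1 - {0, k\<^sub>0}" for k
    using G.q_t_of_double[OF that] G.Fs_double[OF that] \<alpha>[OF that] by simp
  \<comment> \<open>The value is found in \<Gamma> as \<open>q\<^sub>2 \<sigma>\<^sub>0\<close> and
    transferred by \<open>q\<^sub>1 k\<^sub>0 = q\<^sub>2 \<sigma>\<^sub>0\<close>, because q0(u0)
    is computed in G.\<close>
  have q': "\<sigma> + \<sigma> \<noteq> 0 \<Longrightarrow> q\<^sub>1 k\<^sub>0 = - \<alpha>" if "\<sigma> \<in> fixed_points \<theta>\<^sub>2 - {0, \<sigma>\<^sub>0}" for \<sigma>
    using H.q_t_of_double[OF that] H.Fs_double[OF that] \<beta>[OF that] A(13) by simp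
  have conditions: "conditions \<longleftrightarrow> fusion_conditions q\<^sub>1 \<theta>\<^sub>1 k\<^sub>0 Gs q\<^sub>2 \<theta>\<^sub>2 \<sigma>\<^sub>0 \<Gamma>s s f \<alpha>"
  proof
    assume C: conditions
    note C = C[unfolded conditions_def defs]
    show "fusion_conditions q\<^sub>1 \<theta>\<^sub>1 k\<^sub>0 Gs q\<^sub>2 \<theta>\<^sub>2 \<sigma>\<^sub>0 \<Gamma>s s f \<alpha>"
    proof
      show "CARD('h) = CARD('g) + 4"
        using C by blast
      show "(1 + \<alpha>) * (1 - s\<^sup>2 * pairing q\<^sub>1 k k) = 0" if "k \<in> fixed_points \<theta>\<^sub>1 - {0, k\<^sub>0}" for k
        using bspec[OF C[THEN conjunct2, THEN conjunct1] that] \<alpha>[OF that] by (simp add: from_U_def)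
      show "(1 - \<alpha>) * (1 + s\<^sup>2 * pairing q\<^sub>2 \<sigma> \<sigma>) = 0" if "\<sigma> \<in> fixed_points \<theta>\<^sub>2 - {0, \<sigma>\<^sub>0}" for \<sigma>
        using bspec[OF C[THEN conjunct2, THEN conjunct2, THEN conjunct1] that] \<beta>[OF that] by (simp add: from_U_def)
      show "\<alpha> = -1" if "k \<in> fixed_points \<theta>\<^sub>1 - {0, k\<^sub>0}" "k + k \<noteq> 0" for k
        using C G.cyclic_iff[OF that(1)] q[OF that] that(2) by (simp add: from_U_def)
      show "\<alpha> = 1" if "\<sigma> \<in> fixed_points \<theta>\<^sub>2 - {0, \<sigma>\<^sub>0}" "\<sigma> + \<sigma> \<noteq> 0" for \<sigma>
        using C H.cyclic_iff[OF that(1)] q'[OF that] that(2) by (simp add: from_U_def)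
    qed
  next
    assume "fusion_conditions q\<^sub>1 \<theta>\<^sub>1 k\<^sub>0 Gs q\<^sub>2 \<theta>\<^sub>2 \<sigma>\<^sub>0 \<Gamma>s s f \<alpha>"
    then interpret C: fusion_conditions q\<^sub>1 \<theta>\<^sub>1 k\<^sub>0 Gs q\<^sub>2 \<theta>\<^sub>2 \<sigma>\<^sub>0 \<Gamma>s s f \<alpha> .
    show conditions
      unfolding conditions_def defs G.cyclic_iff[OF k\<^sub>1] H.cyclic_iff[OF \<sigma>\<^sub>1]
      using C.card_eq C.cond_k C.cond_\<sigma> C.cyclic_k[OF k\<^sub>1] C.cyclic_\<sigma>[OF \<sigma>\<^sub>1] q[OF k\<^sub>1] q'[OF \<sigma>\<^sub>1] \<alpha> \<beta>
      by (simp add: from_U_def)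
  qed
  have nat: "(\<forall>x\<in>J. \<forall>y\<in>J. \<forall>z\<in>J. N x y z \<in> \<nat>) \<longleftrightarrow> conditions"
    unfolding conditions J_def N_def
    using D.fusion_conditions_if_in_Nats fusion_conditions.N_in_Nats by blast
  show ?thesis
  proof (rule conjI[OF nat], rule impI, goal_cases)
    case 1
    then interpret C: fusion_conditions q\<^sub>1 \<theta>\<^sub>1 k\<^sub>0 Gs q\<^sub>2 \<theta>\<^sub>2 \<sigma>\<^sub>0 \<Gamma>s s f \<alpha>
      unfolding conditions .
    show ?case
      unfolding defs
      by (intro conjI allI ballI;
        rule D.N_swap_left D.N_swap_right
        C.N_Zero_Zero_Zero C.N_Zero_Pi_Pi C.N_Zero_Zero_Pi C.N_Zero_Zero_K C.N_Zero_Zero_G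
        C.N_Zero_Zero_Sig C.N_Zero_Zero_Gam C.N_Zero_Pi_K C.N_Zero_Pi_G C.N_Zero_Pi_Sig
        C.N_Zero_Pi_Gam C.N_Zero_K_K C.N_Zero_G_G C.N_Zero_Sig_Sig C.N_Zero_Gam_Gam C.N_Zero_K_G
        C.N_Zero_K_Sig C.N_Zero_K_Gam C.N_Zero_G_Sig C.N_Zero_G_Gam C.N_Zero_Sig_Gam C.N_Pi_Pi_Pi
        C.N_Pi_Pi_K C.N_Pi_Pi_G C.N_Pi_Pi_Sig C.N_Pi_Pi_Gam
        C.N_Pi_K_K[OF _ _ _ _ k\<^sub>1 \<sigma>\<^sub>1] C.N_Pi_K_G C.N_Pi_K_Sig C.N_Pi_K_Gam
        C.N_Pi_G_G C.N_Pi_G_Sig C.N_Pi_G_Gam C.N_Pi_Sig_Sig[OF _ _ _ _ k\<^sub>1] C.N_Pi_Sig_Gam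
        C.N_Pi_Gam_Gam C.N_K_K_K C.N_K_K_G C.N_K_K_Sig C.N_K_K_Gam[OF _ _ _ _ _ \<sigma>\<^sub>1]
        C.N_K_G_G C.N_K_G_Sig C.N_K_G_Gam C.N_K_Sig_Sig C.N_K_Sig_Gam C.N_K_Gam_Gam C.N_G_G_G
        C.N_G_G_Sig C.N_G_G_Gam C.N_G_Sig_Sig[OF _ _ _ _ _ k\<^sub>1] C.N_G_Sig_Gam C.N_G_Gam_Gam
        C.N_Sig_Sig_Sig C.N_Sig_Sig_Gam C.N_Sig_Gam_Gam C.N_Gam_Gam_Gam;
        assumption)
  qed
qed

end
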